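(* Let $f\in\mathbb{R}[x]$, and let $h=(h_1,\ldots,h_{m_1})$ and $g=(g_1,\ldots,g_{m_2})$ be tuples of polynomials in $\mathbb{R}[x]$, $x=(x_1,\ldots,x_n)$. Let $K=\{x\in\mathbb{R}^n: h(x)=0,\ g_j(x)\ge 0\ (j=1,\ldots,m_2)\}$ and let $f_{min}$ be the optimal value of $\min f(x)$ subject to $x\in K$. For $k\in\mathbb{N}$, let $f^{pre}_k$ be the optimal value of $$\max\ \gamma\quad\text{s.t.}\quad f-\gamma\in\langle h\rangle_{2k}+Pr_k(g).$$ If the feasible set $K$ is finite, then the sequence $\{f^{pre}_k\}$ has finite convergence to $f_{min}$.
   Context: $\mathbb{R}[x]$ is the ring of real polynomials in $x=(x_1,\ldots,x_n)$, and $\mathbb{N}$ is the set of nonnegative integers. $\Sigma\mathbb{R}[x]^2$ denotes the set of sums of squares of polynomials in $\mathbb{R}[x]$. The $2k$-th truncated ideal generated by $h$ is $$\langle h\rangle_{2k}=\Big\{\sum_{i=1}^{m_1}\phi_i h_i:\ \phi_i\in\mathbb{R}[x],\ \deg(\phi_i h_i)\le 2k\text{ for each } i\Big\}.$$ The $k$-th truncated preordering $Pr_k(g)$ generated by $g$ is the $k$-th truncated quadratic module generated by all the cross products $g_1,\ldots,g_{m_2},g_1g_2,\ldots,g_{m_2-1}g_{m_2},\ldots,g_1g_2\cdots g_{m_2}$, i.e. $$Pr_k(g)=\Big\{\sum_{J\subseteq\{1,\ldots,m_2\}}\sigma_J\prod_{j\in J}g_j:\ \sigma_J\in\Sigma\mathbb{R}[x]^2,\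 \deg\Big(\sigma_J\prod_{j\in J}g_j\Big)\le 2k\text{ for each } J\Big\},$$ where the empty product is $1$. Optimal values are understood as an infimum (for $f_{min}$) and a supremum (for $f^{pre}_k$) in $\mathbb{R}\cup\{\pm\infty\}$, the latter not necessarily attained; $f_{min}=+\infty$ if $K=\emptyset$, and $f^{pre}_k=-\infty$ if no $\gamma$ is feasible. The sequence $\{f_k^{pre}\}$ (which is monotonically increasing and bounded above by $f_{min}$) has finite convergence to $f_{min}$ if $f_k^{pre}=f_{min}$ for some $k$. *)

theory Defs
  imports "HOL-Analysis.Analysis" "HOL-Library.Poly_Mapping"
begin

text \<open>
  The ring of real polynomials in the variables indexed by the finite type \<open>'n\<close>, where
  \<open>n = CARD('n)\<close>: a polynomial maps finitely many exponent vectors to nonzero coefficients.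
  Addition and (convolution) multiplication are those of \<^theory>\<open>HOL-Library.Poly_Mapping\<close>.
\<close>
type_synonym 'n rpoly = "('n \<Rightarrow>\<^sub>0 nat) \<Rightarrow>\<^sub>0 real"

definition poly_const :: "real \<Rightarrow> 'n::finite rpoly" where
  "poly_const c = Poly_Mapping.single 0 c"

definition poly_eval :: "'n::finite rpoly \<Rightarrow> real ^ 'n \<Rightarrow> real" where
  "poly_eval p x =
     (\<Sum>a\<in>Poly_Mapping.keys p. Poly_Mapping.lookup p a * (\<Prod>i\<in>UNIV. (x $ i) ^ Poly_Mapping.lookup a i))"

text \<open>
  The total degree. The zero polynomial gets degree \<open>0\<close>; since degrees are only ever bounded
  above by a natural number, this is equivalent to the convention \<open>-\<infinity>\<close>.
\<close>
definition poly_deg :: "'n::finite rpoly \<Rightarrow> nat" where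
  "poly_deg p = Max (insert 0 ((\<lambda>a. \<Sum>i\<in>UNIV. Poly_Mapping.lookup a i) ` Poly_Mapping.keys p))"

definition sos :: "'n::finite rpoly set" where
  "sos = {\<Sum>i<N. q i ^ 2 | (N::nat) q. True}"

text \<open>
  A tuple \<open>(h\<^sub>1, \<dots>, h\<^sub>m)\<close> of polynomials is given by its length \<open>m\<close> and a function
  \<open>h\<close> on indices, of which only the values on \<open>{1..m}\<close> are used.
\<close>
definition trunc_ideal :: "nat \<Rightarrow> nat \<Rightarrow> (nat \<Rightarrow> 'n::finite rpoly) \<Rightarrow> 'n rpoly set" where
  "trunc_ideal d m h =
     {\<Sum>i\<in>{1..m}. \<phi> i * h i | \<phi>. \<forall>i\<in>{1..m}. poly_deg (\<phi> i * h i) \<le> d}"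

definition trunc_preordering :: "nat \<Rightarrow> nat \<Rightarrow> (nat \<Rightarrow> 'n::finite rpoly) \<Rightarrow> 'n rpoly set" where
  "trunc_preordering k m g =
     {\<Sum>J\<in>Pow {1..m}. \<sigma> J * (\<Prod>j\<in>J. g j) | \<sigma>.
        \<forall>J\<in>Pow {1..m}. \<sigma> J \<in> sos \<and> poly_deg (\<sigma> J * (\<Prod>j\<in>J. g j)) \<le> 2 * k}"

definition feasible_set ::
  "nat \<Rightarrow> (nat \<Rightarrow> 'n::finite rpoly) \<Rightarrow> nat \<Rightarrow> (nat \<Rightarrow> 'n rpoly) \<Rightarrow> (real ^ 'n) set" where
  "feasible_set m1 h m2 g =
     {x. (\<forall>i\<in>{1..m1}. poly_eval (h i) x = 0) \<and> (\<forall>j\<in>{1..m2}. poly_eval (g j) x \<ge> 0)}"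

text \<open>
  In \<^typ>\<open>ereal\<close> the infimum over the empty set is \<open>\<infinity>\<close> and the supremum is \<open>-\<infinity>\<close>.
\<close>
definition f_min :: "'n::finite rpoly \<Rightarrow> nat \<Rightarrow> (nat \<Rightarrow> 'n rpoly) \<Rightarrow> nat \<Rightarrow> (nat \<Rightarrow> 'n rpoly) \<Rightarrow> ereal" where
  "f_min f m1 h m2 g = (INF x\<in>feasible_set m1 h m2 g. ereal (poly_eval f x))"

definition f_pre ::
  "'n::finite rpoly \<Rightarrow> nat \<Rightarrow> (nat \<Rightarrow> 'n rpoly) \<Rightarrow> nat \<Rightarrow> (nat \<Rightarrow> 'n rpoly) \<Rightarrow> nat \<Rightarrow> ereal" where
  "f_pre f m1 h m2 g k =
     (SUP \<gamma>\<in>{\<gamma>. \<exists>p\<in>trunc_ideal (2 * k) m1 h. \<exists>q\<in>trunc_preordering k m2 g.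
                 f - poly_const \<gamma> = p + q}. ereal \<gamma>)"

definition finite_convergence :: "(nat \<Rightarrow> ereal) \<Rightarrow> ereal \<Rightarrow> bool" where
  "finite_convergence s L \<longleftrightarrow> (\<exists>k. s k = L)"

end

theory Submission
  imports Defs "HOL-Algebra.Algebraic_Closure_Type"
begin

text \<open>
  Every polynomial in \<open>\<langle>h\<rangle>\<^sub>2\<^sub>k + Pr\<^sub>k(g)\<close> is nonnegative on the feasible set \<open>K\<close>, so the values
  of the relaxations never exceed the minimum. The content of the theorem is that for finite
  \<open>K\<close> a single \<open>k\<close> suffices for all \<open>\<gamma>\<close> below the minimum.

  Suppose first that \<open>K\<close> is nonempty with minimum \<open>m\<close> of \<open>f\<close>. Since \<open>K\<close> is finite,
  some polynomial \<open>q\<close> satisfies \<open>q\<^sup>2 = f - m\<close> on \<open>K\<close> (lemma \<open>interpolation\<close>), so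
  \<open>p = q\<^sup>2 - (f - m)\<close> vanishes on \<open>K\<close>. By the Positivstellensatz
  (\<open>positivstellensatz_vanishing\<close>) the negative of some even power of \<open>p\<close> lies in the
  preordering generated by the constraints, with some degree bound; the exponent may be taken to be
  a power of two. For every \<open>\<epsilon> > 0\<close> one can
  write \<open>\<epsilon> - p\<close> as a nonnegative combination of that negative power and of squares
  \<open>(a + b p\<^sup>t)\<^sup>2\<close> with finitely many exponents \<open>t\<close>; only the real numbers \<open>a\<close>, \<open>b\<close> depend on \<open>\<epsilon>\<close>,
  the degrees do not (\<open>epsilon_minus_in_cone\<close>). Hence
  \<open>f - (m - \<epsilon>) = q\<^sup>2 + (\<epsilon> - p)\<close> is feasible for one fixed \<open>k\<close> and all \<open>\<epsilon> > 0\<close>. The supremum is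
  therefore \<open>m\<close>, although it need not be attained. If \<open>K\<close> is empty, the Positivstellensatz puts
  \<open>-1\<close> into the preordering; as a difference of two squares, \<open>f\<close> then lies in it too, and
  so does \<open>f - \<gamma>\<close> for every \<open>\<gamma>\<close>, again with a degree bound independent of \<open>\<gamma>\<close>.

  The Positivstellensatz is proved in three stages. A preordering that contains no
  \<open>- p\<^sup>2\<^sup>l\<close> is enlarged by Zorn's lemma to a prime cone \<open>P\<close>, an ordering of the ring modulo
  a prime ideal not containing \<open>p\<close>. Modulo that ideal the polynomial ring becomes an ordered
  domain; its fraction field has a real closure \<open>M\<close>, and the canonical morphism
  \<open>\<phi>\<close> into \<open>M\<close> turns membership in \<open>P\<close> into nonnegativity. Finally the signs
  under \<open>\<phi>\<close> of finitely many polynomials occur at a point of \<open>\<real>\<^sup>n\<close>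
  (\<open>morphism_signs_realized\<close>); applied to the constraints and to \<open>p\<close>, this gives a
  feasible point at which \<open>p\<close> does not vanish.

  The last step eliminates one variable after the other. It rests on the observation
  behind Hoermander's proof of the Tarski-Seidenberg theorem: over any real closed field,
  the order of the roots of a finite family of univariate polynomials, and the signs of the family
  between them, are determined by the signs of finitely many polynomial expressions in the
  coefficients (\<open>sign_transfer\<close>). The real closure is obtained inside the algebraic closure by
  maximizing an ordered subfield; that it has the intermediate value property for
  polynomials follows from an argument of Artin and Whaples
  (\<open>cone_field_sign_change_root\<close>).
\<close>

hide_const (open) Polynomials.degree Polynomials.lead_coeff up_ring.coeff up_ring.monom module.smult Coset.order
no_notation fps_nth (infixl "$" 75)

section \<open>Polynomials over real closed fields\<close>

text \<open>
  Among ordered fields, the real closed ones are those in which polynomials have the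
  intermediate value property. It is enough to ask for a root anywhere: roots outside the
  interval can be divided out (lemma \<open>poly_root_between\<close>).
\<close>
class real_closed_field = linordered_field +
  assumes sign_change_root:
    "(\<Sum>k\<le>n. f k * a ^ k) < 0 \<Longrightarrow> 0 < (\<Sum>k\<le>n. f k * b ^ k) \<Longrightarrow> \<exists>c. (\<Sum>k\<le>n. f k * c ^ k) = 0"

instance real :: real_closed_field
proof
  fix f :: "nat \<Rightarrow> real" and n a b
  let ?g = "\<lambda>x. \<Sum>k\<le>n. f k * x ^ k"
  assume neg: "?g a < 0" and pos: "0 < ?g b"
  have cont: "isCont ?g x" for x by (intro continuous_intros)
  show "\<exists>c. ?g c = 0"
  proof (cases "a \<le> b")
    case True
    then show ?thesis using IVT[of ?g a 0 b] neg pos cont by force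
  next
    case False
    then show ?thesis using IVT2[of ?g a 0 b] neg pos cont by force
  qed
qed

lemma poly_sign_change_root:
  fixes p :: "'a::real_closed_field poly"
  assumes "poly p a < 0" "0 < poly p b"
  shows "\<exists>c. poly p c = 0"
  using sign_change_root[of "coeff p" a "degree p" b] assms by (simp add: poly_altdef)

text \<open>
  A root outside the interval contributes a linear factor of constant sign there. Dividing it
  out keeps the sign change, so induction on the degree reaches a root inside.
\<close>
lemma poly_root_between:
  fixes p :: "'a::real_closed_field poly"
  assumes "a < b" "poly p a * poly p b < 0"
  shows "\<exists>c. a < c \<and> c < b \<and> poly p c = 0"
  using assms(2)
proof (induction "degree p" arbitrary: p rule: less_induct)
  case less
  have "\<exists>c. poly p c = 0"
    using poly_sign_change_root[of p a b] poly_sign_change_root[of p b a] less.prems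
    by (auto simp: mult_less_0_iff)
  then obtain c where c: "poly p c = 0" by blast
  then obtain q where q: "p = [:-c, 1:] * q" by (auto simp: poly_eq_0_iff_dvd)
  have "p \<noteq> 0" using less.prems by auto
  then have deg: "degree q < degree p" unfolding q by (subst degree_mult_eq) auto
  show ?case
  proof (cases "a < c \<and> c < b")
    case False
    have "c \<noteq> a" "c \<noteq> b" using c less.prems by auto
    with False have "0 < (a - c) * (b - c)"
      using assms(1) by (auto simp: zero_less_mult_iff)
    moreover have "poly p a * poly p b = ((a - c) * (b - c)) * (poly q a * poly q b)"
      unfolding q by (simp add: algebra_simps)
    ultimately have "poly q a * poly q b < 0"
      using less.prems by (metis mult_less_cancel_left_pos mult_zero_right)
    from less.hyps[OF deg this] show ?thesis unfolding q by auto
  qed (use c in auto)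
qed

lemma pderiv_two_root_powers:
  fixes A B q :: "'a::idom poly"
  assumes "pderiv A = 1" "pderiv B = 1"
  shows "pderiv (A ^ Suc m * (B ^ Suc n * q)) =
    A ^ m * B ^ n * (smult (of_nat (Suc m)) (B * q) + smult (of_nat (Suc n)) (A * q) + A * B * pderiv q)"
  unfolding pderiv_mult pderiv_power_Suc assms
  by (simp add: algebra_simps del: of_nat_Suc)

text \<open>
  Without completeness there is no maximum to look at. Instead, for consecutive roots \<open>a\<close> and \<open>d\<close>
  write \<open>p = (x - a)\<^sup>m (x - d)\<^sup>n q\<close> with \<open>q\<close> of constant sign on \<open>[a, d]\<close>; after removal of the powers
  of \<open>x - a\<close> and \<open>x - d\<close>, the derivative has opposite signs at \<open>a\<close> and \<open>d\<close>.
\<close>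
lemma poly_Rolle:
  fixes p :: "'a::real_closed_field poly"
  assumes "a < b" "poly p a = 0" "poly p b = 0"
  shows "\<exists>c. a < c \<and> c < b \<and> poly (pderiv p) c = 0"
proof (cases "p = 0")
  case True
  then show ?thesis using dense[OF assms(1)] by auto
next
  case False
  let ?R = "{x. poly p x = 0 \<and> a < x}"
  have fin: "finite ?R" by (rule finite_subset[OF _ poly_roots_finite[OF False]]) auto
  define d where "d = Min ?R"
  have b: "b \<in> ?R" using assms by auto
  then have d: "d \<in> ?R" "d \<le> b" using Min_in[OF fin] Min_le[OF fin b] unfolding d_def by blast+
  have gap: "poly p x \<noteq> 0" if "a < x" "x < d" for x
    using Min_le[OF fin, of x] that by (auto simp: d_def)
  obtain q1 where q1: "p = [:-a, 1:] ^ order a p * q1" "\<not> [:-a, 1:] dvd q1"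
    using order_decomp[OF False] by blast
  have q10: "q1 \<noteq> 0" using q1 by auto
  obtain q where q: "q1 = [:-d, 1:] ^ order d q1 * q" "\<not> [:-d, 1:] dvd q"
    using order_decomp[OF q10] by blast
  have qa: "poly q a \<noteq> 0" using q1(2) by (metis dvd_mult poly_eq_0_iff_dvd q(1))
  have qd: "poly q d \<noteq> 0" using q(2) by (simp add: poly_eq_0_iff_dvd)
  have "order a p \<noteq> 0" using assms(2) False by (simp add: order_root)
  then obtain m where m: "order a p = Suc m" by (metis not0_implies_Suc)
  have "poly p d = (d - a) ^ order a p * poly q1 d"
    using arg_cong[OF q1(1), of "\<lambda>r. poly r d"] by (simp add: poly_power)
  then have "poly q1 d = 0" using d(1) by auto
  then have "order d q1 \<noteq> 0" using q10 by (simp add: order_root)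
  then obtain n where n: "order d q1 = Suc n" by (metis not0_implies_Suc)
  let ?A = "[:-a, 1:]" let ?B = "[:-d, 1:]"
  have p: "p = ?A ^ Suc m * (?B ^ Suc n * q)" using q1(1) q(1) m n by simp
  define r where "r = smult (of_nat (Suc m)) (?B * q) + smult (of_nat (Suc n)) (?A * q) + ?A * ?B * pderiv q"
  have pd: "pderiv p = ?A ^ m * ?B ^ n * r"
    unfolding p r_def by (rule pderiv_two_root_powers) (simp_all add: pderiv_pCons)
  have sg: "0 < poly q a * poly q d"
  proof (rule ccontr)
    assume "\<not> 0 < poly q a * poly q d"
    then have "poly q a * poly q d < 0" using qa qd by (simp add: mult_less_0_iff zero_less_mult_iff) (metis linorder_neqE)
    then obtain c where "a < c" "c < d" "poly q c = 0" using poly_root_between[of a d q] d(1) by auto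
    then show False using gap[of c] unfolding p by simp
  qed
  have "poly r a = of_nat (Suc m) * ((a - d) * poly q a)" "poly r d = of_nat (Suc n) * ((d - a) * poly q d)"
    by (simp_all add: r_def algebra_simps)
  then have "poly r a * poly r d = (of_nat (Suc m) * of_nat (Suc n)) * (((a - d) * (d - a)) * (poly q a * poly q d))"
    by (simp add: mult_ac del: of_nat_Suc)
  moreover have "(a - d) * (d - a) < 0" using d(1) by (auto simp: mult_less_0_iff)
  moreover have "(0::'a) < of_nat (Suc m) * of_nat (Suc n)" by (simp del: of_nat_Suc)
  ultimately have "poly r a * poly r d < 0"
    using sg by (metis mult_pos_neg mult.commute)
  then obtain c where "a < c" "c < d" "poly r c = 0" using poly_root_between[of a d r] d(1) by auto
  then show ?thesis using d(2) by (intro exI[of _ c]) (auto simp: pd)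
qed

lemma poly_mean_value:
  fixes p :: "'a::real_closed_field poly"
  assumes "a < b"
  shows "\<exists>c. a < c \<and> c < b \<and> poly p b - poly p a = (b - a) * poly (pderiv p) c"
proof -
  define s where "s = (poly p b - poly p a) / (b - a)"
  have s: "s * (b - a) = poly p b - poly p a" using assms by (simp add: s_def)
  define r where "r = p - [:poly p a - s * a, s:]"
  have "poly r a = 0" "poly r b = 0" using s by (simp_all add: r_def algebra_simps)
  from poly_Rolle[OF assms this] obtain c where c: "a < c" "c < b" "poly (pderiv r) c = 0" by blast
  then have "poly (pderiv p) c = s" by (simp add: r_def pderiv_diff pderiv_pCons)
  then show ?thesis using c s by (auto simp: mult.commute)
qed

lemma poly_strict_increasing:
  fixes p :: "'a::real_closed_field poly"
  assumes "a < b" "\<And>t. a < t \<Longrightarrow> t < b \<Longrightarrow> 0 < poly (pderiv p) t"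
  shows "poly p a < poly p b"
proof -
  obtain c where "a < c" "c < b" "poly p b - poly p a = (b - a) * poly (pderiv p) c"
    using poly_mean_value[OF assms(1)] by blast
  moreover have "0 < (b - a) * poly (pderiv p) c" using calculation assms by simp
  ultimately show ?thesis by simp
qed

text \<open>
  The positive lower bound \<open>e\<close> makes the induction work: \<open>x p(x)\<close> exceeds any constant
  once \<open>p(x)\<close> stays above \<open>e\<close>. Mere positivity of \<open>p(x)\<close> would not give a lower bound for the product.
\<close>
lemma poly_eventually_pos:
  fixes p :: "'a::linordered_field poly"
  assumes "0 < lead_coeff p"
  shows "\<exists>N e. 0 < e \<and> (\<forall>x>N. e \<le> poly p x)"
  using assms
proof (induction p)
  case (pCons a p)
  show ?case
  proof (cases "p = 0")
    case False
    then obtain N e where e: "0 < e" and N: "\<forall>x>N. e \<le> poly p x" using pCons by auto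
    have "1 \<le> poly (pCons a p) x" if x: "x > max 0 (max N ((1 - a) / e))" for x
    proof -
      have "1 - a \<le> x * e" using x e by (simp add: pos_divide_less_eq less_imp_le)
      also have "\<dots> \<le> x * poly p x" using x N by (intro mult_left_mono) auto
      finally show ?thesis by simp
    qed
    then show ?thesis by (intro exI[of _ "max 0 (max N ((1 - a) / e))"] exI[of _ 1]) auto
  qed (use pCons in auto)
qed simp

section \<open>Matching the roots of polynomials over two real closed fields\<close>

text \<open>
  The two numbers live in different ordered fields, so their signs cannot be compared
  by an equation between values of \<^const>\<open>sgn\<close>.
\<close>
definition same_sign :: "'a::linordered_field \<Rightarrow> 'b::linordered_field \<Rightarrow> bool" where
  "same_sign x y \<longleftrightarrow> (x < 0 \<longleftrightarrow> y < 0) \<and> (0 < x \<longleftrightarrow> 0 < y)"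

lemma same_sign_sym: "same_sign x y \<Longrightarrow> same_sign y x"
  by (auto simp: same_sign_def)

lemma same_sign_uminus [simp]: "same_sign (- x) (- y) \<longleftrightarrow> same_sign x y"
  by (auto simp: same_sign_def)

lemma same_sign_0_iff: "same_sign x y \<Longrightarrow> x = 0 \<longleftrightarrow> y = 0"
  by (auto simp: same_sign_def)

text \<open>
  A finite set \<open>Z\<close> of pairs records which point of the first line corresponds to which point of
  the second. Two points are in the same position if they lie in corresponding cells of the two
  subdivisions: both on a pair of \<open>Z\<close>, or both in the same gap.
\<close>
definition same_pos ::
  "('a::linordered_field \<times> 'b::linordered_field) set \<Rightarrow> 'a \<Rightarrow> 'b \<Rightarrow> bool" where
  "same_pos Z x y \<longleftrightarrow> (\<forall>(z, w)\<in>Z. same_sign (x - z) (y - w))"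

definition aligned :: "('a::linordered_field \<times> 'b::linordered_field) set \<Rightarrow> bool" where
  "aligned Z \<longleftrightarrow> finite Z \<and> (\<forall>(z, w)\<in>Z. same_pos Z z w)"

definition matched ::
  "('a::linordered_field \<times> 'b::linordered_field) set \<Rightarrow> 'a poly \<Rightarrow> 'b poly \<Rightarrow> bool" where
  "matched Z p q \<longleftrightarrow> (\<forall>x y. same_pos Z x y \<longrightarrow> same_sign (poly p x) (poly q y))"

lemma same_posD:
  assumes "same_pos Z x y" "(z, w) \<in> Z"
  shows "x < z \<longleftrightarrow> y < w" "z < x \<longleftrightarrow> w < y" "x = z \<longleftrightarrow> y = w"
proof -
  have s: "same_sign (x - z) (y - w)" using assms by (auto simp: same_pos_def)
  then show "x < z \<longleftrightarrow> y < w" "z < x \<longleftrightarrow> w < y" by (auto simp: same_sign_def)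
  show "x = z \<longleftrightarrow> y = w" using same_sign_0_iff[OF s] by auto
qed

lemma same_pos_converse: "same_pos (Z\<inverse>) y x \<longleftrightarrow> same_pos Z x y"
  by (auto simp: same_pos_def intro: same_sign_sym)

lemma aligned_converse: "aligned (Z\<inverse>) \<longleftrightarrow> aligned Z"
  by (auto simp: aligned_def same_pos_converse)

lemma matched_converse: "matched (Z\<inverse>) q p \<longleftrightarrow> matched Z p q"
  by (auto simp: matched_def same_pos_converse intro: same_sign_sym)

lemma matched_uminus: "matched Z (- p) (- q) \<longleftrightarrow> matched Z p q"
  by (auto simp: matched_def)

lemma matched_antimono: "matched Z p q \<Longrightarrow> Z \<subseteq> Z' \<Longrightarrow> matched Z' p q"
  unfolding matched_def same_pos_def by blast

lemma matchedD: "matched Z p q \<Longrightarrow> same_pos Z x y \<Longrightarrow> same_sign (poly p x) (poly q y)"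
  by (auto simp: matched_def)

lemma same_pos_fst_iff:
  assumes "same_pos Z x y"
  shows "x \<in> fst ` Z \<longleftrightarrow> y \<in> snd ` Z"
  using same_posD(3)[OF assms] by force

lemma same_pos_between:
  assumes "same_pos Z a y" "same_pos Z b y" "a \<le> x" "x \<le> b"
  shows "same_pos Z x y"
  unfolding same_pos_def
proof (intro ballI, clarify)
  fix z w assume zw: "(z, w) \<in> Z"
  have "x < z \<longleftrightarrow> y < w" "z < x \<longleftrightarrow> w < y"
    using same_posD(1,2)[OF assms(1) zw] same_posD(1,2)[OF assms(2) zw] assms(3,4) by auto
  then show "same_sign (x - z) (y - w)" by (simp add: same_sign_def)
qed

lemma same_pos_between':
  assumes "same_pos Z x a" "same_pos Z x b" "a \<le> y" "y \<le> b"
  shows "same_pos Z x y"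
  using same_pos_between[of "Z\<inverse>" a x b y] assms by (simp add: same_pos_converse)

text \<open>
  Density and the absence of end points, for finitely many constraints at once.
\<close>
lemma separated_by_finite:
  fixes L U :: "'a::linordered_field set"
  assumes "finite L" "finite U" "\<And>l u. l \<in> L \<Longrightarrow> u \<in> U \<Longrightarrow> l < u"
  shows "\<exists>x. (\<forall>l\<in>L. l < x) \<and> (\<forall>u\<in>U. x < u)"
proof -
  have L: "L = {} \<or> (Max L \<in> L \<and> (\<forall>l\<in>L. l \<le> Max L))" using Max_in[OF assms(1)] Max_ge[OF assms(1)] by blast
  have U: "U = {} \<or> (Min U \<in> U \<and> (\<forall>u\<in>U. Min U \<le> u))" using Min_in[OF assms(2)] Min_le[OF assms(2)] by blast
  consider "L = {}" "U = {}" | "L = {}" "U \<noteq> {}" | "L \<noteq> {}" "U = {}" | "L \<noteq> {}" "U \<noteq> {}" by blast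
  then show ?thesis
  proof cases
    case 2
    obtain x where "x < Min U" using lt_ex by blast
    then show ?thesis using U 2 by (intro exI[of _ x]) auto
  next
    case 3
    obtain x where "Max L < x" using gt_ex by blast
    then show ?thesis using L 3 by (intro exI[of _ x]) auto
  next
    case 4
    then have "Max L < Min U" using L U assms(3) by blast
    then obtain x where "Max L < x" "x < Min U" using dense by blast
    then show ?thesis using L U 4 by (intro exI[of _ x]) force
  qed auto
qed

lemma same_pos_exists:
  fixes Z :: "('a::linordered_field \<times> 'b::linordered_field) set"
  assumes "aligned Z"
  shows "\<exists>x. same_pos Z x y"
proof (cases "y \<in> snd ` Z")
  case True
  then obtain x where "(x, y) \<in> Z" by auto
  then show ?thesis using assms unfolding aligned_def by blast
next
  case False
  have fin: "finite Z" using assms by (simp add: aligned_def)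
  let ?L = "fst ` {(z, w)\<in>Z. w < y}" let ?U = "fst ` {(z, w)\<in>Z. y < w}"
  have "\<exists>x. (\<forall>l\<in>?L. l < x) \<and> (\<forall>u\<in>?U. x < u)"
  proof (rule separated_by_finite)
    show "finite ?L" "finite ?U" using fin by (auto intro: finite_subset[OF _ fin])
    fix l u assume "l \<in> ?L" "u \<in> ?U"
    then obtain w w' where w: "(l, w) \<in> Z" "w < y" "(u, w') \<in> Z" "y < w'" by auto
    then have "same_pos Z l w" using assms by (auto simp: aligned_def)
    from same_posD(1)[OF this w(3)] show "l < u" using w by auto
  qed
  then obtain x where x: "\<forall>l\<in>?L. l < x" "\<forall>u\<in>?U. x < u" by blast
  have "same_sign (x - z) (y - w)" if zw: "(z, w) \<in> Z" for z w
  proof (cases "w < y")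
    case True
    then have "z < x" using x zw by force
    with True show ?thesis by (simp add: same_sign_def)
  next
    case F: False
    then have w: "y < w" using False zw by force
    then have "x < z" using x zw by force
    with w show ?thesis by (simp add: same_sign_def)
  qed
  then show ?thesis by (auto simp: same_pos_def)
qed

lemma same_pos_open:
  assumes "aligned Z" "same_pos Z x y" "x \<notin> fst ` Z"
  shows "\<exists>a<x. \<exists>b>x. same_pos Z a y \<and> same_pos Z b y"
proof -
  have fin: "finite (fst ` Z)" using assms(1) by (simp add: aligned_def)
  have "\<exists>a. (\<forall>l\<in>{z\<in>fst ` Z. z < x}. l < a) \<and> (\<forall>u\<in>{x}. a < u)"
    by (rule separated_by_finite) (use fin in auto)
  then obtain a where a: "\<And>z. z \<in> fst ` Z \<Longrightarrow> z < x \<Longrightarrow> z < a" "a < x" by blast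
  have "\<exists>b. (\<forall>l\<in>{x}. l < b) \<and> (\<forall>u\<in>{z\<in>fst ` Z. x < z}. b < u)"
    by (rule separated_by_finite) (use fin in auto)
  then obtain b where b: "\<And>z. z \<in> fst ` Z \<Longrightarrow> x < z \<Longrightarrow> b < z" "x < b" by blast
  have "same_sign (a - z) (y - w) \<and> same_sign (b - z) (y - w)" if zw: "(z, w) \<in> Z" for z w
  proof -
    have zZ: "z \<in> fst ` Z" using zw by force
    then have "z \<noteq> x" using assms(3) by blast
    then consider "z < x" | "x < z" by fastforce
    then show ?thesis
    proof cases
      case 1
      then have "w < y" "z < a" using same_posD(2)[OF assms(2) zw] a(1)[OF zZ] by auto
      then show ?thesis using b(2) 1 by (auto simp: same_sign_def)
    next
      case 2
      then have "y < w" "b < z" using same_posD(1)[OF assms(2) zw] b(1)[OF zZ] by auto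
      then show ?thesis using a(2) 2 by (auto simp: same_sign_def)
    qed
  qed
  then have "same_pos Z a y" "same_pos Z b y" unfolding same_pos_def by auto
  then show ?thesis using a b by blast
qed

text \<open>
  In a gap, \<open>p\<close> has the same sign everywhere, namely that of \<open>q\<close> at any point of the corresponding
  gap. A root in the open gap would make \<open>p\<close> vanish at infinitely many points.
\<close>
lemma matched_root_in_fst:
  assumes "aligned Z" "matched Z p q" "p \<noteq> 0" "poly p x = 0"
  shows "x \<in> fst ` Z"
proof (rule ccontr)
  assume x: "x \<notin> fst ` Z"
  have "aligned (Z\<inverse>)" using assms(1) by (simp add: aligned_converse)
  from same_pos_exists[OF this, of x] obtain y where y: "same_pos Z x y"
    by (auto simp: same_pos_converse)
  obtain a b where ab: "a < x" "x < b" "same_pos Z a y" "same_pos Z b y"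
    using same_pos_open[OF assms(1) y x] by blast
  have qy: "poly q y = 0" using same_sign_0_iff[OF matchedD[OF assms(2) y]] assms(4) by simp
  have "poly p t = 0" if "t \<in> {a<..<b}" for t
    using same_sign_0_iff[OF matchedD[OF assms(2)], of t y] same_pos_between[OF ab(3,4), of t] that qy by auto
  then have "{a<..<b} \<subseteq> {t. poly p t = 0}" by blast
  then have "finite {a<..<b}" using poly_roots_finite[OF assms(3)] finite_subset by blast
  then show False using ab infinite_Ioo[of a b] by auto
qed

text \<open>
  Where the derivative is positive, a negative value somewhere in a gap means negativity near its left
  end. That can be read off from data common to both fields: the sign of the
  polynomials at the left end point, or the behaviour at minus infinity if the gap has none.
\<close>
lemma cell_negative_value:
  fixes p :: "'a::real_closed_field poly" and q :: "'b::real_closed_field poly"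
  assumes Z: "aligned Z" and dp: "matched Z (pderiv p) (pderiv q)"
    and ends: "\<And>z w. (z, w) \<in> Z \<Longrightarrow> same_sign (poly p z) (poly q w)"
    and xy: "same_pos Z x y" "x \<notin> fst ` Z"
    and inc: "0 < poly (pderiv p) x" and neg: "poly p x < 0"
  shows "\<exists>y'. same_pos Z x y' \<and> poly q y' < 0"
proof -
  have dq: "0 < poly (pderiv q) t" if "same_pos Z x t" for t
    using matchedD[OF dp that] inc by (simp add: same_sign_def)
  have dpx: "0 < poly (pderiv p) t" if "same_pos Z t y" for t
    using matchedD[OF dp that] dq[OF xy(1)] by (simp add: same_sign_def)
  have y: "y \<notin> snd ` Z" using same_pos_fst_iff[OF xy(1)] xy(2) by simp
  have fin: "finite (fst ` Z)" using Z by (simp add: aligned_def)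
  show ?thesis
  proof (cases "\<exists>z\<in>fst ` Z. z < x")
    case False
    have cell: "same_pos Z x t" if "t \<le> y" for t
    proof -
      have "same_sign (x - z) (t - w)" if zw: "(z, w) \<in> Z" for z w
      proof -
        have "x < z" using False xy(2) zw by (metis fst_conv image_eqI linorder_neqE)
        moreover have "y < w" using same_posD(1)[OF xy(1) zw] calculation by simp
        ultimately show ?thesis using \<open>t \<le> y\<close> by (simp add: same_sign_def)
      qed
      then show ?thesis by (auto simp: same_pos_def)
    qed
    \<comment> \<open>the derivative is positive up to \<open>y\<close>, so \<open>q\<close> tends to minus infinity on the left\<close>
    define r where "r = - pcompose q [:0, -1:]"
    have dr: "pderiv r = pcompose (pderiv q) [:0, -1:]"
      by (simp add: r_def pderiv_minus pderiv_pcompose pderiv_pCons)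
    have r: "poly r t = - poly q (- t)" "poly (pderiv r) t = poly (pderiv q) (- t)" for t
      by (simp add: r_def poly_pcompose, simp add: dr poly_pcompose)
    have nz: "pderiv r \<noteq> 0" using dq[OF cell[of y]] r(2)[of "- y"] by auto
    have "0 < lead_coeff (pderiv r)"
    proof (rule ccontr)
      assume "\<not> 0 < lead_coeff (pderiv r)"
      then have "0 < lead_coeff (- pderiv r)" using nz by (auto simp: le_less not_less)
      then obtain N e where N: "0 < e" "\<forall>t>N. e \<le> poly (- pderiv r) t" using poly_eventually_pos by blast
      obtain t where t: "max N (- y) < t" using gt_ex by blast
      then have "0 < poly (pderiv q) (- t)" by (intro dq cell) auto
      moreover have "e \<le> poly (- pderiv r) t" using N t by simp
      ultimately show False using r(2)[of t] N(1) by simp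
    qed
    moreover have "degree r \<noteq> 0" using nz by (auto simp: pderiv_eq_0_iff)
    ultimately have "0 < lead_coeff r" 
      by (simp add: degree_pderiv coeff_pderiv zero_less_mult_iff)
    then obtain N e where N: "0 < e" "\<forall>t>N. e \<le> poly r t" using poly_eventually_pos by blast
    obtain t where t: "max N (- y) < t" using gt_ex by blast
    then have "e \<le> poly r t" using N by simp
    then have "poly q (- t) < 0" using r(1)[of t] N(1) by simp
    moreover have "same_pos Z x (- t)" using t by (intro cell) auto
    ultimately show ?thesis by blast
  next
    case True
    let ?L = "{z \<in> fst ` Z. z < x}"
    have L: "finite ?L" "?L \<noteq> {}" using fin True by auto
    define z where "z = Max ?L"
    have z: "z \<in> ?L" "\<And>z'. z' \<in> ?L \<Longrightarrow> z' \<le> z"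
      unfolding z_def using Max_in[OF L] Max_ge[OF L(1)] by blast+
    then obtain w where w: "(z, w) \<in> Z" "z < x" by auto
    then have wy: "w < y" using same_posD(2)[OF xy(1)] by simp
    have zw: "same_pos Z z w" using Z w by (auto simp: aligned_def)
    have cell: "same_pos Z t y" if "z < t" "t \<le> x" for t
    proof -
      have "same_sign (t - z') (y - w')" if zw': "(z', w') \<in> Z" for z' w'
      proof (cases "z' < x")
        case True
        then have "z' \<le> z" using z zw' by force
        moreover have "w' < y" using True same_posD(2)[OF xy(1) zw'] by simp
        ultimately show ?thesis using that \<open>z < t\<close> by (simp add: same_sign_def)
      next
        case False
        then have "x < z'" using zw' xy(2) by (metis fst_conv image_eqI linorder_neqE)
        moreover have "y < w'" using calculation same_posD(1)[OF xy(1) zw'] by simp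
        ultimately show ?thesis using that \<open>t \<le> x\<close> by (simp add: same_sign_def)
      qed
      then show ?thesis by (auto simp: same_pos_def)
    qed
    have cell': "same_pos Z x t" if "w < t" "t \<le> y" for t
    proof -
      have "same_sign (x - z') (t - w')" if zw': "(z', w') \<in> Z" for z' w'
      proof (cases "z' < x")
        case True
        then have "z' \<le> z" using z zw' by force
        then have "w' \<le> w" using same_posD[OF zw zw'] by auto
        then show ?thesis using True \<open>w < t\<close> by (simp add: same_sign_def)
      next
        case False
        then have "x < z'" using zw' xy(2) by (metis fst_conv image_eqI linorder_neqE)
        moreover have "y < w'" using calculation same_posD(1)[OF xy(1) zw'] by simp
        ultimately show ?thesis using that \<open>t \<le> y\<close> by (simp add: same_sign_def)
      qed
      then show ?thesis by (auto simp: same_pos_def)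
    qed
    have "poly p z < poly p x" using w(2) by (intro poly_strict_increasing dpx cell) auto
    then have qw: "poly q w < 0" using ends[OF w(1)] neg by (simp add: same_sign_def)
    show ?thesis
    proof (cases "poly q y < 0")
      case False
      have "\<exists>c. w < c \<and> c \<le> y \<and> poly q c = 0"
      proof (cases "poly q y = 0")
        case nz: False
        then show ?thesis using poly_root_between[OF wy, of q] qw False
          by (auto simp: mult_less_0_iff intro: less_imp_le)
      qed (use wy in auto)
      then obtain c where c: "w < c" "c \<le> y" "poly q c = 0" by blast
      obtain d where d: "w < d" "d < c" using dense[OF c(1)] by blast
      have "poly q d < poly q c" using d c by (intro poly_strict_increasing dq cell') auto
      then show ?thesis using c d by (intro exI[of _ d]) (auto intro!: cell')
    qed (use xy in blast)
  qed
qed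

definition mirror_pairs :: "('a::linordered_field \<times> 'b::linordered_field) set \<Rightarrow> ('a \<times> 'b) set" where
  "mirror_pairs Z = (\<lambda>(z, w). (- z, - w)) ` Z"

text \<open>
  Replacing \<open>p(x)\<close> by \<open>- p(- x)\<close> exchanges left and right ends of gaps and keeps
  the derivative positive; it turns statements about negative values into statements
  about positive ones.
\<close>
definition mirror_poly :: "'a::linordered_field poly \<Rightarrow> 'a poly" where
  "mirror_poly p = - pcompose p [:0, -1:]"

lemma poly_mirror [simp]:
  "poly (mirror_poly p) t = - poly p (- t)"
  "poly (pderiv (mirror_poly p)) t = poly (pderiv p) (- t)"
  by (simp_all add: mirror_poly_def poly_pcompose pderiv_minus pderiv_pcompose pderiv_pCons)

lemma same_pos_mirror: "same_pos (mirror_pairs Z) x y \<longleftrightarrow> same_pos Z (- x) (- y)"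
proof -
  have "same_sign (x + z) (y + w) \<longleftrightarrow> same_sign (- x - z) (- y - w)" for z :: 'a and w :: 'b
  proof -
    have "- x - z = - (x + z)" "- y - w = - (y + w)" by simp_all
    then show ?thesis by (simp only: same_sign_uminus)
  qed
  then show ?thesis by (auto simp: same_pos_def mirror_pairs_def)
qed

lemma cell_positive_value:
  fixes p :: "'a::real_closed_field poly" and q :: "'b::real_closed_field poly"
  assumes Z: "aligned Z" and dp: "matched Z (pderiv p) (pderiv q)"
    and ends: "\<And>z w. (z, w) \<in> Z \<Longrightarrow> same_sign (poly p z) (poly q w)"
    and xy: "same_pos Z x y" "x \<notin> fst ` Z"
    and inc: "0 < poly (pderiv p) x" and pos: "0 < poly p x"
  shows "\<exists>y'. same_pos Z x y' \<and> 0 < poly q y'"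
proof -
  let ?Z = "mirror_pairs Z"
  have "\<exists>y'. same_pos ?Z (- x) y' \<and> poly (mirror_poly q) y' < 0"
  proof (rule cell_negative_value[of ?Z "mirror_poly p" "mirror_poly q" "- x" "- y"])
    show "aligned ?Z" using Z unfolding aligned_def
      by (auto simp: same_pos_mirror) (auto simp: mirror_pairs_def)
    show "matched ?Z (pderiv (mirror_poly p)) (pderiv (mirror_poly q))"
      using dp by (auto simp: matched_def same_pos_mirror)
    show "same_sign (poly (mirror_poly p) z) (poly (mirror_poly q) w)" if "(z, w) \<in> ?Z" for z w
      using that ends by (auto simp: mirror_pairs_def)
    show "- x \<notin> fst ` ?Z" using xy(2) by (force simp: mirror_pairs_def)
  qed (use xy inc pos in \<open>auto simp: same_pos_mirror\<close>)
  then obtain y' where "same_pos Z x (- y')" "0 < poly q (- y')" by (auto simp: same_pos_mirror)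
  then show ?thesis by blast
qed

lemma same_pos_trans:
  assumes "same_pos Z x y" "same_pos Z x' y" "same_pos Z x' y'"
  shows "same_pos Z x y'"
  unfolding same_pos_def
proof (intro ballI, clarify)
  fix z w assume "(z, w) \<in> Z"
  then have "same_sign (x - z) (y - w)" "same_sign (x' - z) (y - w)" "same_sign (x' - z) (y' - w)"
    using assms by (auto simp: same_pos_def)
  then show "same_sign (x - z) (y' - w)" by (auto simp: same_sign_def)
qed

text \<open>
  An increasing polynomial has a root in a gap iff it takes both signs there, and taking a sign
  transfers to the corresponding gap. Decreasing polynomials are covered by negation.
\<close>
lemma cell_root:
  fixes p :: "'a::real_closed_field poly" and q :: "'b::real_closed_field poly"
  assumes Z: "aligned Z" and dp: "matched Z (pderiv p) (pderiv q)" and nz: "pderiv p \<noteq> 0"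
    and ends: "\<And>z w. (z, w) \<in> Z \<Longrightarrow> same_sign (poly p z) (poly q w)"
    and xy: "same_pos Z x y" "x \<notin> fst ` Z" and root: "poly p x = 0"
  shows "\<exists>y'. same_pos Z x y' \<and> poly q y' = 0"
proof -
  have main: "\<exists>y'. same_pos Z x y' \<and> poly q y' = 0"
    if dp: "matched Z (pderiv p) (pderiv q)" and ends: "\<And>z w. (z, w) \<in> Z \<Longrightarrow> same_sign (poly p z) (poly q w)"
      and root: "poly p x = 0" and inc: "0 < poly (pderiv p) x"
    for p :: "'a poly" and q :: "'b poly"
  proof -
    obtain a b where ab: "a < x" "x < b" "same_pos Z a y" "same_pos Z b y"
      using same_pos_open[OF Z xy] by blast
    have y: "y \<notin> snd ` Z" using same_pos_fst_iff[OF xy(1)] xy(2) by simp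
    have out: "a \<notin> fst ` Z" "b \<notin> fst ` Z" using same_pos_fst_iff ab(3,4) y by blast+
    have trans: "same_pos Z x t" if "same_pos Z c t" "same_pos Z c y" for c t
      using same_pos_trans[OF xy(1) that(2,1)] .
    have d: "0 < poly (pderiv p) t" if "same_pos Z t y" for t
      using matchedD[OF dp that] matchedD[OF dp xy(1)] inc by (simp add: same_sign_def)
    have "poly p a < poly p x" using ab by (intro poly_strict_increasing d same_pos_between[OF ab(3) xy(1)]) auto
    then obtain y1 where y1: "same_pos Z a y1" "poly q y1 < 0"
      using cell_negative_value[OF Z dp ends ab(3) out(1) d[OF ab(3)]] root by auto
    have "poly p x < poly p b" using ab by (intro poly_strict_increasing d same_pos_between[OF xy(1) ab(4)]) auto
    then obtain y2 where y2: "same_pos Z b y2" "0 < poly q y2"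
      using cell_positive_value[OF Z dp ends ab(4) out(2) d[OF ab(4)]] root by auto
    have y12: "same_pos Z x y1" "same_pos Z x y2" using trans y1 y2 ab by blast+
    consider "y1 < y2" | "y2 < y1" using y1 y2 by fastforce
    then show ?thesis
    proof cases
      case 1
      then obtain c where "y1 < c" "c < y2" "poly q c = 0"
        using poly_root_between[of y1 y2 q] y1 y2 by (auto simp: mult_less_0_iff)
      then show ?thesis using same_pos_between'[OF y12, of c] by auto
    next
      case 2
      then obtain c where "y2 < c" "c < y1" "poly q c = 0"
        using poly_root_between[of y2 y1 q] y1 y2 by (auto simp: mult_less_0_iff)
      then show ?thesis using same_pos_between'[OF y12(2) y12(1), of c] by auto
    qed
  qed
  have "poly (pderiv p) x \<noteq> 0" using matched_root_in_fst[OF Z dp nz] xy(2) by blast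
  then consider "0 < poly (pderiv p) x" | "0 < poly (pderiv (- p)) x"
    by (auto simp: pderiv_minus neq_iff)
  then show ?thesis
  proof cases
    case 1
    then show ?thesis using main[OF dp ends root] by blast
  next
    case 2
    then show ?thesis using main[of "- p" "- q"] dp ends root by (auto simp: pderiv_minus matched_uminus)
  qed
qed

text \<open>
  The pairs by which \<open>Z\<close> is to be refined when \<open>p\<close> and \<open>q\<close> are added to the matched
  polynomials. Roots that are already end points of gaps are excluded.
\<close>
definition common_roots ::
  "('a::linordered_field \<times> 'b::linordered_field) set \<Rightarrow> 'a poly \<Rightarrow> 'b poly \<Rightarrow> ('a \<times> 'b) set" where
  "common_roots Z p q =
     {(x, y). same_pos Z x y \<and> x \<notin> fst ` Z \<and> y \<notin> snd ` Z \<and> poly p x = 0 \<and> poly q y = 0}"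

lemma common_roots_converse: "common_roots (Z\<inverse>) q p = (common_roots Z p q)\<inverse>"
  by (force simp: common_roots_def same_pos_converse image_iff)

lemma common_roots_uminus [simp]: "common_roots Z (- p) (- q) = common_roots Z p q"
  by (simp add: common_roots_def)

text \<open>
  Two roots in a gap would enclose a root of the derivative, which cannot lie in an open gap.
\<close>
lemma cell_root_unique:
  fixes p :: "'a::real_closed_field poly"
  assumes Z: "aligned Z" and dp: "matched Z (pderiv p) (pderiv q)" and nz: "pderiv p \<noteq> 0"
    and x: "same_pos Z x y" "same_pos Z x' y" "x \<notin> fst ` Z" "poly p x = 0" "poly p x' = 0"
  shows "x = x'"
proof -
  have False if l: "a < b" "poly p a = 0" "poly p b = 0" "same_pos Z a y" "same_pos Z b y" "a \<notin> fst ` Z" for a b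
  proof -
    obtain c where c: "a < c" "c < b" "poly (pderiv p) c = 0" using poly_Rolle[OF l(1,2,3)] by blast
    have "same_pos Z c y" using same_pos_between[OF l(4,5)] c by simp
    then have "c \<notin> fst ` Z" using same_pos_fst_iff l(4,6) by blast
    then show False using matched_root_in_fst[OF Z dp nz c(3)] by blast
  qed
  moreover have "x' \<notin> fst ` Z" using same_pos_fst_iff x by blast
  ultimately show ?thesis using x by (metis linorder_neqE)
qed

lemma fst_converse_image: "fst ` (Z\<inverse>) = snd ` Z"
  by force

lemma aligned_common_roots:
  fixes p :: "'a::real_closed_field poly" and q :: "'b::real_closed_field poly"
  assumes Z: "aligned Z" and dp: "matched Z (pderiv p) (pderiv q)"
    and nz: "pderiv p \<noteq> 0" "pderiv q \<noteq> 0"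
  shows "aligned (Z \<union> common_roots Z p q)"
proof -
  let ?N = "common_roots Z p q"
  have "p \<noteq> 0" "q \<noteq> 0" using nz by auto
  then have "finite ({x. poly p x = 0} \<times> {y. poly q y = 0})" 
    using poly_roots_finite[of p] poly_roots_finite[of q] by (intro finite_cartesian_product) simp_all
  then have fin: "finite ?N" by (rule rev_finite_subset) (auto simp: common_roots_def)
  have Z': "aligned (Z\<inverse>)" "matched (Z\<inverse>) (pderiv q) (pderiv p)"
    using Z dp by (auto simp: aligned_converse matched_converse)
  have NN: "same_sign (x - x') (y - y')" if N: "(x, y) \<in> ?N" "(x', y') \<in> ?N" for x y x' y'
  proof -
    have xy: "same_pos Z x y" "same_pos Z x' y'" "x \<notin> fst ` Z" "x' \<notin> fst ` Z" "y \<notin> snd ` Z"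
      "poly p x = 0" "poly p x' = 0" "poly q y = 0" "poly q y' = 0"
      using N by (auto simp: common_roots_def)
    show ?thesis
    proof (cases "same_pos Z x y'")
      case True
      have "x = x'" by (rule cell_root_unique[OF Z dp nz(1), of x y' x']) (use xy True in auto)
      moreover have "y = y'" 
        by (rule cell_root_unique[OF Z' nz(2), of y x y'])
          (use xy True in \<open>simp_all add: same_pos_converse fst_converse_image\<close>)
      ultimately show ?thesis by (simp add: same_sign_def)
    next
      case False
      then obtain z w where zw: "(z, w) \<in> Z" "\<not> same_sign (x - z) (y' - w)"
        by (auto simp: same_pos_def)
      have "x \<noteq> z" "x' \<noteq> z" using xy(3,4) zw(1) by force+
      then consider "x < z" "z < x'" | "x' < z" "z < x"
        using zw(2) same_posD[OF xy(2) zw(1)] by (auto simp: same_sign_def)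
      then show ?thesis
        using same_posD[OF xy(1) zw(1)] same_posD[OF xy(2) zw(1)]
        by cases (auto simp: same_sign_def)
    qed
  qed
  have ZN: "same_sign (z - x) (w - y)" if zw: "(z, w) \<in> Z" and N: "(x, y) \<in> ?N" for x y z w
  proof -
    have "same_pos Z x y" using N by (simp add: common_roots_def)
    then show ?thesis using same_posD[OF _ zw, of x y] by (auto simp: same_sign_def)
  qed
  have NZ: "same_pos Z x y" if "(x, y) \<in> ?N" for x y using that by (simp add: common_roots_def)
  have "same_pos (Z \<union> ?N) z w" if "(z, w) \<in> Z \<union> ?N" for z w
    using that Z NN ZN NZ unfolding aligned_def same_pos_def by blast
  then show ?thesis using fin Z by (auto simp: aligned_def)
qed

lemma same_pos_Un: "same_pos (Z \<union> N) x y \<longleftrightarrow> same_pos Z x y \<and> same_pos N x y"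
  by (auto simp: same_pos_def)

text \<open>
  If \<open>q\<close> were not positive at \<open>y\<close>, then \<open>p\<close> would take a nonpositive value in the gap, and so have
  a root in it, necessarily to the left of \<open>x\<close>. Its partner is a root of \<open>q\<close> to the left of \<open>y\<close>, and
  monotonicity makes \<open>q\<close> positive at \<open>y\<close> after all.
\<close>
lemma cell_positive_transfer:
  fixes p :: "'a::real_closed_field poly" and q :: "'b::real_closed_field poly"
  assumes Z: "aligned Z" and dp: "matched Z (pderiv p) (pderiv q)"
    and nz: "pderiv p \<noteq> 0" "pderiv q \<noteq> 0"
    and ends: "\<And>z w. (z, w) \<in> Z \<Longrightarrow> same_sign (poly p z) (poly q w)"
    and xy: "same_pos (Z \<union> common_roots Z p q) x y" "x \<notin> fst ` Z"
    and inc: "0 < poly (pderiv p) x" and pos: "0 < poly p x"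
  shows "0 < poly q y"
proof (rule ccontr)
  assume "\<not> 0 < poly q y"
  let ?N = "common_roots Z p q"
  have xyZ: "same_pos Z x y" and xyN: "same_pos ?N x y" using xy(1) by (auto simp: same_pos_Un)
  have y: "y \<notin> snd ` Z" using same_pos_fst_iff[OF xyZ] xy(2) by simp
  have Z': "aligned (Z\<inverse>)" "matched (Z\<inverse>) (pderiv q) (pderiv p)" "same_pos (Z\<inverse>) y x" "y \<notin> fst ` (Z\<inverse>)"
    using Z dp xyZ y by (auto simp: aligned_converse matched_converse same_pos_converse image_iff)
  have ends': "same_sign (poly q w) (poly p z)" if "(w, z) \<in> Z\<inverse>" for w z
    using ends that by (auto intro: same_sign_sym)
  have dpx: "0 < poly (pderiv p) t" if "same_pos Z t y" for t
    using matchedD[OF dp that] matchedD[OF dp xyZ] inc by (simp add: same_sign_def)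
  have dq: "0 < poly (pderiv q) t" if "same_pos Z x t" for t
    using matchedD[OF dp that] inc by (simp add: same_sign_def)
  have "\<exists>x0. same_pos Z x0 y \<and> poly p x0 \<le> 0"
  proof (cases "poly q y = 0")
    case True
    then show ?thesis using cell_root[OF Z'(1,2) nz(2) ends' Z'(3,4)] by (auto simp: same_pos_converse)
  next
    case False
    then have "poly q y < 0" using \<open>\<not> 0 < poly q y\<close> by simp
    then show ?thesis using cell_negative_value[OF Z'(1,2) ends' Z'(3,4) dq[OF xyZ]]
      by (auto simp: same_pos_converse intro: less_imp_le)
  qed
  then obtain x1 where x1: "same_pos Z x1 y" "poly p x1 \<le> 0" by blast
  have "\<exists>x0. same_pos Z x0 y \<and> poly p x0 = 0"
  proof (cases "poly p x1 = 0")
    case False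
    then have neg: "poly p x1 < 0" using x1 by simp
    then consider "x1 < x" | "x < x1" using pos by fastforce
    then show ?thesis
    proof cases
      case 1
      then obtain c where "x1 < c" "c < x" "poly p c = 0"
        using poly_root_between[of x1 x p] neg pos by (auto simp: mult_less_0_iff)
      then show ?thesis using same_pos_between[OF x1(1) xyZ, of c] by auto
    next
      case 2
      then obtain c where "x < c" "c < x1" "poly p c = 0"
        using poly_root_between[of x x1 p] neg pos by (auto simp: mult_less_0_iff)
      then show ?thesis using same_pos_between[OF xyZ x1(1), of c] by auto
    qed
  qed (use x1 in blast)
  then obtain x0 where x0: "same_pos Z x0 y" "poly p x0 = 0" by blast
  have x0Z: "x0 \<notin> fst ` Z" using same_pos_fst_iff[OF x0(1)] y by simp
  obtain y0 where y0: "same_pos Z x0 y0" "poly q y0 = 0"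
    using cell_root[OF Z dp nz(1) ends x0(1) x0Z x0(2)] by blast
  have y0Z: "y0 \<notin> snd ` Z" using same_pos_fst_iff[OF y0(1)] x0Z by simp
  have "(x0, y0) \<in> ?N" using x0 y0 x0Z y0Z by (simp add: common_roots_def)
  note side = same_posD[OF xyN this]
  have "x0 < x"
  proof (rule ccontr)
    assume "\<not> x0 < x"
    moreover have "x \<noteq> x0" using pos x0 by auto
    ultimately have "x < x0" by simp
    then have "poly p x < poly p x0"
      by (intro poly_strict_increasing dpx same_pos_between[OF xyZ x0(1)]) auto
    then show False using pos x0 by simp
  qed
  then have "y0 < y" using side by simp
  have xy0: "same_pos Z x y0"
    using same_pos_trans[OF xyZ x0(1) y0(1)] .
  have "poly q y0 < poly q y" using \<open>y0 < y\<close>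
    by (intro poly_strict_increasing dq same_pos_between'[OF xy0 xyZ]) auto
  then show False using y0 \<open>\<not> 0 < poly q y\<close> by simp
qed

text \<open>
  The inductive step of Hoermander's method: once the derivatives are matched and the signs at the
  points of \<open>Z\<close> agree, adding the common roots matches the polynomials themselves.
\<close>
theorem matched_common_roots:
  fixes p :: "'a::real_closed_field poly" and q :: "'b::real_closed_field poly"
  assumes Z: "aligned Z" and dp: "matched Z (pderiv p) (pderiv q)"
    and nz: "pderiv p \<noteq> 0" "pderiv q \<noteq> 0"
    and ends: "\<And>z w. (z, w) \<in> Z \<Longrightarrow> same_sign (poly p z) (poly q w)"
  shows "matched (Z \<union> common_roots Z p q) p q"
  unfolding matched_def
proof (intro allI impI)
  fix x y assume xy: "same_pos (Z \<union> common_roots Z p q) x y"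
  have xyZ: "same_pos Z x y" using xy by (simp add: same_pos_Un)
  show "same_sign (poly p x) (poly q y)"
  proof (cases "x \<in> fst ` Z")
    case True
    then obtain w where w: "(x, w) \<in> Z" by auto
    then have "y = w" using same_posD(3)[OF xyZ w] by simp
    then show ?thesis using ends w by simp
  next
    case x: False
    then have y: "y \<notin> snd ` Z" using same_pos_fst_iff[OF xyZ] by simp
    have main: "0 < poly p x \<longleftrightarrow> 0 < poly q y"
      if dp: "matched Z (pderiv p) (pderiv q)" and nz: "pderiv p \<noteq> 0" "pderiv q \<noteq> 0"
        and ends: "\<And>z w. (z, w) \<in> Z \<Longrightarrow> same_sign (poly p z) (poly q w)"
        and xy: "same_pos (Z \<union> common_roots Z p q) x y"
        and inc: "0 < poly (pderiv p) x" for p :: "'a poly" and q :: "'b poly"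
    proof
      show "0 < poly q y" if "0 < poly p x"
        using cell_positive_transfer[OF Z dp nz ends xy x inc that] .
    next
      have inc': "0 < poly (pderiv q) y" using matchedD[OF dp xyZ] inc by (simp add: same_sign_def)
      have conv: "same_pos (Z\<inverse> \<union> common_roots (Z\<inverse>) q p) y x"
        using xy by (simp add: common_roots_converse same_pos_Un same_pos_converse)
      show "0 < poly p x" if "0 < poly q y"
        by (rule cell_positive_transfer[of "Z\<inverse>" q p y x])
           (use Z dp nz ends inc' y that conv in \<open>auto simp: aligned_converse matched_converse image_iff intro: same_sign_sym\<close>)
    qed
    have zero: "poly p x = 0 \<longleftrightarrow> poly q y = 0"
    proof
      assume 0: "poly p x = 0"
      then obtain y' where y': "same_pos Z x y'" "poly q y' = 0"
        using cell_root[OF Z dp nz(1) ends xyZ x] by blast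
      then have "(x, y') \<in> common_roots Z p q"
        using x 0 same_pos_fst_iff[OF y'(1)] by (simp add: common_roots_def)
      then show "poly q y = 0" using same_posD(3)[of _ x y x y'] xy y' by (auto simp: same_pos_Un)
    next
      assume 0: "poly q y = 0"
      have "\<exists>x'. same_pos (Z\<inverse>) y x' \<and> poly p x' = 0"
        by (rule cell_root[of "Z\<inverse>" q p y x])
           (use Z dp nz ends xyZ y 0 in \<open>auto simp: aligned_converse matched_converse same_pos_converse image_iff intro: same_sign_sym\<close>)
      then obtain x' where x': "same_pos Z x' y" "poly p x' = 0" by (auto simp: same_pos_converse)
      then have "(x', y) \<in> common_roots Z p q"
        using y 0 same_pos_fst_iff[OF x'(1)] by (simp add: common_roots_def)
      then show "poly p x = 0" using same_posD(3)[of _ x y x' y] xy x' by (auto simp: same_pos_Un)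
    qed
    have "poly (pderiv p) x \<noteq> 0" using matched_root_in_fst[OF Z dp nz(1)] x by blast
    then consider "0 < poly (pderiv p) x" | "0 < poly (pderiv (- p)) x"
      by (auto simp: pderiv_minus neq_iff)
    then show ?thesis
    proof cases
      case 1
      then show ?thesis using main[OF dp nz ends xy] zero unfolding same_sign_def by (metis linorder_neqE less_asym)
    next
      case 2
      have "0 < poly (- p) x \<longleftrightarrow> 0 < poly (- q) y"
        by (rule main[OF _ _ _ _ _ 2])
           (use dp nz ends xy in \<open>auto simp: pderiv_minus matched_uminus\<close>)
      then show ?thesis using zero unfolding same_sign_def by (metis linorder_neqE less_asym neg_0_less_iff_less poly_minus)
    qed
  qed
qed

text \<open>
  Points of \<open>Z\<close> that are roots of no polynomial in the family can be forgotten, because by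
  the intermediate value property signs change only at roots. This is needed because the sign
  of a further polynomial at a point of \<open>Z\<close> is known only where a polynomial of the family
  vanishes: there it is the sign of a remainder.
\<close>
lemma matched_prune:
  fixes E :: "('a::real_closed_field poly \<times> 'b::real_closed_field poly) set"
  assumes Z: "aligned Z" and E: "\<And>p q. (p, q) \<in> E \<Longrightarrow> matched Z p q"
  defines "Z' \<equiv> {(z, w)\<in>Z. \<exists>(p, q)\<in>E. p \<noteq> 0 \<and> poly p z = 0}"
  shows "aligned Z'" "\<And>p q. (p, q) \<in> E \<Longrightarrow> matched Z' p q"
proof -
  have sub: "Z' \<subseteq> Z" by (auto simp: Z'_def)
  have "same_pos Z' z w" if "(z, w) \<in> Z'" for z w
    using that Z sub unfolding aligned_def same_pos_def by blast
  then show "aligned Z'" using Z finite_subset[OF sub] by (auto simp: aligned_def)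
  fix p q assume pq: "(p, q) \<in> E"
  show "matched Z' p q"
    unfolding matched_def
  proof (intro allI impI)
    fix x y assume xy: "same_pos Z' x y"
    obtain x' where x': "same_pos Z x' y" using same_pos_exists[OF Z] by blast
    have s: "same_sign (poly p x') (poly q y)" by (rule matchedD[OF E[OF pq] x'])
    have x'Z': "same_pos Z' x' y" using x' sub unfolding same_pos_def by blast
    have nr: "x = x'" if "p \<noteq> 0" "poly p r = 0" "min x x' \<le> r" "r \<le> max x x'" for r
    proof -
      have "r \<in> fst ` Z" by (rule matched_root_in_fst[OF Z E[OF pq] that(1,2)])
      then obtain w where "(r, w) \<in> Z" by auto
      then have "(r, w) \<in> Z'" using that pq by (auto simp: Z'_def)
      from same_posD[OF xy this] same_posD[OF x'Z' this] show ?thesis using that(3,4)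
        by (auto simp: min_def max_def split: if_splits)
    qed
    have "same_sign (poly p x) (poly p x')"
    proof (cases "p = 0 \<or> x = x'")
      case False
      have "\<not> poly p x * poly p x' < 0"
      proof
        assume l: "poly p x * poly p x' < 0"
        consider "x < x'" | "x' < x" using False by fastforce
        then show False
        proof cases
          case 1
          then obtain c where "x < c" "c < x'" "poly p c = 0" using poly_root_between[of x x' p] l by blast
          then show ?thesis using nr[of c] False by auto
        next
          case 2
          then obtain c where "x' < c" "c < x" "poly p c = 0"
            using poly_root_between[of x' x p] l by (auto simp: mult.commute)
          then show ?thesis using nr[of c] False by auto
        qed
      qed
      moreover have "poly p x \<noteq> 0" "poly p x' \<noteq> 0" using nr[of x] nr[of x'] False by auto
      ultimately show ?thesis by (auto simp: same_sign_def mult_less_0_iff)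
    qed (auto simp: same_sign_def)
    then show "same_sign (poly p x) (poly q y)" using s by (auto simp: same_sign_def)
  qed
qed

section \<open>Transfer of sign conditions along a change of coefficients\<close>

text \<open>
  Morphisms from a ring of coefficients to ordered fields are what specializes the parameters of a
  family of polynomials.
\<close>
definition ring_morphism :: "('a::comm_ring_1 \<Rightarrow> 'b::comm_ring_1) \<Rightarrow> bool" where
  "ring_morphism \<phi> \<longleftrightarrow> \<phi> 0 = 0 \<and> \<phi> 1 = 1 \<and>
     (\<forall>x y. \<phi> (x + y) = \<phi> x + \<phi> y) \<and> (\<forall>x y. \<phi> (x * y) = \<phi> x * \<phi> y)"

lemma ring_morphismD:
  assumes "ring_morphism \<phi>"
  shows "\<phi> 0 = 0" "\<phi> 1 = 1" "\<phi> (x + y) = \<phi> x + \<phi> y" "\<phi> (x * y) = \<phi> x * \<phi> y"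
    "\<phi> (- x) = - \<phi> x" "\<phi> (x - y) = \<phi> x - \<phi> y" "\<phi> (x ^ n) = \<phi> x ^ n" "\<phi> (of_nat n) = of_nat n"
    "\<phi> (sum f A) = (\<Sum>i\<in>A. \<phi> (f i))"
proof -
  show 0: "\<phi> 0 = 0" and 1: "\<phi> 1 = 1" and add: "\<phi> (x + y) = \<phi> x + \<phi> y"
    and mult: "\<phi> (x * y) = \<phi> x * \<phi> y" for x y
    using assms by (auto simp: ring_morphism_def)
  show neg: "\<phi> (- x) = - \<phi> x" for x using add[of x "- x"] 0 by (simp add: eq_neg_iff_add_eq_0 add.commute)
  show "\<phi> (x - y) = \<phi> x - \<phi> y" using add[of x "- y"] neg[of y] by simp
  show "\<phi> (x ^ n) = \<phi> x ^ n" by (induction n) (auto simp: 1 mult)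
  show "\<phi> (of_nat n) = of_nat n" by (induction n) (auto simp: 0 1 add)
  show "\<phi> (sum f A) = (\<Sum>i\<in>A. \<phi> (f i))" by (induction A rule: infinite_finite_induct) (auto simp: 0 add)
qed

lemma map_poly_morphism:
  fixes \<phi> :: "'a::comm_ring_1 \<Rightarrow> 'b::idom"
  assumes "ring_morphism \<phi>"
  shows "coeff (map_poly \<phi> p) i = \<phi> (coeff p i)"
    "map_poly \<phi> (p + q) = map_poly \<phi> p + map_poly \<phi> q"
    "map_poly \<phi> (p * q) = map_poly \<phi> p * map_poly \<phi> q"
    "map_poly \<phi> (smult c p) = smult (\<phi> c) (map_poly \<phi> p)"
    "poly (map_poly \<phi> p) (\<phi> x) = \<phi> (poly p x)"
proof -
  note [simp] = ring_morphismD[OF assms]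
  show c: "coeff (map_poly \<phi> p) i = \<phi> (coeff p i)" for p i by (simp add: coeff_map_poly)
  show "map_poly \<phi> (p + q) = map_poly \<phi> p + map_poly \<phi> q"
    "map_poly \<phi> (p * q) = map_poly \<phi> p * map_poly \<phi> q"
    "map_poly \<phi> (smult c p) = smult (\<phi> c) (map_poly \<phi> p)"
    by (rule poly_eqI; simp add: c coeff_mult)+
  show "poly (map_poly \<phi> p) (\<phi> x) = \<phi> (poly p x)"
    by (induction p) (simp_all add: map_poly_pCons)
qed

definition subring_set :: "'a::comm_ring_1 set \<Rightarrow> bool" where
  "subring_set S \<longleftrightarrow> 1 \<in> S \<and> (\<forall>x\<in>S. \<forall>y\<in>S. x - y \<in> S \<and> x * y \<in> S)"

lemma subring_setD:
  assumes "subring_set S"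
  shows "0 \<in> S" "1 \<in> S" "x \<in> S \<Longrightarrow> - x \<in> S" "x \<in> S \<Longrightarrow> y \<in> S \<Longrightarrow> x + y \<in> S"
    "x \<in> S \<Longrightarrow> y \<in> S \<Longrightarrow> x - y \<in> S" "x \<in> S \<Longrightarrow> y \<in> S \<Longrightarrow> x * y \<in> S"
    "x \<in> S \<Longrightarrow> x ^ n \<in> S" "of_nat n \<in> S" "(\<And>i. i \<in> A \<Longrightarrow> f i \<in> S) \<Longrightarrow> sum f A \<in> S"
proof -
  show 1: "1 \<in> S" and diff: "x \<in> S \<Longrightarrow> y \<in> S \<Longrightarrow> x - y \<in> S" and mult: "x \<in> S \<Longrightarrow> y \<in> S \<Longrightarrow> x * y \<in> S" for x y
    using assms by (auto simp: subring_set_def)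
  show 0: "0 \<in> S" using diff[OF 1 1] by simp
  show neg: "x \<in> S \<Longrightarrow> - x \<in> S" for x using diff[OF 0, of x] by simp
  show add: "x \<in> S \<Longrightarrow> y \<in> S \<Longrightarrow> x + y \<in> S" for x y using diff[of x "- y"] neg[of y] by simp
  show "x \<in> S \<Longrightarrow> x ^ n \<in> S" by (induction n) (auto intro: 1 mult)
  show "of_nat n \<in> S" by (induction n) (auto intro: 0 1 add)
  show "(\<And>i. i \<in> A \<Longrightarrow> f i \<in> S) \<Longrightarrow> sum f A \<in> S"
    by (induction A rule: infinite_finite_induct) (auto intro: 0 add)
qed

text \<open>
  Subrings are kept as sets, so that one ambient type serves all rings of
  polynomials in fewer and fewer variables, as well as all subfields of an algebraic closure.
\<close>
definition polys_over :: "'a::comm_ring_1 set \<Rightarrow> 'a poly set" where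
  "polys_over S = {p. \<forall>i. coeff p i \<in> S}"

lemma polys_over_closed:
  assumes S: "subring_set S"
  shows "0 \<in> polys_over S" "c \<in> S \<Longrightarrow> [:c:] \<in> polys_over S" "c \<in> S \<Longrightarrow> monom c n \<in> polys_over S"
    "p \<in> polys_over S \<Longrightarrow> q \<in> polys_over S \<Longrightarrow> p + q \<in> polys_over S"
    "p \<in> polys_over S \<Longrightarrow> q \<in> polys_over S \<Longrightarrow> p - q \<in> polys_over S"
    "p \<in> polys_over S \<Longrightarrow> q \<in> polys_over S \<Longrightarrow> p * q \<in> polys_over S"
    "c \<in> S \<Longrightarrow> p \<in> polys_over S \<Longrightarrow> smult c p \<in> polys_over S"
    "x \<in> S \<Longrightarrow> p \<in> polys_over S \<Longrightarrow> poly p x \<in> S"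
  using subring_setD(1-8)[OF S]
  by (auto simp: polys_over_def coeff_mult coeff_pCons poly_altdef intro!: subring_setD(9)[OF S] split: nat.split)

lemma pseudo_division_over:
  assumes S: "subring_set S" and g: "g \<in> polys_over S" "g \<noteq> 0" and f: "f \<in> polys_over S"
  shows "\<exists>N q r. q \<in> polys_over S \<and> r \<in> polys_over S \<and> smult (lead_coeff g ^ N) f = q * g + r \<and>
           (r = 0 \<or> degree r < degree g)"
  using f
proof (induction "if f = 0 then 0 else Suc (degree f)" arbitrary: f rule: less_induct)
  case less
  note cl = polys_over_closed[OF S]
  show ?case
  proof (cases "f = 0 \<or> degree f < degree g")
    case True
    then show ?thesis using less.prems cl(1) by (intro exI[of _ 0] exI[of _ "0::'a poly"] exI[of _ f]) auto
  next
    case False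
    let ?c = "lead_coeff g" let ?m = "monom (lead_coeff f) (degree f - degree g)"
    define f' where "f' = smult ?c f - ?m * g"
    have cS: "?c \<in> S" and mS: "?m \<in> polys_over S" using g less.prems cl(3) by (auto simp: polys_over_def)
    have f': "f' \<in> polys_over S" unfolding f'_def by (rule cl(5)[OF cl(7)[OF cS less.prems] cl(6)[OF mS g(1)]])
    have "degree (?m * g) \<le> (degree f - degree g) + degree g"
      using degree_mult_le[of ?m g] degree_monom_le[of "lead_coeff f" "degree f - degree g"] by linarith
    also have "\<dots> = degree f" using False by simp
    finally have "degree f' \<le> degree f"
      unfolding f'_def by (intro degree_diff_le) (auto intro: order.trans[OF degree_smult_le])
    moreover have "coeff (?m * g) (degree f) = lead_coeff f * ?c"
      using False by (simp add: coeff_monom_mult)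
    then have "coeff f' (degree f) = 0" by (simp add: f'_def mult.commute)
    ultimately have "f' = 0 \<or> degree f' < degree f" by (rule eq_zero_or_degree_less)
    then have "(if f' = 0 then 0 else Suc (degree f')) < (if f = 0 then 0 else Suc (degree f))"
      using False by auto
    from less.hyps[OF this f'] obtain N q r where IH: "q \<in> polys_over S" "r \<in> polys_over S"
      "smult (?c ^ N) f' = q * g + r" "r = 0 \<or> degree r < degree g" by blast
    have "smult (?c ^ Suc N) f = smult (?c ^ N) f' + smult (?c ^ N) (?m * g)"
      by (simp add: f'_def smult_diff_right mult.commute)
    also have "\<dots> = (q + smult (?c ^ N) ?m) * g + r" using IH(3) by (simp add: algebra_simps)
    finally show ?thesis
      using IH(2,4) cl(4)[OF IH(1) cl(7)[OF subring_setD(7)[OF S cS] mS]] by blast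
  qed
qed

text \<open>
  The coefficients come from an arbitrary commutative ring, whereas \<^const>\<open>pderiv\<close> supposes that there
  are no zero divisors.
\<close>
definition formal_deriv :: "'a::comm_ring_1 poly \<Rightarrow> 'a poly" where
  "formal_deriv p = (\<Sum>i<degree p. monom (of_nat (Suc i) * coeff p (Suc i)) i)"

lemma coeff_formal_deriv: "coeff (formal_deriv p) i = of_nat (Suc i) * coeff p (Suc i)"
  by (auto simp: formal_deriv_def coeff_sum coeff_eq_0 not_less simp del: of_nat_Suc)

lemma formal_deriv_over: "subring_set S \<Longrightarrow> p \<in> polys_over S \<Longrightarrow> formal_deriv p \<in> polys_over S"
  unfolding polys_over_def mem_Collect_eq coeff_formal_deriv using subring_setD(6,8) by blast

lemma map_poly_formal_deriv:
  fixes \<phi> :: "'a::comm_ring_1 \<Rightarrow> 'b::idom"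
  assumes "ring_morphism \<phi>"
  shows "map_poly \<phi> (formal_deriv p) = pderiv (map_poly \<phi> p)"
  by (rule poly_eqI) (simp add: map_poly_morphism[OF assms] coeff_formal_deriv coeff_pderiv
      ring_morphismD[OF assms] del: of_nat_Suc)

lemma same_sign_power: "same_sign x y \<Longrightarrow> same_sign (x ^ n) (y ^ n)"
  by (induction n) (auto simp: same_sign_def zero_less_mult_iff mult_less_0_iff)

lemma same_sign_mult_cancel:
  assumes "same_sign (a * x) (b * y)" "same_sign a b" "a \<noteq> 0"
  shows "same_sign x y"
proof -
  have "b \<noteq> 0" using assms by (auto simp: same_sign_def)
  then show ?thesis using assms
    by (cases "0 < a"; cases "0 < b") (auto simp: same_sign_def zero_less_mult_iff mult_less_0_iff not_less le_less)
qed

text \<open>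
  The finite set \<open>G\<close> of ring elements collects the conditions on the parameters under which the
  branching of the elimination is the same for \<open>\<psi>\<close> as for \<open>\<phi>\<close>.
\<close>
definition sign_agree ::
  "('a \<Rightarrow> 'c::linordered_field) \<Rightarrow> ('a \<Rightarrow> 'b::linordered_field) \<Rightarrow> 'a set \<Rightarrow> bool" where
  "sign_agree \<psi> \<phi> G \<longleftrightarrow> (\<forall>g\<in>G. same_sign (\<psi> g) (\<phi> g))"

lemma sign_agree_Un: "sign_agree \<psi> \<phi> (G \<union> H) \<longleftrightarrow> sign_agree \<psi> \<phi> G \<and> sign_agree \<psi> \<phi> H"
  by (auto simp: sign_agree_def)

text \<open>
  Agreement on the coefficients includes agreement on which of them vanish, hence on
  the degree after specialization.
\<close>
lemma sign_agree_coeffs: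
  fixes \<phi> :: "'a::comm_ring_1 \<Rightarrow> 'b::linordered_field" and \<psi> :: "'a \<Rightarrow> 'c::linordered_field"
  assumes "ring_morphism \<phi>" "ring_morphism \<psi>" "sign_agree \<psi> \<phi> (coeff f ` {..degree f})"
  shows "same_sign (\<psi> (coeff f i)) (\<phi> (coeff f i))"
    "coeff (map_poly \<psi> f) i = 0 \<longleftrightarrow> coeff (map_poly \<phi> f) i = 0"
    "degree (map_poly \<psi> f) = degree (map_poly \<phi> f)"
proof -
  show s: "same_sign (\<psi> (coeff f i)) (\<phi> (coeff f i))" for i
  proof (cases "i \<le> degree f")
    case False
    then show ?thesis
      by (simp add: coeff_eq_0 same_sign_def ring_morphismD(1)[OF assms(1)] ring_morphismD(1)[OF assms(2)])
  qed (use assms(3) in \<open>auto simp: sign_agree_def\<close>)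
  show c: "coeff (map_poly \<psi> f) i = 0 \<longleftrightarrow> coeff (map_poly \<phi> f) i = 0" for i
    using same_sign_0_iff[OF s[of i]] by (simp add: map_poly_morphism assms)
  show "degree (map_poly \<psi> f) = degree (map_poly \<phi> f)"
    by (rule antisym; rule degree_le) (use c in \<open>auto intro: coeff_eq_0\<close>)
qed

text \<open>
  Here \<open>\<phi>\<close> is fixed and decides all case distinctions, in particular which leading coefficients
  vanish. Any \<open>\<psi>\<close> in \<open>\<Psi>\<close> that agrees with \<open>\<phi>\<close> on finitely many elements of \<open>S\<close> must then give a
  family of polynomials with the same arrangement of roots and signs.
\<close>
definition sign_transfer ::
  "('a::comm_ring_1 \<Rightarrow> 'c::real_closed_field) set \<Rightarrow> 'a set \<Rightarrow> ('a \<Rightarrow> 'b::real_closed_field) \<Rightarrow> 'a poly set \<Rightarrow> bool"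
  where "sign_transfer \<Psi> S \<phi> F \<longleftrightarrow> (\<exists>G\<subseteq>S. finite G \<and> (\<forall>\<psi>\<in>\<Psi>. sign_agree \<psi> \<phi> G \<longrightarrow>
     (\<exists>Z. aligned Z \<and> (\<forall>f\<in>F. matched Z (map_poly \<psi> f) (map_poly \<phi> f)))))"

text \<open>
  At roots of the two specializations of \<open>g\<close>, the sign of \<open>f\<close> is that of its remainder
  modulo \<open>g\<close>, up to the sign of a power of the leading coefficient of \<open>g\<close>. Coefficients of \<open>g\<close> that \<open>\<phi>\<close>
  kills have to be cut off before dividing; agreement of \<open>\<psi>\<close> with \<open>\<phi>\<close> ensures that \<open>\<psi>\<close> kills them
  too.
\<close>
lemma remainder_over:
  fixes \<phi> :: "'a::comm_ring_1 \<Rightarrow> 'b::linordered_field"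
  assumes S: "subring_set S" and \<phi>: "ring_morphism \<phi>"
    and f: "f \<in> polys_over S" and g: "g \<in> polys_over S" "map_poly \<phi> g \<noteq> 0"
  shows "\<exists>r\<in>polys_over S.
    (map_poly \<phi> r = 0 \<or> degree (map_poly \<phi> r) < degree (map_poly \<phi> g)) \<and>
    (\<forall>\<psi> :: 'a \<Rightarrow> 'c::linordered_field. ring_morphism \<psi> \<longrightarrow> sign_agree \<psi> \<phi> (coeff g ` {..degree g}) \<longrightarrow>
      (\<forall>z w. poly (map_poly \<psi> g) z = 0 \<longrightarrow> poly (map_poly \<phi> g) w = 0 \<longrightarrow>
        same_sign (poly (map_poly \<psi> r) z) (poly (map_poly \<phi> r) w) \<longrightarrow>
        same_sign (poly (map_poly \<psi> f) z) (poly (map_poly \<phi> f) w)))"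
proof -
  define n where "n = degree (map_poly \<phi> g)"
  define h where "h = poly_cutoff (Suc n) g"
  have coeff_h: "coeff h i = (if i \<le> n then coeff g i else 0)" for i
    by (simp add: h_def coeff_poly_cutoff less_Suc_eq_le)
  have lcn: "\<phi> (coeff g n) \<noteq> 0"
    using g(2) by (simp add: n_def flip: map_poly_morphism(1)[OF \<phi>])
  then have gn: "coeff g n \<noteq> 0" using ring_morphismD(1)[OF \<phi>] by auto
  have deg_h: "degree h = n"
    by (rule antisym) (use gn in \<open>auto intro!: degree_le le_degree simp: coeff_h\<close>)
  have h: "h \<in> polys_over S" using g(1) subring_setD(1)[OF S] by (auto simp: polys_over_def coeff_h)
  have h0: "h \<noteq> 0" using gn coeff_h[of n] by (metis coeff_0 order_refl)
  obtain N q r where r: "r \<in> polys_over S" "smult (coeff g n ^ N) f = q * h + r" "r = 0 \<or> degree r < n"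
    using pseudo_division_over[OF S h h0 f] by (auto simp: deg_h coeff_h)
  have eval: "\<theta> (coeff g n) ^ N * poly (map_poly \<theta> f) x = poly (map_poly \<theta> r) x"
    if \<theta>: "ring_morphism \<theta>" and high: "\<And>i. n < i \<Longrightarrow> \<theta> (coeff g i) = 0" and x: "poly (map_poly \<theta> g) x = 0"
    for \<theta> :: "'a \<Rightarrow> 'd::linordered_field" and x
  proof -
    have "map_poly \<theta> h = map_poly \<theta> g"
      by (rule poly_eqI) (use high ring_morphismD(1)[OF \<theta>] in \<open>auto simp: map_poly_morphism[OF \<theta>] coeff_h\<close>)
    moreover have "map_poly \<theta> (smult (coeff g n ^ N) f) = map_poly \<theta> (q * h + r)" using r(2) by simp
    ultimately have "smult (\<theta> (coeff g n) ^ N) (map_poly \<theta> f) = map_poly \<theta> q * map_poly \<theta> g + map_poly \<theta> r"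
      by (simp add: map_poly_morphism[OF \<theta>] ring_morphismD[OF \<theta>])
    from arg_cong[OF this, of "\<lambda>p. poly p x"] show ?thesis using x by simp
  qed
  have high: "\<phi> (coeff g i) = 0" if "n < i" for i
    using that coeff_eq_0[of "map_poly \<phi> g" i] by (simp add: n_def map_poly_morphism[OF \<phi>])
  show ?thesis
  proof (intro bexI[of _ r] conjI allI impI)
    show "map_poly \<phi> r = 0 \<or> degree (map_poly \<phi> r) < degree (map_poly \<phi> g)"
    proof -
      have "degree (map_poly \<phi> r) \<le> degree r"
        by (rule degree_le) (simp add: map_poly_morphism[OF \<phi>] coeff_eq_0 ring_morphismD(1)[OF \<phi>])
      then show ?thesis using r(3) by (auto simp: n_def)
    qed
    fix \<psi> :: "'a \<Rightarrow> 'c" and z w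
    assume \<psi>: "ring_morphism \<psi>" and ag: "sign_agree \<psi> \<phi> (coeff g ` {..degree g})"
      and z: "poly (map_poly \<psi> g) z = 0" and w: "poly (map_poly \<phi> g) w = 0"
      and s: "same_sign (poly (map_poly \<psi> r) z) (poly (map_poly \<phi> r) w)"
    note sc = sign_agree_coeffs(1)[OF \<phi> \<psi> ag]
    have high': "\<psi> (coeff g i) = 0" if "n < i" for i using same_sign_0_iff[OF sc] high[OF that] by simp
    show "same_sign (poly (map_poly \<psi> f) z) (poly (map_poly \<phi> f) w)"
    proof (rule same_sign_mult_cancel)
      show "same_sign (\<psi> (coeff g n) ^ N * poly (map_poly \<psi> f) z) (\<phi> (coeff g n) ^ N * poly (map_poly \<phi> f) w)"
        using s eval[OF \<psi> _ z] eval[OF \<phi> _ w] high high' by simp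
      show "same_sign (\<psi> (coeff g n) ^ N) (\<phi> (coeff g n) ^ N)" using sc by (rule same_sign_power)
      show "\<psi> (coeff g n) ^ N \<noteq> 0" using same_sign_0_iff[OF sc, of n] lcn by simp
    qed
  qed (rule r(1))
qed

text \<open>
  Replace a polynomial \<open>f\<close> of maximal degree by its derivative and by its remainders modulo the
  other polynomials and the derivative. All of these have smaller degree, the derivative gives
  monotonicity of \<open>f\<close> between the marked points, and the remainders give the signs of \<open>f\<close> at
  them.
\<close>
lemma sign_transfer_step:
  fixes \<phi> :: "'a::comm_ring_1 \<Rightarrow> 'b::real_closed_field" and \<Psi> :: "('a \<Rightarrow> 'c::real_closed_field) set"
  assumes S: "subring_set S" and \<phi>: "ring_morphism \<phi>" and \<Psi>: "\<And>\<psi>. \<psi> \<in> \<Psi> \<Longrightarrow> ring_morphism \<psi>"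
    and F: "finite F" "F \<subseteq> polys_over S" "f \<in> polys_over S"
    and deg: "0 < degree (map_poly \<phi> f)" "\<And>g. g \<in> F \<Longrightarrow> degree (map_poly \<phi> g) \<le> degree (map_poly \<phi> f)"
    and IH: "\<And>R. finite R \<Longrightarrow> R \<subseteq> polys_over S \<Longrightarrow>
       (\<And>r. r \<in> R \<Longrightarrow> degree (map_poly \<phi> r) < degree (map_poly \<phi> f)) \<Longrightarrow> sign_transfer \<Psi> S \<phi> (F \<union> R)"
  shows "sign_transfer \<Psi> S \<phi> (insert f F)"
proof -
  define D where "D = insert (formal_deriv f) F"
  have D: "finite D" "D \<subseteq> polys_over S" using F formal_deriv_over[OF S] by (auto simp: D_def)
  have degd: "degree (map_poly \<phi> (formal_deriv f)) < degree (map_poly \<phi> f)"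
    using deg(1) by (simp add: map_poly_formal_deriv[OF \<phi>] degree_pderiv)
  define ok where "ok = (\<lambda>g r. r \<in> polys_over S \<and>
    (map_poly \<phi> r = 0 \<or> degree (map_poly \<phi> r) < degree (map_poly \<phi> g)) \<and>
    (\<forall>\<psi> :: 'a \<Rightarrow> 'c. ring_morphism \<psi> \<longrightarrow> sign_agree \<psi> \<phi> (coeff g ` {..degree g}) \<longrightarrow>
      (\<forall>z w. poly (map_poly \<psi> g) z = 0 \<longrightarrow> poly (map_poly \<phi> g) w = 0 \<longrightarrow>
        same_sign (poly (map_poly \<psi> r) z) (poly (map_poly \<phi> r) w) \<longrightarrow>
        same_sign (poly (map_poly \<psi> f) z) (poly (map_poly \<phi> f) w))))"
  define D' where "D' = {g \<in> D. map_poly \<phi> g \<noteq> 0}"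
  have "\<forall>g\<in>D'. \<exists>r. ok g r"
    using remainder_over[OF S \<phi> F(3)] D(2) unfolding ok_def D'_def by blast
  then obtain rem where rem: "\<And>g. g \<in> D' \<Longrightarrow> ok g (rem g)" by metis
  have degD: "degree (map_poly \<phi> g) \<le> degree (map_poly \<phi> f)" if "g \<in> D" for g
    using that deg(2) degd by (auto simp: D_def intro: less_imp_le)
  have "sign_transfer \<Psi> S \<phi> (F \<union> insert (formal_deriv f) (rem ` D'))"
  proof (rule IH)
    show "finite (insert (formal_deriv f) (rem ` D'))" using D(1) by (simp add: D'_def)
    show "insert (formal_deriv f) (rem ` D') \<subseteq> polys_over S"
      using D(2) rem by (auto simp: D_def ok_def)
    fix r assume "r \<in> insert (formal_deriv f) (rem ` D')"
    then consider "r = formal_deriv f" | g where "g \<in> D'" "r = rem g" by blast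
    then show "degree (map_poly \<phi> r) < degree (map_poly \<phi> f)"
    proof cases
      case 2
      have "g \<in> D" using 2 by (simp add: D'_def)
      then show ?thesis using rem[OF 2(1)] degD[of g] deg(1) 2(2) by (auto simp: ok_def)
    qed (use degd in simp)
  qed
  then obtain G where G: "G \<subseteq> S" "finite G"
    and GZ: "\<And>\<psi>. \<psi> \<in> \<Psi> \<Longrightarrow> sign_agree \<psi> \<phi> G \<Longrightarrow> \<exists>Z. aligned Z \<and>
      (\<forall>f\<in>F \<union> insert (formal_deriv f) (rem ` D'). matched Z (map_poly \<psi> f) (map_poly \<phi> f))"
    unfolding sign_transfer_def by blast
  define C where "C = (\<Union>g\<in>insert f D. coeff g ` {..degree g})"
  have C: "finite C" "C \<subseteq> S" using D F(3) by (auto simp: C_def polys_over_def)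
  show ?thesis
    unfolding sign_transfer_def
  proof (intro exI[of _ "G \<union> C"] conjI ballI impI)
    show "G \<union> C \<subseteq> S" "finite (G \<union> C)" using G C by auto
    fix \<psi> assume \<psi>: "\<psi> \<in> \<Psi>" and ag: "sign_agree \<psi> \<phi> (G \<union> C)"
    have hom: "ring_morphism \<psi>" by (rule \<Psi>[OF \<psi>])
    have agc: "sign_agree \<psi> \<phi> (coeff g ` {..degree g})" if "g \<in> insert f D" for g
      using ag that unfolding sign_agree_def C_def by blast
    obtain Z where Z: "aligned Z" "\<And>g. g \<in> F \<union> insert (formal_deriv f) (rem ` D') \<Longrightarrow>
        matched Z (map_poly \<psi> g) (map_poly \<phi> g)"
      using GZ[OF \<psi>] ag unfolding sign_agree_Un by blast
    define E where "E = (\<lambda>g. (map_poly \<psi> g, map_poly \<phi> g)) ` D"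
    define Z0 where "Z0 = {(z, w)\<in>Z. \<exists>(p, q)\<in>E. p \<noteq> 0 \<and> poly p z = 0}"
    have E: "matched Z p q" if "(p, q) \<in> E" for p q
      using that Z(2) by (auto simp: E_def D_def)
    have Z0: "aligned Z0" "\<And>g. g \<in> D \<Longrightarrow> matched Z0 (map_poly \<psi> g) (map_poly \<phi> g)"
      using matched_prune[of Z E, OF Z(1) E] unfolding Z0_def by (auto simp: E_def)
    have ends: "same_sign (poly (map_poly \<psi> f) z) (poly (map_poly \<phi> f) w)" if zw: "(z, w) \<in> Z0" for z w
    proof -
      obtain g where g: "g \<in> D" "map_poly \<psi> g \<noteq> 0" "poly (map_poly \<psi> g) z = 0"
        using zw by (auto simp: Z0_def E_def)
      have pos: "same_pos Z z w" using zw Z(1) by (auto simp: Z0_def aligned_def)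
      have "matched Z (map_poly \<psi> g) (map_poly \<phi> g)" using g(1) Z(2) by (auto simp: D_def)
      from same_sign_0_iff[OF matchedD[OF this pos]] have w: "poly (map_poly \<phi> g) w = 0" using g(3) by simp
      have "map_poly \<phi> g \<noteq> 0"
        using g(2) sign_agree_coeffs(2)[OF \<phi> hom agc[of g]] g(1) by (auto simp: poly_eq_iff)
      then have gD': "g \<in> D'" using g(1) by (simp add: D'_def)
      have "matched Z (map_poly \<psi> (rem g)) (map_poly \<phi> (rem g))" using gD' Z(2) by blast
      from matchedD[OF this pos] show ?thesis
        using rem[OF gD'] agc[of g] g(1,3) w hom unfolding ok_def by blast
    qed
    have dm: "matched Z0 (pderiv (map_poly \<psi> f)) (pderiv (map_poly \<phi> f))"
      using Z0(2)[of "formal_deriv f"] by (simp add: D_def map_poly_formal_deriv \<phi> hom)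
    have "degree (map_poly \<psi> f) = degree (map_poly \<phi> f)"
      by (rule sign_agree_coeffs(3)[OF \<phi> hom agc]) simp
    then have nz: "pderiv (map_poly \<psi> f) \<noteq> 0" "pderiv (map_poly \<phi> f) \<noteq> 0"
      using deg(1) by (auto simp: pderiv_eq_0_iff)
    let ?Z = "Z0 \<union> common_roots Z0 (map_poly \<psi> f) (map_poly \<phi> f)"
    have "matched ?Z (map_poly \<psi> g) (map_poly \<phi> g)" if "g \<in> insert f F" for g
    proof (cases "g = f")
      case True
      then show ?thesis using matched_common_roots[OF Z0(1) dm nz ends] by simp
    next
      case False
      then have "g \<in> D" using that by (simp add: D_def)
      then show ?thesis using Z0(2) matched_antimono by blast
    qed
    then show "\<exists>Z. aligned Z \<and> (\<forall>f\<in>insert f F. matched Z (map_poly \<psi> f) (map_poly \<phi> f))"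
      using aligned_common_roots[OF Z0(1) dm nz] by blast
  qed
qed

text \<open>
  Induction on the maximal degree \<open>d\<close> after specialization, and for fixed \<open>d\<close> on the number of
  polynomials of degree \<open>d\<close>.
\<close>
theorem sign_transfer:
  fixes \<phi> :: "'a::comm_ring_1 \<Rightarrow> 'b::real_closed_field" and \<Psi> :: "('a \<Rightarrow> 'c::real_closed_field) set"
  assumes S: "subring_set S" and \<phi>: "ring_morphism \<phi>" and \<Psi>: "\<And>\<psi>. \<psi> \<in> \<Psi> \<Longrightarrow> ring_morphism \<psi>"
    and F: "finite F" "F \<subseteq> polys_over S"
  shows "sign_transfer \<Psi> S \<phi> F"
proof -
  have "sign_transfer \<Psi> S \<phi> F" if "finite F" "F \<subseteq> polys_over S" "\<forall>f\<in>F. degree (map_poly \<phi> f) \<le> d" for d F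
    using that
  proof (induction d arbitrary: F)
    case 0
    define C where "C = (\<Union>g\<in>F. coeff g ` {..degree g})"
    show ?case
      unfolding sign_transfer_def
    proof (intro exI[of _ C] conjI ballI impI)
      show "C \<subseteq> S" "finite C" using 0 by (auto simp: C_def polys_over_def)
      fix \<psi> assume \<psi>: "\<psi> \<in> \<Psi>" and ag: "sign_agree \<psi> \<phi> C"
      have "matched {} (map_poly \<psi> f) (map_poly \<phi> f)" if f: "f \<in> F" for f
      proof -
        have agf: "sign_agree \<psi> \<phi> (coeff f ` {..degree f})"
          using ag f unfolding sign_agree_def C_def by blast
        have "degree (map_poly \<phi> f) = 0" using 0 f by blast
        moreover have "degree (map_poly \<psi> f) = 0"
          using sign_agree_coeffs(3)[OF \<phi> \<Psi>[OF \<psi>] agf] calculation by simp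
        ultimately have "map_poly \<phi> f = [:\<phi> (coeff f 0):]" "map_poly \<psi> f = [:\<psi> (coeff f 0):]"
          using degree_0_id[of "map_poly \<phi> f"] degree_0_id[of "map_poly \<psi> f"]
          by (simp_all add: map_poly_morphism \<phi> \<Psi>[OF \<psi>])
        then show ?thesis using sign_agree_coeffs(1)[OF \<phi> \<Psi>[OF \<psi>] agf, of 0] by (simp add: matched_def)
      qed
      then show "\<exists>Z. aligned Z \<and> (\<forall>f\<in>F. matched Z (map_poly \<psi> f) (map_poly \<phi> f))"
        by (intro exI[of _ "{}"]) (auto simp: aligned_def)
    qed
  next
    case (Suc d)
    show ?case
      using Suc.prems
    proof (induction "card {f\<in>F. degree (map_poly \<phi> f) = Suc d}" arbitrary: F)
      case 0
      then have "\<forall>f\<in>F. degree (map_poly \<phi> f) \<noteq> Suc d" by auto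
      then have "\<forall>f\<in>F. degree (map_poly \<phi> f) \<le> d" using 0 by (metis le_SucE)
      then show ?case using Suc.IH 0 by blast
    next
      case (Suc n)
      then have "{f\<in>F. degree (map_poly \<phi> f) = Suc d} \<noteq> {}" by (metis card.empty nat.simps(3))
      then obtain f where f: "f \<in> F" "degree (map_poly \<phi> f) = Suc d" by blast
      have "sign_transfer \<Psi> S \<phi> (insert f (F - {f}))"
      proof (rule sign_transfer_step[OF S \<phi> \<Psi>])
        fix R assume R: "finite R" "R \<subseteq> polys_over S" "\<And>r. r \<in> R \<Longrightarrow> degree (map_poly \<phi> r) < degree (map_poly \<phi> f)"
        show "sign_transfer \<Psi> S \<phi> (F - {f} \<union> R)"
        proof (rule Suc.hyps(1))
          have "degree (map_poly \<phi> r) \<noteq> Suc d" if "r \<in> R" for r using R(3)[OF that] f(2) by simp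
          then have "{g \<in> F - {f} \<union> R. degree (map_poly \<phi> g) = Suc d} = {g\<in>F. degree (map_poly \<phi> g) = Suc d} - {f}"
            by auto
          then show "n = card {g \<in> F - {f} \<union> R. degree (map_poly \<phi> g) = Suc d}"
            using Suc.hyps(2) f by (simp add: card_Diff_singleton)
        qed (use Suc.prems R f in \<open>auto intro: less_imp_le\<close>)
      qed (use Suc.prems f in auto)
      then show ?case using f(1) by (simp add: insert_absorb)
    qed
  qed
  moreover obtain d where "\<forall>f\<in>F. degree (map_poly \<phi> f) \<le> d"
    using finite_imageI[OF F(1), of "\<lambda>f. degree (map_poly \<phi> f)"] by (metis finite_nat_set_iff_bounded_le imageI)
  ultimately show ?thesis using F by blast
qed

section \<open>The real closure of an ordered field\<close>


lemma chain_common_member: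
  assumes "subset.chain A C" "x \<in> \<Union>C" "y \<in> \<Union>C"
  shows "\<exists>T\<in>C. x \<in> T \<and> y \<in> T"
  using assms unfolding subset.chain_def by blast

text \<open>
  The nonnegative elements of a field that is ordered, or at least formally real, and is
  not itself given: it is recovered as the set of differences. Closure under inverses
  makes that set a field, so that no separate subfield has to be carried along.
\<close>
definition real_cone :: "'w::field set \<Rightarrow> bool" where
  "real_cone T \<longleftrightarrow> 0 \<in> T \<and> 1 \<in> T \<and> - 1 \<notin> T \<and> (\<forall>x\<in>T. inverse x \<in> T) \<and>
     (\<forall>x\<in>T. \<forall>y\<in>T. x + y \<in> T \<and> x * y \<in> T \<and> (x - y)\<^sup>2 \<in> T)"

lemma real_coneD:
  assumes "real_cone T"
  shows "0 \<in> T" "1 \<in> T" "- 1 \<notin> T" "x \<in> T \<Longrightarrow> inverse x \<in> T" "x \<in> T \<Longrightarrow> y \<in> T \<Longrightarrow> x + y \<in> T"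
    "x \<in> T \<Longrightarrow> y \<in> T \<Longrightarrow> x * y \<in> T" "x \<in> T \<Longrightarrow> y \<in> T \<Longrightarrow> (x - y)\<^sup>2 \<in> T"
  using assms by (auto simp: real_cone_def)

definition maximal_real_cone :: "'w::field set \<Rightarrow> bool" where
  "maximal_real_cone T \<longleftrightarrow> real_cone T \<and> (\<forall>T'. real_cone T' \<longrightarrow> T \<subseteq> T' \<longrightarrow> T' = T)"

lemma maximal_real_cone_exists:
  assumes "real_cone T0"
  shows "\<exists>T. maximal_real_cone T \<and> T0 \<subseteq> T"
proof -
  let ?A = "{T. real_cone T \<and> T0 \<subseteq> T}"
  have "\<exists>M\<in>?A. \<forall>Y\<in>?A. M \<subseteq> Y \<longrightarrow> Y = M"
  proof (rule subset_Zorn_nonempty)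
    fix C assume C: "C \<noteq> {}" "subset.chain ?A C"
    have mem: "real_cone T" "T0 \<subseteq> T" if "T \<in> C" for T using C(2) that unfolding subset.chain_def by auto
    have "real_cone (\<Union>C)"
      unfolding real_cone_def
    proof (intro conjI ballI)
      fix x y assume xy: "x \<in> \<Union>C" "y \<in> \<Union>C"
      then obtain T where T: "T \<in> C" "x \<in> T" "y \<in> T" using chain_common_member[OF C(2) xy] by blast
      note D = real_coneD[OF mem(1)[OF T(1)]]
      show "x + y \<in> \<Union>C" "x * y \<in> \<Union>C" "(x - y)\<^sup>2 \<in> \<Union>C"
        using D(5-7)[OF T(2,3)] T(1) by blast+
    next
      show "- 1 \<notin> \<Union>C" using mem real_coneD(3) by blast
      show "0 \<in> \<Union>C" "1 \<in> \<Union>C" using C(1) mem real_coneD(1,2) by blast+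
      fix x assume "x \<in> \<Union>C" then show "inverse x \<in> \<Union>C" using mem real_coneD(4) by blast
    qed
    then show "\<Union>C \<in> ?A" using C(1) mem(2) by blast
  qed (use assms in auto)
  then obtain M where "real_cone M" "T0 \<subseteq> M" "\<forall>Y\<in>?A. M \<subseteq> Y \<longrightarrow> Y = M" by blast
  then show ?thesis unfolding maximal_real_cone_def by (intro exI[of _ M]) auto
qed

definition cone_field :: "'w::field set \<Rightarrow> 'w set" where
  "cone_field T = {x - y | x y. x \<in> T \<and> y \<in> T}"

lemma cone_fieldI: "x \<in> T \<Longrightarrow> y \<in> T \<Longrightarrow> x - y \<in> cone_field T"
  by (auto simp: cone_field_def)

lemma cone_field:
  assumes T: "real_cone T"
  shows "T \<subseteq> cone_field T" "subring_set (cone_field T)" "x \<in> cone_field T \<Longrightarrow> x\<^sup>2 \<in> T"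
    "x \<in> cone_field T \<Longrightarrow> inverse x \<in> cone_field T"
proof -
  note D = real_coneD[OF T]
  show sub: "T \<subseteq> cone_field T" using cone_fieldI[of _ T 0] D(1) by auto
  show ring: "subring_set (cone_field T)"
    unfolding subring_set_def
  proof (intro conjI ballI)
    show "1 \<in> cone_field T" using sub D(2) by blast
    fix x y assume "x \<in> cone_field T" "y \<in> cone_field T"
    then obtain a b c d where ab: "x = a - b" "a \<in> T" "b \<in> T" and cd: "y = c - d" "c \<in> T" "d \<in> T"
      by (auto simp: cone_field_def)
    have diff: "x - y = (a + d) - (b + c)" and prod: "x * y = (a * c + b * d) - (a * d + b * c)"
      by (simp_all add: ab cd algebra_simps)
    show "x - y \<in> cone_field T" unfolding diff using ab cd D by (intro cone_fieldI) auto
    show "x * y \<in> cone_field T" unfolding prod using ab cd D by (intro cone_fieldI) auto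
  qed
  show sq: "x \<in> cone_field T \<Longrightarrow> x\<^sup>2 \<in> T" for x using D(7) by (auto simp: cone_field_def)
  show "inverse x \<in> cone_field T" if x: "x \<in> cone_field T"
  proof -
    have "inverse (x\<^sup>2) \<in> cone_field T" using sq[OF x] D(4) sub by blast
    then have "x * inverse (x\<^sup>2) \<in> cone_field T" by (rule subring_setD(6)[OF ring x])
    moreover have "x * inverse (x\<^sup>2) = inverse x" by (cases "x = 0") (auto simp: power2_eq_square field_simps)
    ultimately show ?thesis by simp
  qed
qed

lemma real_cone_antisym:
  assumes "real_cone T" "x \<in> T" "- x \<in> T"
  shows "x = 0"
proof (rule ccontr)
  assume "x \<noteq> 0"
  then have "- 1 = x * (- x) * (inverse x * inverse x)" by (simp add: field_simps)
  also have "\<dots> \<in> T" by (intro real_coneD(4,6)[OF assms(1)] assms(2,3))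
  finally show False using real_coneD(3)[OF assms(1)] by blast
qed

text \<open>
  If \<open>a\<close> is not in \<open>T\<close>, then \<open>-1\<close> cannot be written as \<open>s - a t\<close>, since that would express \<open>a\<close>
  through \<open>T\<close>. So \<open>- a\<close> can be adjoined, and by maximality it is already there.
\<close>
lemma maximal_real_cone_total:
  assumes T: "maximal_real_cone T" and a: "a \<in> cone_field T"
  shows "a \<in> T \<or> - a \<in> T"
proof (rule ccontr)
  assume neg: "\<not> (a \<in> T \<or> - a \<in> T)"
  have rT: "real_cone T" using T by (simp add: maximal_real_cone_def)
  note D = real_coneD[OF rT] and K = cone_field[OF rT]
  define T' where "T' = {s - a * t | s t. s \<in> T \<and> t \<in> T}"
  have I: "s - a * t \<in> T'" if "s \<in> T" "t \<in> T" for s t using that by (auto simp: T'_def)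
  have sub: "T \<subseteq> T'" using I[of _ 0] D(1) by auto
  have "s - a * t \<in> cone_field T" if "s \<in> T" "t \<in> T" for s t
    using subring_setD(5)[OF K(2) _ subring_setD(6)[OF K(2) a], of s t] K(1) that by blast
  then have T'K: "T' \<subseteq> cone_field T" by (auto simp: T'_def)
  have mult: "x * y \<in> T'" if xy: "x \<in> T'" "y \<in> T'" for x y
  proof -
    obtain s t s' t' where st: "x = s - a * t" "s \<in> T" "t \<in> T" "y = s' - a * t'" "s' \<in> T" "t' \<in> T"
      using xy unfolding T'_def by blast
    have "x * y = (s * s' + a\<^sup>2 * (t * t')) - a * (s * t' + t * s')"
      by (simp add: st algebra_simps power2_eq_square)
    moreover have "s * s' + a\<^sup>2 * (t * t') \<in> T" "s * t' + t * s' \<in> T"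
      by (intro D(5,6) st(2,3,5,6) K(3)[OF a])+
    ultimately show ?thesis using I[of "s * s' + a\<^sup>2 * (t * t')" "s * t' + t * s'"] by simp
  qed
  have "real_cone T'"
    unfolding real_cone_def
  proof (intro conjI ballI)
    show "0 \<in> T'" "1 \<in> T'" using sub D by blast+
    show "- 1 \<notin> T'"
    proof
      assume "- 1 \<in> T'"
      then obtain s t where st: "- 1 = s - a * t" "s \<in> T" "t \<in> T" unfolding T'_def by blast
      have at: "a * t = 1 + s" using st(1) by (simp add: algebra_simps)
      have "t \<noteq> 0"
      proof
        assume "t = 0"
        then have "s = - 1" using st(1) by simp
        then show False using st(2) D(3) by simp
      qed
      then have "a = (1 + s) * inverse t" using at by (simp add: field_simps)
      moreover have "(1 + s) * inverse t \<in> T" by (intro D st(2,3))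
      ultimately show False using neg by metis
    qed
    fix x assume x: "x \<in> T'"
    have "(inverse x)\<^sup>2 \<in> T'" using K(3)[OF K(4)] x T'K sub by blast
    then have "x * (inverse x)\<^sup>2 \<in> T'" by (rule mult[OF x])
    moreover have "x * (inverse x)\<^sup>2 = inverse x" by (cases "x = 0") (auto simp: power2_eq_square)
    ultimately show "inverse x \<in> T'" by simp
    fix y assume y: "y \<in> T'"
    show "x * y \<in> T'" by (rule mult[OF x y])
    have "x - y \<in> cone_field T" using subring_setD(5)[OF K(2), of x y] x y T'K by blast
    then show "(x - y)\<^sup>2 \<in> T'" using K(3) sub by blast
    obtain s t s' t' where st: "x = s - a * t" "s \<in> T" "t \<in> T" "y = s' - a * t'" "s' \<in> T" "t' \<in> T"
      using x y unfolding T'_def by blast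
    have "x + y = (s + s') - a * (t + t')" by (simp add: st algebra_simps)
    then show "x + y \<in> T'" using I[OF D(5)[OF st(2,5)] D(5)[OF st(3,6)]] by simp
  qed
  then have "T' = T" using T sub by (auto simp: maximal_real_cone_def)
  moreover have "- a \<in> T'" using I[of 0 1] D by simp
  ultimately show False using neg by blast
qed

text \<open>
  The candidates for nonnegative elements in an extension field \<open>U\<close> of the field ordered by
  \<open>T\<close>.
\<close>
inductive_set weighted_squares :: "'w::field set \<Rightarrow> 'w set \<Rightarrow> 'w set" for T U where
  zero: "0 \<in> weighted_squares T U"
| add: "t \<in> weighted_squares T U \<Longrightarrow> c \<in> T \<Longrightarrow> u \<in> U \<Longrightarrow> t + c * u\<^sup>2 \<in> weighted_squares T U"

lemma weighted_squares_closed: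
  assumes T: "\<forall>c\<in>T. \<forall>d\<in>T. c * d \<in> T" "1 \<in> T" "T \<subseteq> U" and U: "subring_set U"
  shows "x \<in> weighted_squares T U \<Longrightarrow> y \<in> weighted_squares T U \<Longrightarrow> x + y \<in> weighted_squares T U"
    "x \<in> weighted_squares T U \<Longrightarrow> y \<in> weighted_squares T U \<Longrightarrow> x * y \<in> weighted_squares T U"
    "weighted_squares T U \<subseteq> U" "x \<in> U \<Longrightarrow> x\<^sup>2 \<in> weighted_squares T U" "T \<subseteq> weighted_squares T U"
proof -
  let ?W = "weighted_squares T U"
  show sum: "x + y \<in> ?W" if "x \<in> ?W" "y \<in> ?W" for x y
    using that(2)
  proof induction
    case (add t c u)
    show ?case using weighted_squares.add[OF add.IH add.hyps(2,3)] by (simp add: add.assoc)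
  qed (use that in simp)
  have scale: "x * (c * u\<^sup>2) \<in> ?W" if "x \<in> ?W" "c \<in> T" "u \<in> U" for x c u
    using that(1)
  proof induction
    case (add t d v)
    have "(t + d * v\<^sup>2) * (c * u\<^sup>2) = t * (c * u\<^sup>2) + (d * c) * (v * u)\<^sup>2"
      by (simp add: algebra_simps power_mult_distrib)
    moreover have "d * c \<in> T" "v * u \<in> U" using add that T subring_setD(6)[OF U] by auto
    ultimately show ?case using weighted_squares.add[OF add.IH] by simp
  qed (simp add: weighted_squares.zero)
  show "x * y \<in> ?W" if "x \<in> ?W" "y \<in> ?W" for x y
    using that(2)
  proof induction
    case (add t c u)
    show ?case using sum[OF add.IH scale[OF that(1) add.hyps(2,3)]] by (simp add: algebra_simps)
  qed (simp add: weighted_squares.zero)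
  show "?W \<subseteq> U"
  proof
    fix x assume "x \<in> ?W"
    then show "x \<in> U"
      by induction (use T(3) subring_setD[OF U] in auto)
  qed
  show "x\<^sup>2 \<in> ?W" if "x \<in> U" for x using weighted_squares.add[OF weighted_squares.zero T(2) that] by simp
  show "T \<subseteq> ?W" using weighted_squares.add[OF weighted_squares.zero, of _ T 1 U] subring_setD(2)[OF U] by auto
qed

text \<open>
  Induction on the degree, following Artin and Whaples. Suppose that \<open>p\<close> changes sign between \<open>a\<close> and \<open>b\<close>
  but has no root in the field \<open>K\<close> ordered by \<open>T\<close>. By the induction hypothesis \<open>p\<close> is
  irreducible. Let \<open>\<omega>\<close> be a root of \<open>p\<close> in the ambient algebraically closed field. If the ordering did
  not extend to \<open>K(\<omega>)\<close>, then \<open>-1\<close> would be a weighted sum of squares there, that is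
  \<open>1 + (\<Sum>i. c\<^sub>i f\<^sub>i\<^sup>2) = h p\<close> with \<open>c\<^sub>i \<ge> 0\<close> and \<open>deg f\<^sub>i < deg p\<close>. The left hand side is
  positive on \<open>K\<close>, so \<open>h\<close> changes sign together with \<open>p\<close>; as \<open>deg h < deg p\<close>, it has a root in \<open>K\<close>,
  which contradicts this positivity. So the ordering extends, against the
  maximality of \<open>T\<close>.
\<close>
lemma cone_field_sign_change_root:
  fixes T :: "'w::alg_closed_field set"
  assumes T: "maximal_real_cone T"
    and p: "p \<in> polys_over (cone_field T)" and ab: "a \<in> cone_field T" "b \<in> cone_field T"
    and sign: "- poly p a \<in> T" "poly p a \<noteq> 0" "poly p b \<in> T" "poly p b \<noteq> 0"
  shows "\<exists>c\<in>cone_field T. poly p c = 0"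
  using p ab sign
proof (induction "degree p" arbitrary: p a b rule: less_induct)
  case less
  define K where "K = cone_field T"
  have rT: "real_cone T" using T by (simp add: maximal_real_cone_def)
  note D = real_coneD[OF rT] and KD = cone_field[OF rT, folded K_def]
  note R = subring_setD[OF KD(2)] and P = polys_over_closed[OF KD(2)]
  have p: "p \<in> polys_over K" and a: "a \<in> K" and b: "b \<in> K" using less.prems by (auto simp: K_def)
  have tot: "x \<in> T \<or> - x \<in> T" if "x \<in> K" for x
    using maximal_real_cone_total[OF T] that by (simp add: K_def)
  have anti: "x = 0" if "x \<in> T" "- x \<in> T" for x using real_cone_antisym[OF rT that] .
  have lcK: "coeff f i \<in> K" if "f \<in> polys_over K" for f i using that by (simp add: polys_over_def)
  have IH: "\<exists>c\<in>K. poly q c = 0"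
    if "degree q < degree p" "q \<in> polys_over K" "c \<in> K" "d \<in> K" "- poly q c \<in> T" "poly q c \<noteq> 0"
      "poly q d \<in> T" "poly q d \<noteq> 0" for q c d
    using less.hyps[OF that(1)] that by (simp add: K_def)
  show ?case
  proof (rule ccontr)
    assume "\<not> ?case"
    then have noroot: "poly p c \<noteq> 0" if "c \<in> K" for c using that by (auto simp: K_def)
    have p0: "p \<noteq> 0" using less.prems by auto
    have degp: "0 < degree p"
    proof (rule ccontr)
      assume "\<not> 0 < degree p"
      then obtain c where "p = [:c:]" by (meson degree_eq_zeroE gr_zeroI)
      then show False using less.prems anti[of c] by auto
    qed
    \<comment> \<open>minimality of the degree makes \<open>p\<close> irreducible over \<open>K\<close>\<close>
    have irred: False if qr: "p = q * r" "q \<in> polys_over K" "r \<in> polys_over K"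
      "degree q < degree p" "degree r < degree p" for q r
    proof -
      have nz: "poly q a \<noteq> 0" "poly r a \<noteq> 0" "poly q b \<noteq> 0" "poly r b \<noteq> 0"
        using less.prems(5,7) qr(1) by auto
      have qc: "\<not> (- poly q c \<in> T \<and> poly q d \<in> T)" if "c \<in> {a, b}" "d \<in> {a, b}" for c d
        using IH[of q c d] qr nz noroot that a b by auto
      have rc: "\<not> (- poly r c \<in> T \<and> poly r d \<in> T)" if "c \<in> {a, b}" "d \<in> {a, b}" for c d
        using IH[of r c d] qr nz noroot that a b by auto
      have vals: "poly q a \<in> K" "poly q b \<in> K" "poly r a \<in> K" "poly r b \<in> K" using P(8) a b qr by blast+
      have mm: "- x * - y \<in> T \<Longrightarrow> x * y \<in> T" for x y :: 'w by simp
      have "poly q a * poly r a \<in> T \<or> - (poly q b * poly r b) \<in> T"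
      proof (cases "poly q a \<in> T")
        case True
        then have qb: "poly q b \<in> T" using qc[of b a] tot[OF vals(2)] by auto
        show ?thesis
        proof (cases "poly r a \<in> T")
          case False
          then have "- poly r b \<in> T" using rc[of a b] tot vals by auto
          then have "poly q b * - poly r b \<in> T" by (intro D(6) qb)
          then show ?thesis by simp
        qed (use D(6)[OF True] in blast)
      next
        case False
        then have qa: "- poly q a \<in> T" using tot vals by blast
        then have qb: "- poly q b \<in> T" using qc[of a b] tot[OF vals(2)] by auto
        show ?thesis
        proof (cases "poly r a \<in> T")
          case True
          then have "poly r b \<in> T" using rc[of b a] tot vals by auto
          then have "- poly q b * poly r b \<in> T" by (intro D(6) qb)
          then show ?thesis by simp
        next
          case False
          then have "- poly r a \<in> T" using tot vals by blast
          then have "- poly q a * - poly r a \<in> T" by (intro D(6) qa)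
          then show ?thesis by simp
        qed
      qed
      then show False using less.prems(4-7) anti[of "poly p a"] anti[of "poly p b"] qr(1) by auto
    qed
    obtain \<omega> where \<omega>: "poly p \<omega> = 0" using alg_closed_imp_poly_has_root[OF degp] by blast
    have invK: "inverse c \<in> K" if "c \<in> K" for c using KD(4) that .
    \<comment> \<open>over a field the constant factor of pseudo-division can be cancelled\<close>
    have divide: "\<exists>q\<in>polys_over K. \<exists>r\<in>polys_over K. f = q * g + r \<and> (r = 0 \<or> degree r < degree g)"
      if fg: "f \<in> polys_over K" "g \<in> polys_over K" "g \<noteq> 0" for f g
    proof -
      obtain N q r where qr: "q \<in> polys_over K" "r \<in> polys_over K" "smult (lead_coeff g ^ N) f = q * g + r"
        "r = 0 \<or> degree r < degree g" using pseudo_division_over[OF KD(2) fg(2,3,1)] by blast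
      let ?d = "inverse (lead_coeff g ^ N)"
      have dK: "?d \<in> K" by (intro invK R(7) lcK[OF fg(2)])
      have "f = smult ?d (smult (lead_coeff g ^ N) f)" using fg(3) by simp
      also have "\<dots> = smult ?d q * g + smult ?d r" unfolding qr(3) by (simp add: smult_add_right)
      finally have "f = smult ?d q * g + smult ?d r" .
      moreover have "smult ?d r = 0 \<or> degree (smult ?d r) < degree g" using qr(4) fg(3) by auto
      ultimately show ?thesis using P(7)[OF dK] qr(1,2) by blast
    qed
    \<comment> \<open>so \<open>p\<close> is, up to a factor, the minimal polynomial of \<open>\<omega>\<close>\<close>
    have minimal: "degree p \<le> degree g" if "g \<in> polys_over K" "g \<noteq> 0" "poly g \<omega> = 0" for g
      using that
    proof (induction "degree g" arbitrary: g rule: less_induct)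
      case (less g)
      show ?case
      proof (rule ccontr)
        assume lt: "\<not> degree p \<le> degree g"
        obtain q r where qr: "q \<in> polys_over K" "r \<in> polys_over K" "p = q * g + r" "r = 0 \<or> degree r < degree g"
          using divide[OF p less.prems(1,2)] by blast
        have "poly r \<omega> = 0" using \<omega> less.prems(3) qr(3) by simp
        then have r0: "r = 0" using less.hyps[of r] qr lt by fastforce
        then have pq: "p = q * g" using qr by simp
        have "0 < degree g"
        proof (rule ccontr)
          assume "\<not> 0 < degree g"
          then obtain c where "g = [:c:]" by (meson degree_eq_zeroE gr_zeroI)
          then show False using less.prems by auto
        qed
        then have "degree q < degree p" using pq p0 by (auto simp: degree_mult_eq)
        then show False using irred[OF pq qr(1) less.prems(1)] lt by simp
      qed
    qed
    define U where "U = (\<lambda>f. poly f \<omega>) ` polys_over K"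
    have reduce: "\<exists>f\<in>polys_over K. u = poly f \<omega> \<and> degree f < degree p" if "u \<in> U" for u
    proof -
      obtain f where f: "f \<in> polys_over K" "u = poly f \<omega>" using \<open>u \<in> U\<close> by (auto simp: U_def)
      obtain q r where "q \<in> polys_over K" "r \<in> polys_over K" "f = q * p + r" "r = 0 \<or> degree r < degree p"
        using divide[OF f(1) p p0] by blast
      then show ?thesis using f(2) \<omega> degp by (intro bexI[of _ r]) auto
    qed
    have UI: "poly f \<omega> \<in> U" if "f \<in> polys_over K" for f using that by (auto simp: U_def)
    have KU: "K \<subseteq> U" using UI[OF P(2)] by auto
    have Uring: "subring_set U"
      unfolding subring_set_def
    proof (intro conjI ballI)
      show "1 \<in> U" using KU R(2) by blast
      fix u v assume "u \<in> U" "v \<in> U"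
      then obtain f g where fg: "f \<in> polys_over K" "u = poly f \<omega>" "g \<in> polys_over K" "v = poly g \<omega>"
        by (auto simp: U_def)
      show "u - v \<in> U" "u * v \<in> U" using UI[OF P(5)[OF fg(1,3)]] UI[OF P(6)[OF fg(1,3)]] fg by auto
    qed
    \<comment> \<open>the Euclidean algorithm, one division at a time\<close>
    have Uinv: "inverse (poly g \<omega>) \<in> U" if "g \<in> polys_over K" "degree g < degree p" for g
      using that
    proof (induction "degree g" arbitrary: g rule: less_induct)
      case (less g)
      show ?case
      proof (cases "degree g = 0")
        case True
        then obtain c where "g = [:c:]" by (meson degree_eq_zeroE)
        then show ?thesis using lcK[OF less.prems(1), of 0] KU invK by auto
      next
        case False
        then have "g \<noteq> 0" by auto
        obtain q r where qr: "q \<in> polys_over K" "r \<in> polys_over K" "p = q * g + r" "r = 0 \<or> degree r < degree g"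
          using divide[OF p less.prems(1) \<open>g \<noteq> 0\<close>] by blast
        have "r \<noteq> 0"
        proof
          assume "r = 0"
          then have pq: "p = q * g" using qr by simp
          then have "degree q < degree p" using p0 False by (auto simp: degree_mult_eq)
          then show False using irred[OF pq qr(1) less.prems(1)] less.prems(2) by simp
        qed
        then have r: "degree r < degree g" "poly r \<omega> \<noteq> 0"
          using qr minimal[of r] less.prems(2) by fastforce+
        have "inverse (poly r \<omega>) \<in> U" using less.hyps[OF r(1) qr(2)] r(1) less.prems(2) by simp
        moreover have "poly q \<omega> \<in> U" using UI qr by blast
        ultimately have "- (poly q \<omega> * inverse (poly r \<omega>)) \<in> U" by (intro subring_setD(3,6)[OF Uring])
        moreover have "poly r \<omega> = - (poly q \<omega> * poly g \<omega>)"
          using \<omega> qr(3) by (simp add: eq_neg_iff_add_eq_0 add.commute)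
        then have "- (poly q \<omega> * inverse (poly r \<omega>)) = inverse (poly g \<omega>)" using r(2) by (auto simp: field_simps)
        ultimately show ?thesis by simp
      qed
    qed
    define T' where "T' = weighted_squares T U"
    have TU: "T \<subseteq> U" using KU KD(1) by blast
    have "\<forall>c\<in>T. \<forall>d\<in>T. c * d \<in> T" using D(6) by blast
    note W = weighted_squares_closed[OF this D(2) TU Uring, folded T'_def]
    \<comment> \<open>the bound keeps the cofactor of \<open>p\<close> below the degree of \<open>p\<close>\<close>
    have repr: "\<exists>G\<in>polys_over K. degree G \<le> 2 * (degree p - 1) \<and> t = poly G \<omega> \<and> (\<forall>c\<in>K. poly G c \<in> T)"
      if "t \<in> T'" for t
      using that unfolding T'_def
    proof induction
      case zero
      then show ?case using P(1) D(1) by (intro bexI[of _ 0]) auto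
    next
      case (add t c u)
      then obtain G where G: "G \<in> polys_over K" "degree G \<le> 2 * (degree p - 1)" "t = poly G \<omega>"
        "\<forall>c\<in>K. poly G c \<in> T" by blast
      obtain f where f: "f \<in> polys_over K" "u = poly f \<omega>" "degree f < degree p" using reduce[OF add.hyps(3)] by blast
      have cK: "c \<in> K" using add KD(1) by blast
      let ?G = "G + smult c (f * f)"
      have "degree (smult c (f * f)) \<le> degree f + degree f"
        using degree_smult_le[of c "f * f"] degree_mult_le[of f f] by linarith
      also have "\<dots> \<le> 2 * (degree p - 1)" using f(3) by simp
      finally have "degree ?G \<le> 2 * (degree p - 1)" using G(2) by (intro degree_add_le)
      moreover have "?G \<in> polys_over K" using P(4)[OF G(1) P(7)[OF cK P(6)[OF f(1) f(1)]]] .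
      moreover have "poly ?G x \<in> T" if "x \<in> K" for x
      proof -
        have "c * (poly f x)\<^sup>2 \<in> T" using D(6)[OF add.hyps(2) KD(3)[OF P(8)[OF that f(1)]]] .
        then show ?thesis using D(5) G(4) that by (simp add: power2_eq_square)
      qed
      ultimately show ?case using G(3) f(2) by (intro bexI[of _ ?G]) (auto simp: power2_eq_square)
    qed
    have "- 1 \<notin> T'"
    proof
      assume "- 1 \<in> T'"
      from repr[OF this] obtain G where G: "G \<in> polys_over K" "degree G \<le> 2 * (degree p - 1)" "- 1 = poly G \<omega>"
        "\<forall>c\<in>K. poly G c \<in> T" by blast
      define H where "H = [:1:] + G"
      have H: "H \<in> polys_over K" unfolding H_def by (rule P(4)[OF P(2)[OF R(2)] G(1)])
      have "degree H \<le> 2 * (degree p - 1)" unfolding H_def using G(2) by (intro degree_add_le) auto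
      have H\<omega>: "poly H \<omega> = 0" using G(3) by (simp add: H_def flip: G(3))
      have HT: "poly H c \<in> T" "poly H c \<noteq> 0" if "c \<in> K" for c
      proof -
        have Gc: "poly G c \<in> T" using G(4) that by blast
        show "poly H c \<in> T" using D(5)[OF D(2) Gc] by (simp add: H_def)
        show "poly H c \<noteq> 0"
        proof
          assume "poly H c = 0"
          then have "poly G c = - 1" by (simp add: H_def eq_neg_iff_add_eq_0 add.commute)
          then show False using Gc D(3) by simp
        qed
      qed
      obtain h r where hr: "h \<in> polys_over K" "r \<in> polys_over K" "H = h * p + r" "r = 0 \<or> degree r < degree p"
        using divide[OF H p p0] by blast
      have "poly r \<omega> = 0" using H\<omega> hr(3) \<omega> by simp
      then have "r = 0" using minimal[of r] hr by fastforce
      then have Hh: "H = h * p" using hr by simp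
      have "H \<noteq> 0" using HT(2)[OF a] by auto
      then have "degree h < degree p"
        using \<open>degree H \<le> 2 * (degree p - 1)\<close> degp unfolding Hh by (auto simp: degree_mult_eq)
      have prod: "poly h c * poly p c \<in> T" "poly h c \<noteq> 0" if "c \<in> K" for c using HT[OF that] by (auto simp: Hh)
      have hK: "poly h c \<in> K" if "c \<in> K" for c using P(8) hr(1) that by blast
      have "- poly h a \<in> T"
      proof (rule ccontr)
        assume "- poly h a \<notin> T"
        then have "poly h a \<in> T" using tot hK a by blast
        then have "poly h a * - poly p a \<in> T" using D(6)[OF _ less.prems(4)] by blast
        then show False using anti[OF prod(1)[OF a]] prod(2)[OF a] less.prems by simp
      qed
      moreover have "poly h b \<in> T"
      proof (rule ccontr)
        assume "poly h b \<notin> T"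
        then have "- poly h b \<in> T" using tot hK b by blast
        then have "- poly h b * poly p b \<in> T" using D(6)[OF _ less.prems(6)] by blast
        then show False using anti[OF prod(1)[OF b]] prod(2)[OF b] less.prems by simp
      qed
      ultimately obtain c where "c \<in> K" "poly h c = 0"
        using IH[OF \<open>degree h < degree p\<close> hr(1) a b] prod(2)[OF a] prod(2)[OF b] by blast
      then show False using HT(2)[of c] by (simp add: Hh)
    qed
    then have "real_cone T'"
      unfolding real_cone_def
    proof (intro conjI ballI)
      show "0 \<in> T'" "1 \<in> T'" using W(5) D(1,2) by blast+
      fix x assume x: "x \<in> T'"
      then have "x \<in> U" using W(3) by blast
      then have "inverse x \<in> U" using reduce[of x] Uinv by blast
      then have "x * (inverse x)\<^sup>2 \<in> T'" by (intro W(2)[OF x] W(4))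
      moreover have "x * (inverse x)\<^sup>2 = inverse x" by (cases "x = 0") (auto simp: power2_eq_square)
      ultimately show "inverse x \<in> T'" by simp
      fix y assume y: "y \<in> T'"
      show "x + y \<in> T'" "x * y \<in> T'" by (rule W(1)[OF x y], rule W(2)[OF x y])
      have "x - y \<in> U" using subring_setD(5)[OF Uring, of x y] x y W(3) by blast
      then show "(x - y)\<^sup>2 \<in> T'" by (rule W(4))
    qed
    then have TT': "T' = T" using T W(5) by (auto simp: maximal_real_cone_def)
    \<comment> \<open>\<open>\<omega>\<close> is a difference of two squares of \<open>U\<close>, which lie in \<open>T' = T\<close>, so it lies in \<open>K\<close>\<close>
    have "\<omega> \<in> U" using UI[OF P(3)[OF R(2), of 1]] by (simp add: poly_monom)
    have two: "(2::'w) \<noteq> 0"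
    proof
      assume "(2::'w) = 0"
      then have "(1::'w) = - 1" by (metis eq_neg_iff_add_eq_0 one_add_one)
      then show False using D(2,3) by metis
    qed
    define h where "h = inverse (2::'w)"
    have hh: "h * 2 = 1" using two by (simp add: h_def)
    have hU: "h \<in> U" unfolding h_def using invK[of 2] R(8)[of 2] KU by auto
    have "((\<omega> + 1) * h)\<^sup>2 \<in> T'" "((\<omega> - 1) * h)\<^sup>2 \<in> T'"
      by (intro W(4) subring_setD(2,4,5,6)[OF Uring] \<open>\<omega> \<in> U\<close> hU)+
    then have "((\<omega> + 1) * h)\<^sup>2 \<in> T" "((\<omega> - 1) * h)\<^sup>2 \<in> T" by (simp_all add: TT')
    then have "((\<omega> + 1) * h)\<^sup>2 - ((\<omega> - 1) * h)\<^sup>2 \<in> K" unfolding K_def by (rule cone_fieldI)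
    moreover have "((\<omega> + 1) * h)\<^sup>2 - ((\<omega> - 1) * h)\<^sup>2 = \<omega> * (h * 2) * (h * 2)"
      by (simp add: algebra_simps power2_eq_square)
    ultimately have "\<omega> \<in> K" using hh by simp
    then show False using noroot \<omega> by blast
  qed
qed

text \<open>
  Fixing one maximal cone by choice makes it a constant, from which a type can be defined.
\<close>
definition real_closure_cone :: "'a::linordered_field alg_closure set" where
  "real_closure_cone = (SOME T. maximal_real_cone T \<and> to_ac ` {x. 0 \<le> x} \<subseteq> T)"

lemma real_closure_cone:
  "maximal_real_cone (real_closure_cone :: 'a::linordered_field alg_closure set)"
  "0 \<le> x \<Longrightarrow> to_ac x \<in> (real_closure_cone :: 'a alg_closure set)"
proof -
  have "real_cone (to_ac ` {x::'a. 0 \<le> x})"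
    unfolding real_cone_def
  proof (intro conjI ballI)
    show "0 \<in> to_ac ` {x::'a. 0 \<le> x}" "1 \<in> to_ac ` {x::'a. 0 \<le> x}"
      by (intro image_eqI[of _ _ 0] image_eqI[of _ _ 1]; simp)+
    show "- 1 \<notin> to_ac ` {x::'a. 0 \<le> x}"
    proof
      assume "- 1 \<in> to_ac ` {x::'a. 0 \<le> x}"
      then obtain x :: 'a where "0 \<le> x" "to_ac x = to_ac (- 1)" by auto
      then show False unfolding to_ac_eq_iff by simp
    qed
    fix u :: "'a alg_closure" assume "u \<in> to_ac ` {x. 0 \<le> x}"
    then obtain x where x: "0 \<le> x" "u = to_ac x" by auto
    show "inverse u \<in> to_ac ` {x. 0 \<le> x}" using x by (intro image_eqI[of _ _ "inverse x"]) auto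
    fix v :: "'a alg_closure" assume "v \<in> to_ac ` {x. 0 \<le> x}"
    then obtain y where y: "0 \<le> y" "v = to_ac y" by auto
    show "u + v \<in> to_ac ` {x. 0 \<le> x}" using x y by (intro image_eqI[of _ _ "x + y"]) auto
    show "u * v \<in> to_ac ` {x. 0 \<le> x}" using x y by (intro image_eqI[of _ _ "x * y"]) auto
    show "(u - v)\<^sup>2 \<in> to_ac ` {x. 0 \<le> x}" using x y by (intro image_eqI[of _ _ "(x - y)\<^sup>2"]) auto
  qed
  then have "\<exists>T. maximal_real_cone T \<and> to_ac ` {x::'a. 0 \<le> x} \<subseteq> T" by (rule maximal_real_cone_exists)
  from someI_ex[OF this] have "maximal_real_cone (real_closure_cone :: 'a alg_closure set)"
    "to_ac ` {x::'a. 0 \<le> x} \<subseteq> real_closure_cone" unfolding real_closure_cone_def by blast+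
  then show "maximal_real_cone (real_closure_cone :: 'a alg_closure set)"
    "0 \<le> x \<Longrightarrow> to_ac x \<in> (real_closure_cone :: 'a alg_closure set)" by auto
qed

typedef (overloaded) 'a real_closure = "cone_field (real_closure_cone :: 'a::linordered_field alg_closure set)"
  unfolding cone_field_def using real_closure_cone(2)[of 0] by blast

setup_lifting type_definition_real_closure

lemma real_closure_real_cone: "real_cone (real_closure_cone :: 'a::linordered_field alg_closure set)"
  using real_closure_cone(1) by (auto simp: maximal_real_cone_def)

lemmas real_closure_coneD = real_coneD[OF real_closure_real_cone]
  and real_closure_cone_field = cone_field[OF real_closure_real_cone]

lemmas real_closure_subring = subring_setD[OF real_closure_cone_field(2)]

instantiation real_closure :: (linordered_field) linordered_field
begin

lift_definition zero_real_closure :: "'a real_closure" is 0 by (rule real_closure_subring)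
lift_definition one_real_closure :: "'a real_closure" is 1 by (rule real_closure_subring)
lift_definition plus_real_closure :: "'a real_closure \<Rightarrow> 'a real_closure \<Rightarrow> 'a real_closure" is "(+)" by (rule real_closure_subring)
lift_definition minus_real_closure :: "'a real_closure \<Rightarrow> 'a real_closure \<Rightarrow> 'a real_closure" is "(-)" by (rule real_closure_subring)
lift_definition times_real_closure :: "'a real_closure \<Rightarrow> 'a real_closure \<Rightarrow> 'a real_closure" is "(*)" by (rule real_closure_subring)
lift_definition uminus_real_closure :: "'a real_closure \<Rightarrow> 'a real_closure" is uminus by (rule real_closure_subring)
lift_definition inverse_real_closure :: "'a real_closure \<Rightarrow> 'a real_closure" is inverse by (rule real_closure_cone_field)
definition divide_real_closure :: "'a real_closure \<Rightarrow> 'a real_closure \<Rightarrow> 'a real_closure" where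
  "divide_real_closure x y = x * inverse y"
lift_definition less_eq_real_closure :: "'a real_closure \<Rightarrow> 'a real_closure \<Rightarrow> bool"
  is "\<lambda>x y. y - x \<in> real_closure_cone" .
definition less_real_closure :: "'a real_closure \<Rightarrow> 'a real_closure \<Rightarrow> bool" where
  "less_real_closure x y \<longleftrightarrow> x \<le> y \<and> \<not> y \<le> x"
definition abs_real_closure :: "'a real_closure \<Rightarrow> 'a real_closure" where
  "abs_real_closure x = (if x < 0 then - x else x)"
definition sgn_real_closure :: "'a real_closure \<Rightarrow> 'a real_closure" where
  "sgn_real_closure x = (if x = 0 then 0 else if 0 < x then 1 else - 1)"

instance
proof
  have antisym: "x \<le> y \<Longrightarrow> y \<le> x \<Longrightarrow> x = y" for x y :: "'a real_closure"
  proof transfer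
    fix x y :: "'a alg_closure"
    assume "y - x \<in> real_closure_cone" "x - y \<in> real_closure_cone"
    then have "y - x = 0" using real_cone_antisym[OF real_closure_real_cone, of "y - x"] by simp
    then show "x = y" by simp
  qed
  fix x y z :: "'a real_closure"
  show "x + y + z = x + (y + z)" by transfer (rule add.assoc)
  show "x + y = y + x" by transfer (rule add.commute)
  show "0 + x = x" by transfer simp
  show "- x + x = 0" by transfer simp
  show "x - y = x + - y" by transfer simp
  show "x + y - x = y" "x - y - z = x - (y + z)" by (transfer; simp)+
  show "0 * x = 0" "x * 0 = 0" by (transfer; simp)+
  show "x * y * z = x * (y * z)" by transfer (rule mult.assoc)
  show "x * y = y * x" by transfer (rule mult.commute)
  show "1 * x = x" by transfer simp
  show "(x + y) * z = x * z + y * z" by transfer (rule distrib_right)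
  show "(0::'a real_closure) \<noteq> 1" by transfer simp
  show "x \<noteq> 0 \<Longrightarrow> inverse x * x = 1" by transfer simp
  show "inverse (0 :: 'a real_closure) = 0" by transfer simp
  show "x div y = x * inverse y" by (rule divide_real_closure_def)
  show "x < y \<longleftrightarrow> x \<le> y \<and> \<not> y \<le> x" by (rule less_real_closure_def)
  show "x \<le> x" by transfer (simp add: real_closure_coneD(1))
  show "x \<le> y \<Longrightarrow> y \<le> z \<Longrightarrow> x \<le> z"
  proof transfer
    fix x y z :: "'a alg_closure"
    assume "y - x \<in> real_closure_cone" "z - y \<in> real_closure_cone"
    from real_closure_coneD(5)[OF this] show "z - x \<in> real_closure_cone" by simp
  qed
  show "x \<le> y \<Longrightarrow> y \<le> x \<Longrightarrow> x = y" by (rule antisym)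
  show "x \<le> y \<or> y \<le> x"
  proof transfer
    fix x y :: "'a alg_closure"
    assume "x \<in> cone_field real_closure_cone" "y \<in> cone_field real_closure_cone"
    then show "y - x \<in> real_closure_cone \<or> x - y \<in> real_closure_cone" using maximal_real_cone_total[OF real_closure_cone(1), of "y - x"] real_closure_subring(5) by auto
  qed
  show "x \<le> y \<Longrightarrow> z + x \<le> z + y" by transfer simp
  show "x < y \<Longrightarrow> 0 < z \<Longrightarrow> z * x < z * y"
  proof -
    assume xy: "x < y" and z: "0 < z"
    have le: "z * x \<le> z * y"
      using xy z unfolding less_real_closure_def
    proof transfer
      fix x y z :: "'a alg_closure"
      assume "y - x \<in> real_closure_cone \<and> x - y \<notin> real_closure_cone"
        "z - 0 \<in> real_closure_cone \<and> 0 - z \<notin> real_closure_cone"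
      then have "z * (y - x) \<in> real_closure_cone" by (intro real_closure_coneD(6)) auto
      then show "z * y - z * x \<in> real_closure_cone" by (simp add: right_diff_distrib)
    qed
    moreover have "z * x \<noteq> z * y"
    proof -
      have "x \<noteq> y" "z \<noteq> 0" using xy z by (auto simp: less_real_closure_def)
      then show ?thesis by transfer simp
    qed
    ultimately show "z * x < z * y" using antisym unfolding less_real_closure_def by blast
  qed
  show "\<bar>x\<bar> = (if x < 0 then - x else x)" by (rule abs_real_closure_def)
  show "sgn x = (if x = 0 then 0 else if 0 < x then 1 else - 1)" by (rule sgn_real_closure_def)
qed

end

lemma Rep_real_closure_poly:
  fixes c :: "'a::linordered_field real_closure"
  shows "Rep_real_closure (\<Sum>k\<le>n. f k * c ^ k) = (\<Sum>k\<le>n. Rep_real_closure (f k) * Rep_real_closure c ^ k)"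
proof -
  have pow: "Rep_real_closure (c ^ k) = Rep_real_closure c ^ k" for k
    by (induction k) (simp_all add: one_real_closure.rep_eq times_real_closure.rep_eq)
  show ?thesis
    by (induction n) (simp_all add: plus_real_closure.rep_eq times_real_closure.rep_eq pow del: power_Suc)
qed

instance real_closure :: (linordered_field) real_closed_field
proof
  fix f :: "nat \<Rightarrow> 'a real_closure" and n a b
  let ?R = "Rep_real_closure :: 'a real_closure \<Rightarrow> _"
  define p where "p = (\<Sum>k\<le>n. monom (?R (f k)) k)"
  have p: "poly p x = (\<Sum>k\<le>n. ?R (f k) * x ^ k)" for x by (simp add: p_def poly_sum poly_monom)
  have le: "x \<le> 0 \<Longrightarrow> - ?R x \<in> real_closure_cone" "0 \<le> x \<Longrightarrow> ?R x \<in> real_closure_cone" for x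
    by (transfer, simp)+
  have nz: "?R x = 0 \<longleftrightarrow> x = 0" for x by (simp add: zero_real_closure.rep_eq flip: Rep_real_closure_inject)
  assume "(\<Sum>k\<le>n. f k * a ^ k) < 0" "0 < (\<Sum>k\<le>n. f k * b ^ k)"
  then have signs: "- poly p (?R a) \<in> real_closure_cone" "poly p (?R a) \<noteq> 0" "poly p (?R b) \<in> real_closure_cone" "poly p (?R b) \<noteq> 0"
    unfolding p Rep_real_closure_poly[symmetric] nz by (auto intro: le)
  have over: "p \<in> polys_over (cone_field real_closure_cone)"
    unfolding polys_over_def p_def mem_Collect_eq coeff_sum coeff_monom
    using real_closure_subring(1,9) Rep_real_closure by auto
  obtain u where u: "u \<in> cone_field real_closure_cone" "poly p u = 0"
    using cone_field_sign_change_root[OF real_closure_cone(1) over Rep_real_closure Rep_real_closure signs] by blast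
  then have "?R (\<Sum>k\<le>n. f k * Abs_real_closure u ^ k) = 0"
    unfolding Rep_real_closure_poly by (simp add: Abs_real_closure_inverse p)
  then show "\<exists>c. (\<Sum>k\<le>n. f k * c ^ k) = 0" using nz by blast
qed

lift_definition to_rc :: "'a::linordered_field \<Rightarrow> 'a real_closure" is to_ac
proof -
  fix x :: 'a
  show "to_ac x \<in> cone_field real_closure_cone"
  proof (cases "0 \<le> x")
    case True
    then show ?thesis using real_closure_cone(2) real_closure_cone_field(1) by blast
  next
    case False
    then have "to_ac (- x) \<in> cone_field real_closure_cone" using real_closure_cone(2)[of "- x"] real_closure_cone_field(1) by auto
    then have "- to_ac (- x) \<in> cone_field real_closure_cone" by (rule real_closure_subring(3))
    then show ?thesis by simp
  qed
qed

lemma to_rc: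
  fixes x y :: "'a::linordered_field"
  shows "ring_morphism (to_rc :: 'a \<Rightarrow> _)" "to_rc x = 0 \<longleftrightarrow> x = 0" "0 \<le> x \<Longrightarrow> 0 \<le> to_rc x"
proof -
  show "ring_morphism (to_rc :: 'a \<Rightarrow> _)" unfolding ring_morphism_def by (intro conjI allI; transfer; simp)
  show "to_rc x = 0 \<longleftrightarrow> x = 0" by transfer simp
  show "0 \<le> x \<Longrightarrow> 0 \<le> to_rc x" by transfer (simp add: real_closure_cone(2))
qed

section \<open>Evaluation of multivariate polynomials and realization of signs\<close>


definition monom_val :: "('n::finite \<Rightarrow>\<^sub>0 nat) \<Rightarrow> real ^ 'n \<Rightarrow> real" where
  "monom_val a x = (\<Prod>i\<in>UNIV. (x $ i) ^ Poly_Mapping.lookup a i)"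

lemma monom_val_add: "monom_val (a + b) x = monom_val a x * monom_val b x"
  by (simp add: monom_val_def lookup_add power_add prod.distrib)

lemma monom_val_0 [simp]: "monom_val 0 x = 1"
  by (simp add: monom_val_def)

lemma poly_eval_superset:
  assumes "finite A" "Poly_Mapping.keys p \<subseteq> A"
  shows "poly_eval p x = (\<Sum>a\<in>A. Poly_Mapping.lookup p a * monom_val a x)"
  unfolding poly_eval_def monom_val_def
  by (rule sum.mono_neutral_left) (use assms in \<open>auto simp: in_keys_iff\<close>)

lemma poly_eval_add: "poly_eval (p + q) x = poly_eval p x + poly_eval q x"
proof -
  let ?A = "Poly_Mapping.keys p \<union> Poly_Mapping.keys q"
  have "Poly_Mapping.keys (p + q) \<subseteq> ?A" by (rule Poly_Mapping.keys_add)
  then show ?thesis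
    by (simp add: poly_eval_superset[of ?A] lookup_add sum.distrib algebra_simps)
qed

lemma poly_eval_single: "poly_eval (Poly_Mapping.single a c) x = c * monom_val a x"
  by (subst poly_eval_superset[of "{a}"]) auto

lemma poly_eval_sum: "poly_eval (sum f I) x = (\<Sum>i\<in>I. poly_eval (f i) x)"
  by (induction I rule: infinite_finite_induct) (simp_all add: poly_eval_add poly_eval_def[of 0])

lemma rpoly_sum_monomials:
  "p = (\<Sum>a\<in>Poly_Mapping.keys p. Poly_Mapping.single a (Poly_Mapping.lookup p a))"
  by (rule poly_mapping_eqI) (auto simp: lookup_sum lookup_single when_def in_keys_iff)

lemma poly_eval_mult: "poly_eval (p * q) x = poly_eval p x * poly_eval q x"
proof -
  let ?m = "\<lambda>p a. Poly_Mapping.single a (Poly_Mapping.lookup p a)"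
  have "p * q = (\<Sum>a\<in>Poly_Mapping.keys p. ?m p a) * (\<Sum>b\<in>Poly_Mapping.keys q. ?m q b)"
    using rpoly_sum_monomials[of p] rpoly_sum_monomials[of q] by simp
  also have "\<dots> = (\<Sum>a\<in>Poly_Mapping.keys p. \<Sum>b\<in>Poly_Mapping.keys q. ?m p a * ?m q b)"
    by (rule sum_product)
  finally have "poly_eval (p * q) x =
    (\<Sum>a\<in>Poly_Mapping.keys p. \<Sum>b\<in>Poly_Mapping.keys q. poly_eval (?m p a * ?m q b) x)"
    by (simp add: poly_eval_sum)
  also have "\<dots> = (\<Sum>a\<in>Poly_Mapping.keys p. \<Sum>b\<in>Poly_Mapping.keys q. poly_eval (?m p a) x * poly_eval (?m q b) x)"
    by (simp add: mult_single poly_eval_single monom_val_add mult_ac)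
  also have "\<dots> = poly_eval (\<Sum>a\<in>Poly_Mapping.keys p. ?m p a) x * poly_eval (\<Sum>b\<in>Poly_Mapping.keys q. ?m q b) x"
    by (simp add: poly_eval_sum sum_product)
  also have "\<dots> = poly_eval p x * poly_eval q x"
    using rpoly_sum_monomials[of p] rpoly_sum_monomials[of q] by simp
  finally show ?thesis .
qed

lemma poly_eval_const [simp]: "poly_eval (poly_const c) x = c"
  by (simp add: poly_const_def poly_eval_single)

lemma poly_const_simps:
  "poly_const 0 = 0" "poly_const 1 = 1" "poly_const (a + b) = poly_const a + poly_const b"
  "poly_const (a * b) = poly_const a * poly_const b" "poly_const (- a) = - poly_const a"
  "poly_const (a - b) = poly_const a - poly_const b"
  by (simp_all add: poly_const_def single_add mult_single single_uminus single_diff)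

lemma ring_morphism_poly_eval: "ring_morphism (\<lambda>p. poly_eval p x)"
  using poly_eval_const[of 0 x] poly_eval_const[of 1 x]
  by (simp add: ring_morphism_def poly_eval_add poly_eval_mult poly_const_simps)

lemmas poly_eval_simps = ring_morphismD[OF ring_morphism_poly_eval]

definition poly_var :: "'n::finite \<Rightarrow> 'n rpoly" where
  "poly_var v = Poly_Mapping.single (Poly_Mapping.single v 1) 1"

lemma poly_eval_var [simp]: "poly_eval (poly_var v) x = x $ v"
proof -
  have "monom_val (Poly_Mapping.single v 1) x = (\<Prod>i\<in>UNIV. if i = v then x $ i else 1)"
    unfolding monom_val_def by (rule prod.cong) (auto simp: lookup_single when_def)
  then show ?thesis by (simp add: poly_var_def poly_eval_single)
qed

text \<open>
  The ring of polynomials that involve only the variables in \<open>W\<close>. The inductive definition makes it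
  easy to regard a polynomial as univariate in one of its variables.
\<close>
inductive_set polys_in :: "'n::finite set \<Rightarrow> 'n rpoly set" for W where
  const: "poly_const c \<in> polys_in W"
| var: "v \<in> W \<Longrightarrow> poly_var v \<in> polys_in W"
| add: "p \<in> polys_in W \<Longrightarrow> q \<in> polys_in W \<Longrightarrow> p + q \<in> polys_in W"
| mult: "p \<in> polys_in W \<Longrightarrow> q \<in> polys_in W \<Longrightarrow> p * q \<in> polys_in W"

lemma subring_polys_in: "subring_set (polys_in W)"
  unfolding subring_set_def
proof (intro conjI ballI)
  show "1 \<in> polys_in W" using polys_in.const[of 1] by (simp add: poly_const_simps)
  fix p q assume pq: "p \<in> polys_in W" "q \<in> polys_in W"
  then show "p * q \<in> polys_in W" by (rule polys_in.mult)
  have "p + poly_const (- 1) * q \<in> polys_in W" using pq by (intro polys_in.intros)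
  then show "p - q \<in> polys_in W" by (simp add: poly_const_simps)
qed

lemma polys_in_UNIV:
  fixes p :: "'n::finite rpoly"
  shows "p \<in> polys_in UNIV"
proof -
  note R = subring_setD[OF subring_polys_in[of UNIV]]
  have pow: "Poly_Mapping.single (Poly_Mapping.single v k) 1 = poly_var v ^ k" for v :: 'n and k
  proof (induction k)
    case (Suc k)
    have "Poly_Mapping.single (Poly_Mapping.single v (Suc k)) (1::real) =
        Poly_Mapping.single (Poly_Mapping.single v 1 + Poly_Mapping.single v k) (1 * 1)"
      by (simp flip: single_add)
    also have "\<dots> = poly_var v * poly_var v ^ k"
      unfolding mult_single[symmetric] Suc.IH by (simp add: poly_var_def)
    finally show ?case by simp
  qed simp
  have prod: "Poly_Mapping.single (\<Sum>v\<in>I. Poly_Mapping.single v (k v)) (1::real) \<in> polys_in UNIV" for I :: "'n set" and k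
  proof (induction I rule: infinite_finite_induct)
    case (insert v I)
    have "Poly_Mapping.single (\<Sum>v\<in>insert v I. Poly_Mapping.single v (k v)) (1::real) =
        poly_var v ^ k v * Poly_Mapping.single (\<Sum>v\<in>I. Poly_Mapping.single v (k v)) 1"
      using insert by (simp add: mult_single flip: pow)
    then show ?case using insert R(6,7) polys_in.var[of v UNIV] by auto
  qed (use R(2) in simp_all)
  have "Poly_Mapping.single a c \<in> polys_in UNIV" for a :: "'n \<Rightarrow>\<^sub>0 nat" and c
  proof -
    have "a = (\<Sum>v\<in>Poly_Mapping.keys a. Poly_Mapping.single v (Poly_Mapping.lookup a v))"
      by (rule poly_mapping_eqI) (auto simp: lookup_sum lookup_single when_def in_keys_iff)
    then have "Poly_Mapping.single a (1::real) \<in> polys_in UNIV" using prod by metis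
    then have "poly_const c * Poly_Mapping.single a 1 \<in> polys_in UNIV" by (intro polys_in.intros)
    then show ?thesis by (simp add: poly_const_def mult_single)
  qed
  then show ?thesis by (subst rpoly_sum_monomials) (rule R(9))
qed

lemma polys_in_insert:
  assumes "f \<in> polys_in (insert v W)"
  shows "\<exists>F\<in>polys_over (polys_in W). poly F (poly_var v) = f"
  using assms
proof induction
  note P = polys_over_closed[OF subring_polys_in[of W]] and R = subring_setD[OF subring_polys_in[of W]]
  {
    case (const c)
    show ?case using P(2)[OF polys_in.const[of c W]] by (intro bexI[of _ "[:poly_const c:]"]) auto
  next
    case (var u)
    show ?case
    proof (cases "u = v")
      case True
      then show ?thesis using P(3)[OF R(2), of 1] by (intro bexI[of _ "monom 1 1"]) (simp_all add: poly_monom)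
    next
      case False
      then show ?thesis using var P(2)[OF polys_in.var[of u W]] by (intro bexI[of _ "[:poly_var u:]"]) auto
    qed
  next
    case (add p q)
    then show ?case using P(4) by (metis poly_add)
  next
    case (mult p q)
    then show ?case using P(6) by (metis poly_mult)
  }
qed

lemma poly_eval_polys_in_cong:
  fixes x y :: "real ^ 'n::finite"
  assumes "f \<in> polys_in W" "\<And>v. v \<in> W \<Longrightarrow> x $ v = y $ v"
  shows "poly_eval f x = poly_eval f y"
  using assms(1) by induction (use assms(2) in \<open>auto simp: poly_eval_add poly_eval_mult\<close>)

text \<open>
  The ordering of the reals is preserved because positive numbers are squares of units.
\<close>
lemma morphism_poly_const_sign:
  fixes \<phi> :: "'n::finite rpoly \<Rightarrow> 'b::linordered_field"
  assumes "ring_morphism \<phi>"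
  shows "same_sign c (\<phi> (poly_const c))"
proof -
  note H = ring_morphismD[OF assms]
  have pos: "0 < \<phi> (poly_const c)" if "0 < c" for c
  proof -
    have "\<phi> (poly_const (sqrt c)) * \<phi> (poly_const (inverse (sqrt c))) = \<phi> (poly_const (sqrt c * inverse (sqrt c)))"
      by (simp add: H poly_const_simps)
    also have "\<dots> = 1" using that by (simp add: poly_const_simps H)
    finally have "\<phi> (poly_const (sqrt c)) \<noteq> 0" by auto
    then have "0 < \<phi> (poly_const (sqrt c)) * \<phi> (poly_const (sqrt c))" by (auto simp: zero_less_mult_iff neq_iff)
    also have "\<dots> = \<phi> (poly_const (sqrt c * sqrt c))" by (simp only: H(4) poly_const_simps(4))
    finally show ?thesis using that by simp
  qed
  consider "0 < c" | "c = 0" | "0 < - c" by linarith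
  then show ?thesis
  proof cases
    case 2
    then show ?thesis by (simp add: same_sign_def poly_const_simps H)
  next
    case 3
    then show ?thesis using pos[OF 3] by (simp add: same_sign_def poly_const_simps H)
  qed (use pos[of c] in \<open>simp add: same_sign_def\<close>)
qed

text \<open>
  A form of the Artin-Lang theorem. By induction on the number of variables, a real point
  realizes the signs of the finitely many coefficient conditions supplied by \<open>sign_transfer\<close>. Matching
  the roots then provides a real value for the next variable that is in the same position as its image
  under \<open>\<phi>\<close>.
\<close>
theorem morphism_signs_realized:
  fixes \<phi> :: "'n::finite rpoly \<Rightarrow> 'b::real_closed_field"
  assumes \<phi>: "ring_morphism \<phi>" and G: "finite G"
  shows "\<exists>x. \<forall>g\<in>G. same_sign (poly_eval g x) (\<phi> g)"
proof -
  have "finite W \<Longrightarrow> finite G \<Longrightarrow> G \<subseteq> polys_in W \<Longrightarrow> \<exists>x. \<forall>g\<in>G. same_sign (poly_eval g x) (\<phi> g)" for W G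
  proof (induction W arbitrary: G rule: finite_induct)
    case empty
    have "same_sign (poly_eval g 0) (\<phi> g)" if "g \<in> G" for g
    proof -
      have "g \<in> polys_in {}" using that empty by auto
      then have "\<exists>c. g = poly_const c" by induction (auto simp flip: poly_const_simps)
      then show ?thesis using morphism_poly_const_sign[OF \<phi>] by auto
    qed
    then show ?case by blast
  next
    case (insert v W)
    have "\<forall>g\<in>G. \<exists>F. F \<in> polys_over (polys_in W) \<and> poly F (poly_var v) = g"
      using polys_in_insert insert.prems by blast
    then obtain F where F: "\<And>g. g \<in> G \<Longrightarrow> F g \<in> polys_over (polys_in W)" "\<And>g. g \<in> G \<Longrightarrow> poly (F g) (poly_var v) = g"
      by metis
    let ?\<Psi> = "range (\<lambda>x p. poly_eval p x) :: ('n rpoly \<Rightarrow> real) set"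
    have "sign_transfer ?\<Psi> (polys_in W) \<phi> (F ` G)"
      by (rule sign_transfer[OF subring_polys_in \<phi>])
         (use F insert.prems ring_morphism_poly_eval in auto)
    then obtain H where H: "H \<subseteq> polys_in W" "finite H"
      and HZ: "\<And>x. sign_agree (\<lambda>p. poly_eval p x) \<phi> H \<Longrightarrow>
        \<exists>Z. aligned Z \<and> (\<forall>f\<in>F ` G. matched Z (map_poly (\<lambda>p. poly_eval p x) f) (map_poly \<phi> f))"
      unfolding sign_transfer_def by blast
    obtain x where x: "\<forall>g\<in>H. same_sign (poly_eval g x) (\<phi> g)" using insert.IH[OF H(2,1)] by blast
    then obtain Z where Z: "aligned Z"
      "\<And>g. g \<in> G \<Longrightarrow> matched Z (map_poly (\<lambda>p. poly_eval p x) (F g)) (map_poly \<phi> (F g))"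
      using HZ[of x] unfolding sign_agree_def by blast
    obtain t where t: "same_pos Z t (\<phi> (poly_var v))" using same_pos_exists[OF Z(1)] by blast
    define y where "y = (\<chi> i. if i = v then t else x $ i)"
    have "same_sign (poly_eval g y) (\<phi> g)" if g: "g \<in> G" for g
    proof -
      have "map_poly (\<lambda>p. poly_eval p y) (F g) = map_poly (\<lambda>p. poly_eval p x) (F g)"
      proof (rule poly_eqI)
        fix i
        have "coeff (F g) i \<in> polys_in W" using F(1)[OF g] by (simp add: polys_over_def)
        then have "poly_eval (coeff (F g) i) y = poly_eval (coeff (F g) i) x"
          by (rule poly_eval_polys_in_cong) (use insert.hyps in \<open>auto simp: y_def\<close>)
        then show "coeff (map_poly (\<lambda>p. poly_eval p y) (F g)) i = coeff (map_poly (\<lambda>p. poly_eval p x) (F g)) i"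
          by (simp add: map_poly_morphism[OF ring_morphism_poly_eval])
      qed
      moreover have "poly_eval g y = poly (map_poly (\<lambda>p. poly_eval p y) (F g)) t"
        using map_poly_morphism(5)[OF ring_morphism_poly_eval, of y "F g" "poly_var v"] F(2)[OF g]
        by (simp add: y_def)
      moreover have "\<phi> g = poly (map_poly \<phi> (F g)) (\<phi> (poly_var v))"
        using map_poly_morphism(5)[OF \<phi>, of "F g" "poly_var v"] F(2)[OF g] by simp
      ultimately show ?thesis using matchedD[OF Z(2)[OF g] t] by simp
    qed
    then show ?case by blast
  qed
  from this[of UNIV G] show ?thesis using G polys_in_UNIV by auto
qed


section \<open>Prime cones come from sign conditions at real points\<close>

text \<open>
  The positive cones of orderings of the residue domains of a ring, in other words the points
  of its real spectrum.
\<close>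
definition prime_cone :: "'a::comm_ring_1 set \<Rightarrow> bool" where
  "prime_cone P \<longleftrightarrow> (\<forall>x\<in>P. \<forall>y\<in>P. x + y \<in> P \<and> x * y \<in> P) \<and> (\<forall>x. x \<in> P \<or> - x \<in> P) \<and> - 1 \<notin> P \<and>
     (\<forall>x y. x * y \<in> P \<longrightarrow> - (x * y) \<in> P \<longrightarrow> x \<in> P \<and> - x \<in> P \<or> y \<in> P \<and> - y \<in> P)"

lemma prime_coneD:
  assumes "prime_cone P"
  shows "x \<in> P \<Longrightarrow> y \<in> P \<Longrightarrow> x + y \<in> P" "x \<in> P \<Longrightarrow> y \<in> P \<Longrightarrow> x * y \<in> P" "x \<in> P \<or> - x \<in> P" "- 1 \<notin> P"
    "x * y \<in> P \<Longrightarrow> - (x * y) \<in> P \<Longrightarrow> x \<in> P \<and> - x \<in> P \<or> y \<in> P \<and> - y \<in> P" "0 \<in> P" "1 \<in> P"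
proof -
  show add: "x \<in> P \<Longrightarrow> y \<in> P \<Longrightarrow> x + y \<in> P" and "x \<in> P \<Longrightarrow> y \<in> P \<Longrightarrow> x * y \<in> P" and tot: "x \<in> P \<or> - x \<in> P"
    and m1: "- 1 \<notin> P" and "x * y \<in> P \<Longrightarrow> - (x * y) \<in> P \<Longrightarrow> x \<in> P \<and> - x \<in> P \<or> y \<in> P \<and> - y \<in> P" for x y
    using assms unfolding prime_cone_def by blast+
  show "0 \<in> P" using tot[of 0] by simp
  show "1 \<in> P" using tot[of 1] m1 by blast
qed

text \<open>
  For a prime cone, the prime ideal of the elements that vanish in the ordered residue domain.
\<close>
definition cone_support :: "'a::comm_ring_1 set \<Rightarrow> 'a set" where
  "cone_support P = {x. x \<in> P \<and> - x \<in> P}"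

lemma cone_support:
  assumes "prime_cone P"
  shows "0 \<in> cone_support P" "x \<in> cone_support P \<Longrightarrow> y \<in> cone_support P \<Longrightarrow> x + y \<in> cone_support P"
    "x \<in> cone_support P \<Longrightarrow> - x \<in> cone_support P" "x \<in> cone_support P \<Longrightarrow> y * x \<in> cone_support P"
    "x * y \<in> cone_support P \<Longrightarrow> x \<in> cone_support P \<or> y \<in> cone_support P" "1 \<notin> cone_support P"
    "x \<in> P \<Longrightarrow> y \<in> cone_support P \<Longrightarrow> x + y \<in> P"
proof -
  note D = prime_coneD[OF assms]
  show "0 \<in> cone_support P" "1 \<notin> cone_support P" using D(4,6) by (auto simp: cone_support_def)
  show "x \<in> cone_support P \<Longrightarrow> y \<in> cone_support P \<Longrightarrow> x + y \<in> cone_support P"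
    using D(1)[of x y] D(1)[of "- x" "- y"] by (simp add: cone_support_def)
  show "x \<in> cone_support P \<Longrightarrow> - x \<in> cone_support P" by (simp add: cone_support_def)
  show "x * y \<in> cone_support P \<Longrightarrow> x \<in> cone_support P \<or> y \<in> cone_support P"
    using D(5) by (auto simp: cone_support_def)
  show "x \<in> P \<Longrightarrow> y \<in> cone_support P \<Longrightarrow> x + y \<in> P" using D(1) by (simp add: cone_support_def)
  show "y * x \<in> cone_support P" if x: "x \<in> cone_support P"
  proof (cases "y \<in> P")
    case True
    then show ?thesis using D(2)[of y x] D(2)[of y "- x"] x by (simp add: cone_support_def)
  next
    case False
    then have "- y \<in> P" using D(3) by blast
    then show ?thesis using D(2)[of "- y" x] D(2)[of "- y" "- x"] x by (simp add: cone_support_def)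
  qed
qed

definition realizable :: "'n::finite rpoly set \<Rightarrow> bool" where
  "realizable P \<longleftrightarrow> (\<forall>G. finite G \<longrightarrow> (\<exists>x. \<forall>g\<in>G. g \<in> P \<longleftrightarrow> 0 \<le> poly_eval g x))"

text \<open>
  The residue ring of a prime cone is to become a type, and a type cannot depend on a variable. The
  remedy is a constant that is a counterexample to the realizability of prime cones as soon as there is
  one. It is then enough to realize this single cone.
\<close>
definition test_cone :: "'n::finite rpoly set" where
  "test_cone = (SOME P. prime_cone P \<and> ((\<exists>Q::'n rpoly set. prime_cone Q \<and> \<not> realizable Q) \<longrightarrow> \<not> realizable P))"

lemma test_cone:
  "prime_cone (test_cone :: 'n::finite rpoly set)"
  "prime_cone Q \<Longrightarrow> realizable (test_cone :: 'n rpoly set) \<Longrightarrow> realizable (Q :: 'n rpoly set)"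
proof -
  let ?A = "\<lambda>P :: 'n rpoly set. prime_cone P \<and> ((\<exists>Q::'n rpoly set. prime_cone Q \<and> \<not> realizable Q) \<longrightarrow> \<not> realizable P)"
  have "prime_cone {p :: 'n rpoly. 0 \<le> poly_eval p 0}"
    by (auto simp: prime_cone_def poly_eval_simps zero_le_mult_iff mult_le_0_iff)
  then have "\<exists>P. ?A P" by (cases "\<exists>Q::'n rpoly set. prime_cone Q \<and> \<not> realizable Q") blast+
  from someI_ex[OF this] have "?A test_cone" unfolding test_cone_def .
  then show "prime_cone (test_cone :: 'n rpoly set)"
    "prime_cone Q \<Longrightarrow> realizable (test_cone :: 'n rpoly set) \<Longrightarrow> realizable (Q :: 'n rpoly set)" by blast+
qed

lemmas test_coneD = prime_coneD[OF test_cone(1)] and test_cone_support = cone_support[OF test_cone(1)]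

text \<open>
  The residue ring modulo the support, ordered by the cone. Its order is total because the cone
  contains every element or its negative, and primality of the support makes it a domain.
\<close>
quotient_type (overloaded) 'n residue = "'n::finite rpoly" / "\<lambda>p q. p - q \<in> cone_support test_cone"
  morphisms residue_representatives residue_class
proof (rule equivpI)
  show "reflp (\<lambda>p q :: 'n rpoly. p - q \<in> cone_support test_cone)" by (simp add: reflp_def test_cone_support(1))
  show "symp (\<lambda>p q :: 'n rpoly. p - q \<in> cone_support test_cone)"
    using test_cone_support(3) by (force simp: symp_def)
  show "transp (\<lambda>p q :: 'n rpoly. p - q \<in> cone_support test_cone)"
    using test_cone_support(2) by (force simp: transp_def)
qed

instantiation residue :: (finite) linordered_idom
begin

lift_definition zero_residue :: "'a residue" is 0 .
lift_definition one_residue :: "'a residue" is 1 .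
lift_definition plus_residue :: "'a residue \<Rightarrow> 'a residue \<Rightarrow> 'a residue" is "(+)"
  subgoal for p p' q q' using test_cone_support(2)[of "p - p'" "q - q'"] by (simp add: algebra_simps) done
lift_definition uminus_residue :: "'a residue \<Rightarrow> 'a residue" is uminus
  subgoal for p p' using test_cone_support(3)[of "p - p'"] by simp done
lift_definition minus_residue :: "'a residue \<Rightarrow> 'a residue \<Rightarrow> 'a residue" is "(-)"
  subgoal for p p' q q' using test_cone_support(2)[OF _ test_cone_support(3), of "p - p'" "q - q'"] by (simp add: algebra_simps) done
lift_definition times_residue :: "'a residue \<Rightarrow> 'a residue \<Rightarrow> 'a residue" is "(*)"
  subgoal for p p' q q'
    using test_cone_support(2)[OF test_cone_support(4)[of "p - p'" q] test_cone_support(4)[of "q - q'" p']] by (simp add: algebra_simps) done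
lift_definition less_eq_residue :: "'a residue \<Rightarrow> 'a residue \<Rightarrow> bool" is "\<lambda>p q. q - p \<in> test_cone"
  subgoal for p p' q q'
    using test_cone_support(7)[OF _ test_cone_support(2)[OF _ test_cone_support(3)], of "q - p" "p - p'" "q - q'"]
      test_cone_support(7)[OF _ test_cone_support(2)[OF test_cone_support(3)], of "q' - p'" "p - p'" "q - q'"]
    by (auto simp: algebra_simps) done
definition less_residue :: "'a residue \<Rightarrow> 'a residue \<Rightarrow> bool" where
  "less_residue x y \<longleftrightarrow> x \<le> y \<and> \<not> y \<le> x"
definition abs_residue :: "'a residue \<Rightarrow> 'a residue" where
  "abs_residue x = (if x < 0 then - x else x)"
definition sgn_residue :: "'a residue \<Rightarrow> 'a residue" where
  "sgn_residue x = (if x = 0 then 0 else if 0 < x then 1 else - 1)"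

instance
proof
  have antisym: "x \<le> y \<Longrightarrow> y \<le> x \<Longrightarrow> x = y" for x y :: "'a residue"
    by transfer (simp add: cone_support_def)
  fix x y z :: "'a residue"
  show "x + y + z = x + (y + z)" by transfer (simp add: algebra_simps test_cone_support(1))
  show "x + y = y + x" by transfer (simp add: algebra_simps test_cone_support(1))
  show "0 + x = x" by transfer (simp add: test_cone_support(1))
  show "- x + x = 0" by transfer (simp add: test_cone_support(1))
  show "x - y = x + - y" by transfer (simp add: test_cone_support(1))
  show "x + y - x = y" "x - y - z = x - (y + z)" by (transfer; simp add: test_cone_support(1) algebra_simps)+
  show "0 * x = 0" "x * 0 = 0" by (transfer; simp add: test_cone_support(1))+
  show "x * y * z = x * (y * z)" by transfer (simp add: algebra_simps test_cone_support(1))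
  show "x * y = y * x" by transfer (simp add: algebra_simps test_cone_support(1))
  show "1 * x = x" by transfer (simp add: test_cone_support(1))
  show "(x + y) * z = x * z + y * z" by transfer (simp add: algebra_simps test_cone_support(1))
  show "(0::'a residue) \<noteq> 1" by transfer (use test_cone_support(3)[of "- 1"] test_cone_support(6) in auto)
  show "x < y \<longleftrightarrow> x \<le> y \<and> \<not> y \<le> x" by (rule less_residue_def)
  show "x \<le> x" by transfer (simp add: test_coneD(6))
  show "x \<le> y \<Longrightarrow> y \<le> z \<Longrightarrow> x \<le> z"
  proof transfer
    fix x y z :: "'a rpoly"
    assume "y - x \<in> test_cone" "z - y \<in> test_cone"
    from test_coneD(1)[OF this] show "z - x \<in> test_cone" by simp
  qed
  show "x \<le> y \<Longrightarrow> y \<le> x \<Longrightarrow> x = y" by (rule antisym)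
  show "x \<le> y \<or> y \<le> x" 
  proof transfer
    fix x y :: "'a rpoly"
    show "y - x \<in> test_cone \<or> x - y \<in> test_cone" using test_coneD(3)[of "y - x"] by simp
  qed
  show "x \<le> y \<Longrightarrow> z + x \<le> z + y" by transfer simp
  show "x < y \<Longrightarrow> 0 < z \<Longrightarrow> z * x < z * y"
  proof -
    assume xy: "x < y" and z: "0 < z"
    have le: "z * x \<le> z * y"
      using xy z unfolding less_residue_def
    proof transfer
      fix x y z :: "'a rpoly"
      assume "y - x \<in> test_cone \<and> x - y \<notin> test_cone" "z - 0 \<in> test_cone \<and> 0 - z \<notin> test_cone"
      then have "z * (y - x) \<in> test_cone" by (intro test_coneD(2)) auto
      then show "z * y - z * x \<in> test_cone" by (simp add: right_diff_distrib)
    qed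
    moreover have "z * x \<noteq> z * y"
    proof -
      have "x \<noteq> y" "z \<noteq> 0" using xy z by (auto simp: less_residue_def)
      then show ?thesis
      proof transfer
        fix x y z :: "'a rpoly"
        assume "x - y \<notin> cone_support test_cone" "z - 0 \<notin> cone_support test_cone"
        then show "z * x - z * y \<notin> cone_support test_cone"
          using test_cone_support(5)[of z "x - y"] by (auto simp: right_diff_distrib)
      qed
    qed
    ultimately show "z * x < z * y" using antisym unfolding less_residue_def by blast
  qed
  show "\<bar>x\<bar> = (if x < 0 then - x else x)" by (rule abs_residue_def)
  show "sgn x = (if x = 0 then 0 else if 0 < x then 1 else - 1)" by (rule sgn_residue_def)
qed

end

lemma ring_morphism_compose:
  "ring_morphism f \<Longrightarrow> ring_morphism g \<Longrightarrow> ring_morphism (\<lambda>x. g (f x))"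
  by (simp add: ring_morphism_def)

text \<open>
  The cone consists of the polynomials that become nonnegative in the real closure of the
  fraction field of the residue ring, and there signs are realized by real points.
\<close>
lemma realizable_test_cone: "realizable (test_cone :: 'n::finite rpoly set)"
  unfolding realizable_def
proof (intro allI impI)
  fix G :: "'n rpoly set" assume G: "finite G"
  define \<phi> where "\<phi> = (\<lambda>p :: 'n rpoly. to_rc (Fract (residue_class p) 1))"
  have mor: "ring_morphism \<phi>"
  proof -
    have "residue_class (p + q) = residue_class p + residue_class q"
      "residue_class (p * q) = residue_class p * residue_class q"
      "residue_class 0 = (0 :: 'n residue)" "residue_class 1 = (1 :: 'n residue)" for p q :: "'n rpoly"
      by (simp_all add: plus_residue.abs_eq times_residue.abs_eq zero_residue_def one_residue_def)
    then have "ring_morphism (\<lambda>p :: 'n rpoly. Fract (residue_class p) 1)"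
      by (simp add: ring_morphism_def Zero_fract_def One_fract_def)
    from ring_morphism_compose[OF this to_rc(1)] show ?thesis unfolding \<phi>_def .
  qed
  have nonneg: "0 \<le> \<phi> p" if "p \<in> test_cone" for p
  proof -
    have "0 \<le> residue_class p" using that by (simp add: zero_residue_def less_eq_residue.abs_eq)
    then show ?thesis unfolding \<phi>_def by (intro to_rc(3)) (simp add: zero_le_Fract_iff)
  qed
  have nz: "\<phi> p \<noteq> 0" if "p \<notin> cone_support test_cone" for p
  proof -
    have "residue_class p \<noteq> 0" using that by (simp add: zero_residue_def residue.abs_eq_iff)
    then show ?thesis by (simp add: \<phi>_def to_rc(2) Zero_fract_def eq_fract)
  qed
  have sign: "p \<in> test_cone \<longleftrightarrow> 0 \<le> \<phi> p" for p
  proof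
    assume p: "0 \<le> \<phi> p"
    show "p \<in> test_cone"
    proof (rule ccontr)
      assume n: "p \<notin> test_cone"
      then have "0 \<le> \<phi> (- p)" using test_coneD(3) nonneg by blast
      then have "\<phi> p = 0" using p ring_morphismD(5)[OF mor, of p] by simp
      then show False using nz[of p] n by (auto simp: cone_support_def)
    qed
  qed (rule nonneg)
  obtain x where x: "\<forall>g\<in>G. same_sign (poly_eval g x) (\<phi> g)"
    using morphism_signs_realized[OF mor G] by blast
  have "g \<in> test_cone \<longleftrightarrow> 0 \<le> poly_eval g x" if "g \<in> G" for g
    using x that sign[of g] unfolding same_sign_def by (meson not_le)
  then show "\<exists>x. \<forall>g\<in>G. g \<in> test_cone \<longleftrightarrow> 0 \<le> poly_eval g x" by blast
qed

theorem prime_cone_realizable: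
  fixes P :: "'n::finite rpoly set"
  assumes "prime_cone P"
  shows "realizable P"
  using test_cone(2)[OF assms realizable_test_cone] .


section \<open>Enlarging a preordering to a prime cone\<close>

definition ring_preordering :: "'a::comm_ring_1 set \<Rightarrow> bool" where
  "ring_preordering T \<longleftrightarrow> (\<forall>x\<in>T. \<forall>y\<in>T. x + y \<in> T \<and> x * y \<in> T) \<and> (\<forall>x. x\<^sup>2 \<in> T)"

lemma ring_preorderingD:
  assumes "ring_preordering T"
  shows "x \<in> T \<Longrightarrow> y \<in> T \<Longrightarrow> x + y \<in> T" "x \<in> T \<Longrightarrow> y \<in> T \<Longrightarrow> x * y \<in> T" "x\<^sup>2 \<in> T" "0 \<in> T" "1 \<in> T"
    "x ^ (2 * n) \<in> T"
proof -
  show "x \<in> T \<Longrightarrow> y \<in> T \<Longrightarrow> x + y \<in> T" "x \<in> T \<Longrightarrow> y \<in> T \<Longrightarrow> x * y \<in> T" and sq: "x\<^sup>2 \<in> T" for x y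
    using assms unfolding ring_preordering_def by blast+
  show "0 \<in> T" using sq[of 0] by simp
  show "1 \<in> T" using sq[of 1] by simp
  show "x ^ (2 * n) \<in> T" using sq[of "x ^ n"] by (simp add: power_mult mult.commute)
qed

lemma ring_preordering_adjoin:
  assumes T: "ring_preordering T"
  shows "ring_preordering {s + a * t | s t. s \<in> T \<and> t \<in> T}"
proof -
  note D = ring_preorderingD[OF T]
  let ?T = "{s + a * t | s t. s \<in> T \<and> t \<in> T}"
  have "x + y \<in> ?T \<and> x * y \<in> ?T" if xy: "x \<in> ?T" "y \<in> ?T" for x y
  proof -
    obtain s t s' t' where st: "x = s + a * t" "s \<in> T" "t \<in> T" "y = s' + a * t'" "s' \<in> T" "t' \<in> T"
      using xy by blast
    have "x + y = (s + s') + a * (t + t')" "x * y = (s * s' + a\<^sup>2 * (t * t')) + a * (s * t' + t * s')"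
      by (simp_all add: st algebra_simps power2_eq_square)
    moreover have "s + s' \<in> T" "t + t' \<in> T" "s * s' + a\<^sup>2 * (t * t') \<in> T" "s * t' + t * s' \<in> T"
      by (intro D(1-3) st(2,3,5,6))+
    ultimately show ?thesis by blast
  qed
  moreover have "x\<^sup>2 \<in> ?T" for x using D(3)[of x] D(4) by force
  ultimately show ?thesis unfolding ring_preordering_def by blast
qed

text \<open>
  The exponent \<open>0\<close> is included, so that \<open>-1\<close> is avoided as well. Excluding all even powers
  instead of only \<open>-1\<close> keeps \<open>p\<close> out of the support without an auxiliary variable inverse to \<open>p\<close>.
\<close>
definition avoids_negative_powers :: "'a::comm_ring_1 \<Rightarrow> 'a set \<Rightarrow> bool" where
  "avoids_negative_powers p T \<longleftrightarrow> ring_preordering T \<and> (\<forall>l. - (p ^ (2 * l)) \<notin> T)"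

lemma neg_eq_of_add_eq_neg:
  fixes a b c :: "'a::ab_group_add"
  assumes "a + b = - c"
  shows "- a = b + c"
proof -
  have "- a = b - (a + b)" by simp
  then show ?thesis unfolding assms by simp
qed

text \<open>
  An element \<open>x\<close> that is not in \<open>Q\<close> cannot be adjoined, which yields an equation
  \<open>p\<^sup>2\<^sup>l + s = - x t\<close> with \<open>s\<close> and \<open>t\<close> in \<open>Q\<close>. Multiplying two such equations produces \<open>- p\<^sup>2\<^sup>l \<in> Q\<close> for some
  \<open>l\<close> if totality or primality fails.
\<close>
lemma maximal_ring_preordering_prime_cone:
  assumes Q: "avoids_negative_powers p Q" and max: "\<And>Q'. avoids_negative_powers p Q' \<Longrightarrow> Q \<subseteq> Q' \<Longrightarrow> Q' = Q"
  shows "prime_cone Q" "p \<notin> cone_support Q"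
proof -
  have pre: "ring_preordering Q" and avoid: "\<And>l. - (p ^ (2 * l)) \<notin> Q"
    using Q by (auto simp: avoids_negative_powers_def)
  note D = ring_preorderingD[OF pre]
  \<comment> \<open>adjoining \<open>a\<close> to the maximal \<open>Q\<close> must produce the negative of a power of \<open>p\<close>\<close>
  have witness: "\<exists>l s t. s \<in> Q \<and> t \<in> Q \<and> p ^ (2 * l) + s = - (a * t)" if a: "a \<notin> Q" for a
  proof -
    let ?T = "{s + a * t | s t. s \<in> Q \<and> t \<in> Q}"
    have "s + a * 0 \<in> ?T" if "s \<in> Q" for s using that D(4) by blast
    then have sub: "Q \<subseteq> ?T" by auto
    have "0 + a * 1 \<in> ?T" using D(4,5) by blast
    then have "?T \<noteq> Q" using a by auto
    then have "\<not> avoids_negative_powers p ?T" using max[OF _ sub] by blast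
    then obtain l s t where st: "- (p ^ (2 * l)) = s + a * t" "s \<in> Q" "t \<in> Q"
      using ring_preordering_adjoin[OF pre] unfolding avoids_negative_powers_def by blast
    have "p ^ (2 * l) + s = - (a * t)" using arg_cong[OF st(1), of uminus] by simp
    then show ?thesis using st by blast
  qed
  have tot: "x \<in> Q \<or> - x \<in> Q" for x
  proof (rule ccontr)
    assume "\<not> (x \<in> Q \<or> - x \<in> Q)"
    then obtain l s t l' s' t' where w: "s \<in> Q" "t \<in> Q" "p ^ (2 * l) + s = - (x * t)"
      "s' \<in> Q" "t' \<in> Q" "p ^ (2 * l') + s' = - (- x * t')" using witness[of x] witness[of "- x"] by blast
    have "p ^ (2 * (l + l')) + (p ^ (2 * l) * s' + s * p ^ (2 * l') + s * s') =
        (p ^ (2 * l) + s) * (p ^ (2 * l') + s')" by (simp add: algebra_simps power_add)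
    also have "\<dots> = - (x\<^sup>2 * (t * t'))" unfolding w by (simp add: algebra_simps power2_eq_square)
    finally have "- (p ^ (2 * (l + l'))) = p ^ (2 * l) * s' + s * p ^ (2 * l') + s * s' + x\<^sup>2 * (t * t')"
      by (rule neg_eq_of_add_eq_neg)
    also have "\<dots> \<in> Q" by (intro D(1,2,3,6) w(1,2,4,5))
    finally show False using avoid by blast
  qed
  have ideal: "y * x \<in> cone_support Q" if x: "x \<in> cone_support Q" for x y
    using tot[of y] D(2)[of y x] D(2)[of y "- x"] D(2)[of "- y" x] D(2)[of "- y" "- x"] x
    by (auto simp: cone_support_def)
  have half: "\<exists>l s t. s \<in> Q \<and> (p ^ (2 * l) + s = x * t)" if x: "x \<notin> cone_support Q" for x
  proof -
    have "x \<notin> Q \<or> - x \<notin> Q" using x by (simp add: cone_support_def)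
    then show ?thesis
    proof
      assume "x \<notin> Q"
      then obtain l s t where "s \<in> Q" "p ^ (2 * l) + s = - (x * t)" using witness by blast
      then show ?thesis by (intro exI[of _ l] exI[of _ s] exI[of _ "- t"]) simp
    next
      assume "- x \<notin> Q"
      then obtain l s t where "s \<in> Q" "p ^ (2 * l) + s = - (- x * t)" using witness by blast
      then show ?thesis by (intro exI[of _ l] exI[of _ s] exI[of _ t]) simp
    qed
  qed
  have prime: "x \<in> cone_support Q \<or> y \<in> cone_support Q" if xy: "x * y \<in> cone_support Q" for x y
  proof (rule ccontr)
    assume "\<not> (x \<in> cone_support Q \<or> y \<in> cone_support Q)"
    then obtain l s t l' s' t' where w: "s \<in> Q" "p ^ (2 * l) + s = x * t" "s' \<in> Q" "p ^ (2 * l') + s' = y * t'"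
      using half[of x] half[of y] by blast
    have "p ^ (2 * (l + l')) + (p ^ (2 * l) * s' + s * p ^ (2 * l') + s * s') =
        (p ^ (2 * l) + s) * (p ^ (2 * l') + s')" by (simp add: algebra_simps power_add)
    also have "\<dots> = - (- ((t * t') * (x * y)))" unfolding w by (simp add: algebra_simps)
    finally have "- (p ^ (2 * (l + l'))) = p ^ (2 * l) * s' + s * p ^ (2 * l') + s * s' + - ((t * t') * (x * y))"
      by (rule neg_eq_of_add_eq_neg)
    also have "\<dots> \<in> Q"
    proof -
      have "- ((t * t') * (x * y)) \<in> Q" using ideal[OF xy, of "t * t'"] by (simp add: cone_support_def)
      then show ?thesis by (intro D(1,2,6) w(1,3))
    qed
    finally show False using avoid by blast
  qed
  have "- 1 \<notin> Q" using avoid[of 0] by simp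
  then show "prime_cone Q" unfolding prime_cone_def using D(1,2) tot prime by (auto simp: cone_support_def)
  show "p \<notin> cone_support Q"
  proof
    assume "p \<in> cone_support Q"
    from ideal[OF this, of p] show False using avoid[of 1] by (simp add: cone_support_def power2_eq_square)
  qed
qed

lemma ring_preordering_in_prime_cone:
  assumes "ring_preordering T" "\<And>l. - (p ^ (2 * l)) \<notin> T"
  shows "\<exists>P. prime_cone P \<and> T \<subseteq> P \<and> p \<notin> cone_support P"
proof -
  let ?A = "{Q. avoids_negative_powers p Q \<and> T \<subseteq> Q}"
  have "\<exists>M\<in>?A. \<forall>Y\<in>?A. M \<subseteq> Y \<longrightarrow> Y = M"
  proof (rule subset_Zorn_nonempty)
    fix C assume C: "C \<noteq> {}" "subset.chain ?A C"
    have mem: "avoids_negative_powers p Q" "ring_preordering Q" "T \<subseteq> Q" if "Q \<in> C" for Q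
      using C(2) that unfolding subset.chain_def avoids_negative_powers_def by auto
    have "ring_preordering (\<Union>C)"
      unfolding ring_preordering_def
    proof (intro conjI ballI allI)
      fix x y assume xy: "x \<in> \<Union>C" "y \<in> \<Union>C"
      then obtain Q where "Q \<in> C" "x \<in> Q" "y \<in> Q" using chain_common_member[OF C(2) xy] by blast
      then show "x + y \<in> \<Union>C" "x * y \<in> \<Union>C" using ring_preorderingD(1,2)[OF mem(2)] by blast+
    next
      fix x show "x\<^sup>2 \<in> \<Union>C" using C(1) ring_preorderingD(3)[OF mem(2)] by blast
    qed
    then show "\<Union>C \<in> ?A" using C(1) mem unfolding avoids_negative_powers_def by blast
  qed (use assms in \<open>auto simp: avoids_negative_powers_def\<close>)
  then obtain M where M: "avoids_negative_powers p M" "T \<subseteq> M" "\<forall>Y\<in>?A. M \<subseteq> Y \<longrightarrow> Y = M" by blast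
  have "Q' = M" if "avoids_negative_powers p Q'" "M \<subseteq> Q'" for Q' using M(2,3) that by blast
  from maximal_ring_preordering_prime_cone[OF M(1) this] show ?thesis using M(2) by blast
qed

section \<open>Truncated and full preorderings\<close>

lemma poly_deg_le_iff:
  "poly_deg p \<le> d \<longleftrightarrow> (\<forall>a\<in>Poly_Mapping.keys p. (\<Sum>i\<in>UNIV. Poly_Mapping.lookup a i) \<le> d)"
  by (simp add: poly_deg_def)

lemma poly_deg_add: "poly_deg p \<le> d \<Longrightarrow> poly_deg q \<le> d \<Longrightarrow> poly_deg (p + q) \<le> d"
  unfolding poly_deg_le_iff using Poly_Mapping.keys_add[of p q] by blast

lemma lookup_const_mult: "Poly_Mapping.lookup (poly_const c * p) a = c * Poly_Mapping.lookup p a"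
  unfolding poly_const_def mult_map_scale_conv_mult[symmetric] by (simp add: map.rep_eq when_def)

lemma poly_deg_const_mult: "poly_deg p \<le> d \<Longrightarrow> poly_deg (poly_const c * p) \<le> d"
  unfolding poly_deg_le_iff by (auto simp: in_keys_iff lookup_const_mult)

lemma poly_deg_const: "poly_deg (poly_const c) \<le> d"
  unfolding poly_deg_le_iff poly_const_def by simp

lemma sos_0: "0 \<in> sos"
  unfolding sos_def by (intro CollectI exI[of _ "\<lambda>_. 0"] exI[of _ 0]) simp

lemma sos_add_square:
  assumes "s \<in> sos"
  shows "s + q\<^sup>2 \<in> sos"
proof -
  obtain N and r :: "nat \<Rightarrow> 'a rpoly" where s: "s = (\<Sum>i<N. r i ^ 2)" using assms unfolding sos_def by blast
  have "s + q\<^sup>2 = (\<Sum>i<Suc N. (if i < N then r i else q) ^ 2)" unfolding s by simp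
  then show ?thesis unfolding sos_def
    by (intro CollectI exI[of _ "\<lambda>i. if i < N then r i else q"] exI[of _ "Suc N"]) simp
qed

lemma sos_square: "q\<^sup>2 \<in> sos"
  using sos_add_square[OF sos_0, of q] by simp

lemma sos_induct [consumes 1, case_names zero add]:
  assumes "s \<in> sos" "P 0" "\<And>t q. t \<in> sos \<Longrightarrow> P t \<Longrightarrow> P (t + q\<^sup>2)"
  shows "P s"
proof -
  obtain N and r :: "nat \<Rightarrow> 'a rpoly" where s: "s = (\<Sum>i<N. r i ^ 2)" using assms(1) unfolding sos_def by blast
  have "(\<Sum>i<n. r i ^ 2) \<in> sos \<and> P (\<Sum>i<n. r i ^ 2)" for n
    by (induction n) (auto intro: sos_0 sos_add_square assms(2,3))
  then show ?thesis unfolding s by blast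
qed

lemma sos_add:
  assumes "s \<in> sos" "t \<in> sos"
  shows "s + t \<in> sos"
  using assms(2)
  by (induction t rule: sos_induct) (use assms(1) in \<open>auto simp: sos_add_square simp flip: add.assoc\<close>)

lemma sos_mult:
  assumes "s \<in> sos" "t \<in> sos"
  shows "s * t \<in> sos"
  using assms(2)
proof (induction t rule: sos_induct)
  case (add t q)
  have "s * q\<^sup>2 \<in> sos"
    using assms(1)
  proof (induction s rule: sos_induct)
    case (add u r)
    have "(u + r\<^sup>2) * q\<^sup>2 = u * q\<^sup>2 + (r * q)\<^sup>2" by (simp add: algebra_simps power_mult_distrib)
    then show ?case using sos_add_square[OF add(2), of "r * q"] by simp
  qed (simp add: sos_0)
  then show ?case using add sos_add by (simp add: distrib_left)
qed (simp add: sos_0)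

lemma poly_eval_sos: "s \<in> sos \<Longrightarrow> 0 \<le> poly_eval s x"
  by (induction s rule: sos_induct) (simp_all add: poly_eval_simps)

lemma sos_const: "0 \<le> c \<Longrightarrow> poly_const c \<in> sos"
  using sos_square[of "poly_const (sqrt c)"] by (simp add: power2_eq_square flip: poly_const_simps)

text \<open>
  The set \<open>\<langle>h\<rangle>\<^sub>2\<^sub>k + Pr\<^sub>k(g)\<close> of the \<open>k\<close>-th relaxation.
\<close>
definition trunc_cone ::
  "nat \<Rightarrow> nat \<Rightarrow> (nat \<Rightarrow> 'n::finite rpoly) \<Rightarrow> nat \<Rightarrow> (nat \<Rightarrow> 'n rpoly) \<Rightarrow> 'n rpoly set" where
  "trunc_cone k m1 h m2 g = {p + q | p q. p \<in> trunc_ideal (2 * k) m1 h \<and> q \<in> trunc_preordering k m2 g}"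

lemma trunc_cone_add:
  assumes "x \<in> trunc_cone k m1 h m2 g" "y \<in> trunc_cone k m1 h m2 g"
  shows "x + y \<in> trunc_cone k m1 h m2 g"
proof -
  obtain p q p' q' where xy: "x = p + q" "p \<in> trunc_ideal (2 * k) m1 h" "q \<in> trunc_preordering k m2 g"
    "y = p' + q'" "p' \<in> trunc_ideal (2 * k) m1 h" "q' \<in> trunc_preordering k m2 g"
    using assms unfolding trunc_cone_def by blast
  obtain a a' where a: "p = (\<Sum>i\<in>{1..m1}. a i * h i)" "\<forall>i\<in>{1..m1}. poly_deg (a i * h i) \<le> 2 * k"
    "p' = (\<Sum>i\<in>{1..m1}. a' i * h i)" "\<forall>i\<in>{1..m1}. poly_deg (a' i * h i) \<le> 2 * k"
    using xy(2,5) unfolding trunc_ideal_def by blast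
  have "p + p' = (\<Sum>i\<in>{1..m1}. (a i + a' i) * h i)"
    unfolding a by (simp add: distrib_right sum.distrib)
  moreover have "\<forall>i\<in>{1..m1}. poly_deg ((a i + a' i) * h i) \<le> 2 * k"
    using a(2,4) by (auto simp: distrib_right intro!: poly_deg_add)
  ultimately have p: "p + p' \<in> trunc_ideal (2 * k) m1 h"
    unfolding trunc_ideal_def by (intro CollectI exI[of _ "\<lambda>i. a i + a' i"] conjI)
  obtain s s' where s: "q = (\<Sum>J\<in>Pow {1..m2}. s J * (\<Prod>j\<in>J. g j))"
    "\<forall>J\<in>Pow {1..m2}. s J \<in> sos \<and> poly_deg (s J * (\<Prod>j\<in>J. g j)) \<le> 2 * k"
    "q' = (\<Sum>J\<in>Pow {1..m2}. s' J * (\<Prod>j\<in>J. g j))"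
    "\<forall>J\<in>Pow {1..m2}. s' J \<in> sos \<and> poly_deg (s' J * (\<Prod>j\<in>J. g j)) \<le> 2 * k"
    using xy(3,6) unfolding trunc_preordering_def by blast
  have "q + q' = (\<Sum>J\<in>Pow {1..m2}. (s J + s' J) * (\<Prod>j\<in>J. g j))"
    unfolding s by (simp add: distrib_right sum.distrib)
  moreover have "\<forall>J\<in>Pow {1..m2}. s J + s' J \<in> sos \<and> poly_deg ((s J + s' J) * (\<Prod>j\<in>J. g j)) \<le> 2 * k"
    using s(2,4) by (auto simp: distrib_right intro!: poly_deg_add sos_add)
  ultimately have "q + q' \<in> trunc_preordering k m2 g"
    unfolding trunc_preordering_def by (intro CollectI exI[of _ "\<lambda>J. s J + s' J"] conjI)
  moreover have "x + y = (p + p') + (q + q')" by (simp add: xy)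
  ultimately show ?thesis using p unfolding trunc_cone_def by blast
qed

lemma trunc_cone_scale:
  assumes "x \<in> trunc_cone k m1 h m2 g" "0 \<le> c"
  shows "poly_const c * x \<in> trunc_cone k m1 h m2 g"
proof -
  obtain p q where x: "x = p + q" "p \<in> trunc_ideal (2 * k) m1 h" "q \<in> trunc_preordering k m2 g"
    using assms unfolding trunc_cone_def by blast
  obtain a where a: "p = (\<Sum>i\<in>{1..m1}. a i * h i)" "\<forall>i\<in>{1..m1}. poly_deg (a i * h i) \<le> 2 * k"
    using x(2) unfolding trunc_ideal_def by blast
  have "poly_const c * p = (\<Sum>i\<in>{1..m1}. (poly_const c * a i) * h i)"
    unfolding a by (simp add: sum_distrib_left mult.assoc)
  moreover have "\<forall>i\<in>{1..m1}. poly_deg ((poly_const c * a i) * h i) \<le> 2 * k"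
    using a(2) by (auto simp: mult.assoc intro!: poly_deg_const_mult)
  ultimately have p: "poly_const c * p \<in> trunc_ideal (2 * k) m1 h"
    unfolding trunc_ideal_def by (intro CollectI exI[of _ "\<lambda>i. poly_const c * a i"] conjI)
  obtain s where s: "q = (\<Sum>J\<in>Pow {1..m2}. s J * (\<Prod>j\<in>J. g j))"
    "\<forall>J\<in>Pow {1..m2}. s J \<in> sos \<and> poly_deg (s J * (\<Prod>j\<in>J. g j)) \<le> 2 * k"
    using x(3) unfolding trunc_preordering_def by blast
  have "poly_const c * q = (\<Sum>J\<in>Pow {1..m2}. (poly_const c * s J) * (\<Prod>j\<in>J. g j))"
    unfolding s by (simp add: sum_distrib_left mult.assoc)
  moreover have "\<forall>J\<in>Pow {1..m2}. poly_const c * s J \<in> sos \<and> poly_deg ((poly_const c * s J) * (\<Prod>j\<in>J. g j)) \<le> 2 * k"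
    using s(2) by (auto simp: mult.assoc intro!: poly_deg_const_mult sos_mult sos_const assms(2))
  ultimately have "poly_const c * q \<in> trunc_preordering k m2 g"
    unfolding trunc_preordering_def by (intro CollectI exI[of _ "\<lambda>J. poly_const c * s J"] conjI)
  then show ?thesis using p unfolding trunc_cone_def x(1) distrib_left by blast
qed

lemma trunc_cone_mono:
  assumes "k \<le> k'"
  shows "trunc_cone k m1 h m2 g \<subseteq> trunc_cone k' m1 h m2 g"
proof -
  have "2 * k \<le> 2 * k'" using assms by simp
  then have "trunc_ideal (2 * k) m1 h \<subseteq> trunc_ideal (2 * k') m1 h"
    "trunc_preordering k m2 g \<subseteq> trunc_preordering k' m2 g"
    unfolding trunc_ideal_def trunc_preordering_def by (blast intro: order.trans)+
  then show ?thesis unfolding trunc_cone_def by blast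
qed

lemma trunc_cone_nonneg:
  assumes "y \<in> trunc_cone k m1 h m2 g" "x \<in> feasible_set m1 h m2 g"
  shows "0 \<le> poly_eval y x"
proof -
  have H: "\<And>i. i \<in> {1..m1} \<Longrightarrow> poly_eval (h i) x = 0" and G: "\<And>j. j \<in> {1..m2} \<Longrightarrow> 0 \<le> poly_eval (g j) x"
    using assms(2) by (auto simp: feasible_set_def)
  obtain p q where y: "y = p + q" "p \<in> trunc_ideal (2 * k) m1 h" "q \<in> trunc_preordering k m2 g"
    using assms unfolding trunc_cone_def by blast
  have prod: "0 \<le> poly_eval (\<Prod>j\<in>J. g j) x" if "J \<subseteq> {1..m2}" for J
  proof -
    have "finite J" using that finite_subset by blast
    then show ?thesis using that
      by (induction J rule: finite_induct) (auto simp: poly_eval_simps intro!: mult_nonneg_nonneg G)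
  qed
  have "poly_eval p x = 0" using y(2) H by (auto simp: trunc_ideal_def poly_eval_simps)
  moreover have "0 \<le> poly_eval q x"
  proof -
    obtain s where s: "q = (\<Sum>J\<in>Pow {1..m2}. s J * (\<Prod>j\<in>J. g j))" "\<forall>J\<in>Pow {1..m2}. s J \<in> sos"
      using y(3) unfolding trunc_preordering_def by blast
    show ?thesis unfolding s(1) poly_eval_simps
      by (intro sum_nonneg mult_nonneg_nonneg poly_eval_sos prod) (use s(2) in auto)
  qed
  ultimately show ?thesis by (simp add: y(1) poly_eval_simps)
qed

lemma square_in_trunc_cone:
  assumes "poly_deg (s\<^sup>2) \<le> 2 * k"
  shows "s\<^sup>2 \<in> trunc_cone k m1 h m2 g"
proof -
  have "0 \<in> trunc_ideal (2 * k) m1 h"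
    unfolding trunc_ideal_def by (intro CollectI exI[of _ "\<lambda>_. 0"]) (simp add: poly_deg_def)
  moreover have "s\<^sup>2 \<in> trunc_preordering k m2 g"
  proof -
    let ?s = "\<lambda>J. if J = {} then s\<^sup>2 else 0"
    have "(\<Sum>J\<in>Pow {1..m2}. ?s J * (\<Prod>j\<in>J. g j)) = (\<Sum>J\<in>Pow {1..m2}. if J = {} then s\<^sup>2 else 0)"
      by (rule sum.cong) auto
    also have "\<dots> = s\<^sup>2" by (simp add: sum.delta)
    finally have "s\<^sup>2 = (\<Sum>J\<in>Pow {1..m2}. ?s J * (\<Prod>j\<in>J. g j))" by simp
    moreover have "\<forall>J\<in>Pow {1..m2}. ?s J \<in> sos \<and> poly_deg (?s J * (\<Prod>j\<in>J. g j)) \<le> 2 * k"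
      using assms sos_square sos_0 by (auto simp: poly_deg_def)
    ultimately show ?thesis unfolding trunc_preordering_def by (intro CollectI exI[of _ ?s] conjI)
  qed
  ultimately have "0 + s\<^sup>2 \<in> trunc_cone k m1 h m2 g" unfolding trunc_cone_def by blast
  then show ?thesis by simp
qed

definition full_ideal :: "nat \<Rightarrow> (nat \<Rightarrow> 'n::finite rpoly) \<Rightarrow> 'n rpoly set" where
  "full_ideal m h = {\<Sum>i\<in>{1..m}. \<phi> i * h i | \<phi>. True}"

definition full_preordering :: "nat \<Rightarrow> (nat \<Rightarrow> 'n::finite rpoly) \<Rightarrow> 'n rpoly set" where
  "full_preordering m g = {\<Sum>J\<in>Pow {1..m}. \<sigma> J * (\<Prod>j\<in>J. g j) | \<sigma>. \<forall>J\<in>Pow {1..m}. \<sigma> J \<in> sos}"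

definition full_cone ::
  "nat \<Rightarrow> (nat \<Rightarrow> 'n::finite rpoly) \<Rightarrow> nat \<Rightarrow> (nat \<Rightarrow> 'n rpoly) \<Rightarrow> 'n rpoly set" where
  "full_cone m1 h m2 g = {p + q | p q. p \<in> full_ideal m1 h \<and> q \<in> full_preordering m2 g}"

lemma full_ideal_closed:
  "p \<in> full_ideal m h \<Longrightarrow> q \<in> full_ideal m h \<Longrightarrow> p + q \<in> full_ideal m h"
  "p \<in> full_ideal m h \<Longrightarrow> r * p \<in> full_ideal m h"
  "i \<in> {1..m} \<Longrightarrow> h i \<in> full_ideal m h" "0 \<in> full_ideal m h"
proof -
  show "p + q \<in> full_ideal m h" if "p \<in> full_ideal m h" "q \<in> full_ideal m h" for p q
  proof -
    obtain a b where "p = (\<Sum>i\<in>{1..m}. a i * h i)" "q = (\<Sum>i\<in>{1..m}. b i * h i)"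
      using \<open>p \<in> _\<close> \<open>q \<in> _\<close> unfolding full_ideal_def by blast
    then have "p + q = (\<Sum>i\<in>{1..m}. (a i + b i) * h i)" by (simp add: distrib_right sum.distrib)
    then show ?thesis unfolding full_ideal_def by (intro CollectI exI[of _ "\<lambda>i. a i + b i"]) simp
  qed
  show mult: "r * p \<in> full_ideal m h" if "p \<in> full_ideal m h" for p r
  proof -
    obtain a where "p = (\<Sum>i\<in>{1..m}. a i * h i)" using \<open>p \<in> _\<close> unfolding full_ideal_def by blast
    then have "r * p = (\<Sum>i\<in>{1..m}. (r * a i) * h i)" by (simp add: sum_distrib_left mult.assoc)
    then show ?thesis unfolding full_ideal_def by (intro CollectI exI[of _ "\<lambda>i. r * a i"]) simp
  qed
  show h: "h i \<in> full_ideal m h" if "i \<in> {1..m}" for i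
  proof -
    have "(\<Sum>l\<in>{1..m}. (if l = i then 1 else 0) * h l) = (\<Sum>l\<in>{1..m}. if l = i then h l else 0)"
      by (rule sum.cong) auto
    also have "\<dots> = h i" using that by (simp add: sum.delta)
    finally have "h i = (\<Sum>l\<in>{1..m}. (if l = i then 1 else 0) * h l)" by simp
    then show ?thesis unfolding full_ideal_def
      by (intro CollectI exI[of _ "\<lambda>l. if l = i then 1 else 0"]) simp
  qed
  show "0 \<in> full_ideal m h" unfolding full_ideal_def by (intro CollectI exI[of _ "\<lambda>_. 0"]) simp
qed

lemma full_preordering_add:
  assumes "p \<in> full_preordering m g" "q \<in> full_preordering m g"
  shows "p + q \<in> full_preordering m g"
proof -
  obtain a b where ab: "p = (\<Sum>J\<in>Pow {1..m}. a J * (\<Prod>j\<in>J. g j))" "q = (\<Sum>J\<in>Pow {1..m}. b J * (\<Prod>j\<in>J. g j))"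
    "\<forall>J\<in>Pow {1..m}. a J \<in> sos" "\<forall>J\<in>Pow {1..m}. b J \<in> sos"
    using assms unfolding full_preordering_def by blast
  have "p + q = (\<Sum>J\<in>Pow {1..m}. (a J + b J) * (\<Prod>j\<in>J. g j))"
    unfolding ab by (simp add: distrib_right sum.distrib)
  moreover have "\<forall>J\<in>Pow {1..m}. a J + b J \<in> sos" using ab(3,4) sos_add by blast
  ultimately show ?thesis unfolding full_preordering_def by (intro CollectI exI[of _ "\<lambda>J. a J + b J"] conjI)
qed

lemma full_preordering_term:
  assumes "s \<in> sos" "K \<subseteq> {1..m}"
  shows "s * (\<Prod>j\<in>K. g j) \<in> full_preordering m g"
proof -
  let ?s = "\<lambda>J. if J = K then s else 0"
  have "(\<Sum>J\<in>Pow {1..m}. ?s J * (\<Prod>j\<in>J. g j)) = (\<Sum>J\<in>Pow {1..m}. if J = K then s * (\<Prod>j\<in>J. g j) else 0)"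
    by (rule sum.cong) auto
  also have "\<dots> = s * (\<Prod>j\<in>K. g j)" using assms(2) by (simp add: sum.delta)
  finally have "s * (\<Prod>j\<in>K. g j) = (\<Sum>J\<in>Pow {1..m}. ?s J * (\<Prod>j\<in>J. g j))" by simp
  moreover have "\<forall>J\<in>Pow {1..m}. ?s J \<in> sos" using assms(1) sos_0 by auto
  ultimately show ?thesis unfolding full_preordering_def by (intro CollectI exI[of _ ?s] conjI)
qed

lemma full_preordering_sum:
  "(\<And>i. i \<in> A \<Longrightarrow> f i \<in> full_preordering m g) \<Longrightarrow> sum f A \<in> full_preordering m g"
proof (induction A rule: infinite_finite_induct)
  case (insert x A)
  then show ?case by (simp add: full_preordering_add)
qed (use full_preordering_term[OF sos_0, of "{}" m g] in simp_all)

text \<open>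
  A product of two cross products is again a cross product up to a square, because every
  constraint that occurs twice contributes its square.
\<close>
lemma full_preordering_mult:
  assumes "p \<in> full_preordering m g" "q \<in> full_preordering m g"
  shows "p * q \<in> full_preordering m g"
proof -
  obtain a b where ab: "p = (\<Sum>J\<in>Pow {1..m}. a J * (\<Prod>j\<in>J. g j))" "q = (\<Sum>J\<in>Pow {1..m}. b J * (\<Prod>j\<in>J. g j))"
    "\<forall>J\<in>Pow {1..m}. a J \<in> sos" "\<forall>J\<in>Pow {1..m}. b J \<in> sos"
    using assms unfolding full_preordering_def by blast
  have "(a J * (\<Prod>j\<in>J. g j)) * (b L * (\<Prod>j\<in>L. g j)) \<in> full_preordering m g"
    if J: "J \<in> Pow {1..m}" and L: "L \<in> Pow {1..m}" for J L
  proof -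
    have fin: "finite J" "finite L" using J L finite_subset by auto
    let ?I = "\<Prod>j\<in>J \<inter> L. g j"
    have "(\<Prod>j\<in>J. g j) = ?I * (\<Prod>j\<in>J - L. g j)" "(\<Prod>j\<in>L. g j) = ?I * (\<Prod>j\<in>L - J. g j)"
      using prod.Int_Diff[OF fin(1), of g L] prod.Int_Diff[OF fin(2), of g J] by (simp_all add: Int_commute)
    moreover have "(\<Prod>j\<in>(J - L) \<union> (L - J). g j) = (\<Prod>j\<in>J - L. g j) * (\<Prod>j\<in>L - J. g j)"
      using fin by (intro prod.union_disjoint) auto
    ultimately have "(a J * (\<Prod>j\<in>J. g j)) * (b L * (\<Prod>j\<in>L. g j)) =
        (a J * b L * ?I\<^sup>2) * (\<Prod>j\<in>(J - L) \<union> (L - J). g j)"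
      by (simp add: power2_eq_square mult_ac)
    moreover have "a J * b L * ?I\<^sup>2 \<in> sos" using ab(3,4) J L by (intro sos_mult sos_square) auto
    ultimately show ?thesis using full_preordering_term[of _ "(J - L) \<union> (L - J)" m g] J L by auto
  qed
  then show ?thesis unfolding ab(1,2) sum_product by (intro full_preordering_sum)
qed

lemma ring_preordering_full_cone: "ring_preordering (full_cone m1 h m2 g)"
  unfolding ring_preordering_def
proof (intro conjI ballI allI)
  fix x y assume "x \<in> full_cone m1 h m2 g" "y \<in> full_cone m1 h m2 g"
  then obtain p q p' q' where xy: "x = p + q" "p \<in> full_ideal m1 h" "q \<in> full_preordering m2 g"
    "y = p' + q'" "p' \<in> full_ideal m1 h" "q' \<in> full_preordering m2 g"
    unfolding full_cone_def by blast
  have "x + y = (p + p') + (q + q')" by (simp add: xy)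
  moreover have "p + p' \<in> full_ideal m1 h" "q + q' \<in> full_preordering m2 g"
    using xy full_ideal_closed(1) full_preordering_add by blast+
  ultimately show "x + y \<in> full_cone m1 h m2 g" unfolding full_cone_def by blast
  have "x * y = (y * p + q * p') + q * q'" by (simp add: xy algebra_simps)
  moreover have "y * p + q * p' \<in> full_ideal m1 h"
    by (intro full_ideal_closed(1) full_ideal_closed(2) xy(2,5))
  moreover have "q * q' \<in> full_preordering m2 g" by (intro full_preordering_mult xy(3,6))
  ultimately show "x * y \<in> full_cone m1 h m2 g" unfolding full_cone_def by blast
next
  fix x :: "'a rpoly"
  have "x\<^sup>2 * (\<Prod>j\<in>{}. g j) \<in> full_preordering m2 g" by (rule full_preordering_term[OF sos_square]) simp
  then show "x\<^sup>2 \<in> full_cone m1 h m2 g" unfolding full_cone_def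
    by (intro CollectI exI[of _ 0] exI[of _ "x\<^sup>2"]) (simp add: full_ideal_closed(4))
qed

lemma generators_in_full_cone:
  "i \<in> {1..m1} \<Longrightarrow> h i \<in> full_cone m1 h m2 g" "i \<in> {1..m1} \<Longrightarrow> - h i \<in> full_cone m1 h m2 g"
  "j \<in> {1..m2} \<Longrightarrow> g j \<in> full_cone m1 h m2 g"
proof -
  have 0: "0 \<in> full_preordering m2 g" using full_preordering_term[OF sos_0, of "{}" m2 g] by simp
  have I: "p \<in> full_cone m1 h m2 g" if "p \<in> full_ideal m1 h" for p
    using that 0 unfolding full_cone_def by force
  show "i \<in> {1..m1} \<Longrightarrow> h i \<in> full_cone m1 h m2 g" by (intro I full_ideal_closed(3))
  show "- h i \<in> full_cone m1 h m2 g" if "i \<in> {1..m1}"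
    using I[OF full_ideal_closed(2)[OF full_ideal_closed(3)[OF that], of "- 1" h]] by simp
  assume j: "j \<in> {1..m2}"
  have "1 \<in> sos" using sos_square[of 1] by simp
  from full_preordering_term[OF this, of "{j}" m2 g] j have "g j \<in> full_preordering m2 g" by simp
  then show "g j \<in> full_cone m1 h m2 g" using full_ideal_closed(4) unfolding full_cone_def by force
qed

text \<open>
  Any given representation has finitely many terms, hence bounded degree.
\<close>
lemma full_cone_truncated:
  assumes "x \<in> full_cone m1 h m2 g"
  shows "\<exists>k. x \<in> trunc_cone k m1 h m2 g"
proof -
  obtain a s where x: "x = (\<Sum>i\<in>{1..m1}. a i * h i) + (\<Sum>J\<in>Pow {1..m2}. s J * (\<Prod>j\<in>J. g j))"
    and s: "\<forall>J\<in>Pow {1..m2}. s J \<in> sos"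
    using assms unfolding full_cone_def full_ideal_def full_preordering_def by blast
  define k where "k = (\<Sum>i\<in>{1..m1}. poly_deg (a i * h i)) + (\<Sum>J\<in>Pow {1..m2}. poly_deg (s J * (\<Prod>j\<in>J. g j)))"
  have "\<forall>i\<in>{1..m1}. poly_deg (a i * h i) \<le> 2 * k"
  proof
    fix i assume "i \<in> {1..m1}"
    then have "poly_deg (a i * h i) \<le> (\<Sum>i\<in>{1..m1}. poly_deg (a i * h i))" by (intro member_le_sum) auto
    then show "poly_deg (a i * h i) \<le> 2 * k" by (simp add: k_def)
  qed
  then have "(\<Sum>i\<in>{1..m1}. a i * h i) \<in> trunc_ideal (2 * k) m1 h" unfolding trunc_ideal_def by blast
  moreover have "\<forall>J\<in>Pow {1..m2}. s J \<in> sos \<and> poly_deg (s J * (\<Prod>j\<in>J. g j)) \<le> 2 * k"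
  proof (intro ballI conjI)
    fix J assume J: "J \<in> Pow {1..m2}"
    then have "poly_deg (s J * (\<Prod>j\<in>J. g j)) \<le> (\<Sum>J\<in>Pow {1..m2}. poly_deg (s J * (\<Prod>j\<in>J. g j)))"
      by (intro member_le_sum) auto
    then show "poly_deg (s J * (\<Prod>j\<in>J. g j)) \<le> 2 * k" by (simp add: k_def)
    show "s J \<in> sos" using s J by blast
  qed
  then have "(\<Sum>J\<in>Pow {1..m2}. s J * (\<Prod>j\<in>J. g j)) \<in> trunc_preordering k m2 g"
    unfolding trunc_preordering_def by blast
  ultimately show ?thesis unfolding trunc_cone_def x by blast
qed


section \<open>The Positivstellensatz\<close>

text \<open>
  Otherwise a prime cone would contain all constraints but not have \<open>p\<close> in its support. A real point
  realizing the signs of \<open>\<plusminus> h\<^sub>i\<close>, \<open>g\<^sub>j\<close> and \<open>\<plusminus> p\<close> is feasible, and \<open>p\<close> is not zero there.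
\<close>
theorem positivstellensatz_vanishing:
  fixes p :: "'n::finite rpoly"
  assumes "\<And>x. x \<in> feasible_set m1 h m2 g \<Longrightarrow> poly_eval p x = 0"
  shows "\<exists>l. - (p ^ (2 * l)) \<in> full_cone m1 h m2 g"
proof (rule ccontr)
  assume "\<nexists>l. - (p ^ (2 * l)) \<in> full_cone m1 h m2 g"
  then obtain P where P: "prime_cone P" "full_cone m1 h m2 g \<subseteq> P" "p \<notin> cone_support P"
    using ring_preordering_in_prime_cone[OF ring_preordering_full_cone, of p m1 h m2 g] by blast
  let ?G = "h ` {1..m1} \<union> (\<lambda>i. - h i) ` {1..m1} \<union> g ` {1..m2} \<union> {p, - p}"
  have "finite ?G" by simp
  then obtain x where x: "\<forall>f\<in>?G. f \<in> P \<longleftrightarrow> 0 \<le> poly_eval f x"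
    using prime_cone_realizable[OF P(1)] unfolding realizable_def by meson
  note gen = generators_in_full_cone(1,2)[of _ m1 h m2 g, THEN subsetD[OF P(2)]]
    generators_in_full_cone(3)[of _ m2 g m1 h, THEN subsetD[OF P(2)]]
  have "poly_eval (h i) x = 0" if i: "i \<in> {1..m1}" for i
  proof -
    have "0 \<le> poly_eval (h i) x" "0 \<le> poly_eval (- h i) x" using x gen(1,2)[OF i] i by blast+
    then show ?thesis by (simp add: poly_eval_simps)
  qed
  moreover have "0 \<le> poly_eval (g j) x" if "j \<in> {1..m2}" for j using x gen(3)[OF that] that by blast
  ultimately have "poly_eval p x = 0" by (intro assms) (simp add: feasible_set_def)
  then have "p \<in> P" "- p \<in> P" using x by (simp_all add: poly_eval_simps)
  then show False using P(3) by (simp add: cone_support_def)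
qed


section \<open>Finite convergence\<close>

lemma poly_eval_prod: "poly_eval (prod f A) x = (\<Prod>i\<in>A. poly_eval (f i) x)"
  by (induction A rule: infinite_finite_induct) (simp_all add: poly_eval_simps)

text \<open>
  The products of the squared distances to the earlier points vanish exactly at these points, which allows
  the values to be corrected one point at a time.
\<close>
lemma interpolation:
  fixes K :: "(real ^ 'n::finite) set"
  assumes "finite K"
  shows "\<exists>q. \<forall>u\<in>K. poly_eval q u = v u"
  using assms
proof (induction K rule: finite_induct)
  case (insert u K)
  then obtain q where q: "\<forall>w\<in>K. poly_eval q w = v w" by blast
  define d where "d = (\<lambda>w :: real ^ 'n. \<Sum>i\<in>UNIV. (poly_var i - poly_const (w $ i))\<^sup>2)"
  have d: "poly_eval (d w) x = 0 \<longleftrightarrow> x = w" for w x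
    by (simp add: d_def poly_eval_simps sum_nonneg_eq_0_iff vec_eq_iff)
  define D where "D = prod d K"
  have D: "poly_eval D x = 0 \<longleftrightarrow> x \<in> K" for x
    unfolding D_def poly_eval_prod using insert.hyps(1) by (simp add: d)
  let ?q = "q + poly_const ((v u - poly_eval q u) / poly_eval D u) * D"
  have "poly_eval D u \<noteq> 0" using D insert.hyps by blast
  then have "poly_eval ?q w = v w" if "w \<in> insert u K" for w
    using that q D[of w] by (auto simp: poly_eval_simps)
  then show ?case by blast
qed simp

text \<open>
  Descent along the powers \<open>u = p\<^sup>t\<close> with \<open>t = 2\<^sup>j\<close>: if \<open>\<delta> - u\<^sup>2 \<in> V\<close> for all \<open>\<delta> > 0\<close>, then completing the
  square, \<open>\<epsilon> - u = (a - u / (2 a))\<^sup>2 + (\<epsilon>\<^sup>2 - u\<^sup>2) / (2 \<epsilon>)\<close> with \<open>a\<^sup>2 = \<epsilon> / 2\<close>, gives \<open>\<epsilon> - u \<in> V\<close> for all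
  \<open>\<epsilon> > 0\<close>. The descent starts from \<open>- p\<^sup>t \<in> V\<close> for the largest exponent. The set \<open>V\<close> stands for a
  truncated cone, which is closed under sums and nonnegative multiples but not under products.
\<close>
lemma epsilon_minus_in_cone:
  fixes p :: "'n::finite rpoly" and V :: "'n rpoly set"
  assumes add: "\<And>x y. x \<in> V \<Longrightarrow> y \<in> V \<Longrightarrow> x + y \<in> V"
    and scale: "\<And>c x. 0 \<le> c \<Longrightarrow> x \<in> V \<Longrightarrow> poly_const c * x \<in> V"
    and sq: "\<And>a b j. j \<le> r \<Longrightarrow> (poly_const a + poly_const b * p ^ (2 ^ j))\<^sup>2 \<in> V"
    and top: "- (p ^ (2 ^ r)) \<in> V"
    and "0 < \<epsilon>"
  shows "poly_const \<epsilon> - p \<in> V"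
proof -
  have "\<forall>\<epsilon>>0. poly_const \<epsilon> - p ^ (2 ^ (r - i)) \<in> V" if "i \<le> r" for i
    using that
  proof (induction i)
    case 0
    show ?case
    proof (intro allI impI)
      fix \<epsilon> :: real assume "0 < \<epsilon>"
      then have "poly_const \<epsilon> \<in> V" using sq[of 0 "sqrt \<epsilon>" 0]
        by (simp add: poly_const_simps(1)) (simp add: power2_eq_square flip: poly_const_simps)
      from add[OF this top] show "poly_const \<epsilon> - p ^ (2 ^ (r - 0)) \<in> V" by simp
    qed
  next
    case (Suc i)
    define j where "j = r - Suc i"
    have j: "r - i = Suc j" "j \<le> r" using Suc.prems by (auto simp: j_def)
    show ?case
      unfolding j_def[symmetric]
    proof (intro allI impI)
      fix \<epsilon> :: real assume \<epsilon>: "0 < \<epsilon>"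
      define a where "a = sqrt (\<epsilon> / 2)"
      define b where "b = - 1 / (2 * a)"
      define u where "u = p ^ (2 ^ j)"
      have a: "a > 0" "a * a = \<epsilon> / 2" using \<epsilon> by (auto simp: a_def)
      have ab: "2 * (a * b) = - 1" using a by (simp add: b_def)
      have "b * b = 1 / (4 * (a * a))" using a(1) by (simp add: b_def)
      then have bb: "b * b = 1 / (2 * \<epsilon>)" unfolding a(2) by simp
      have "\<forall>\<delta>>0. poly_const \<delta> - u * u \<in> V"
        using Suc.IH Suc.prems unfolding j by (simp add: u_def power_add mult_2 flip: power_add)
      moreover have "0 < \<epsilon> * \<epsilon>" using \<epsilon> by simp
      ultimately have "poly_const (\<epsilon> * \<epsilon>) - u * u \<in> V" by blast
      then have "poly_const (b * b) * (poly_const (\<epsilon> * \<epsilon>) - u * u) \<in> V" by (rule scale[rotated]) simp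
      from add[OF sq[OF j(2), of a b] this]
      have mem: "(poly_const a + poly_const b * u)\<^sup>2 + poly_const (b * b) * (poly_const (\<epsilon> * \<epsilon>) - u * u) \<in> V"
        by (simp add: u_def)
      have "(poly_const a + poly_const b * u)\<^sup>2 + poly_const (b * b) * (poly_const (\<epsilon> * \<epsilon>) - u * u) =
          poly_const (a * a + b * b * (\<epsilon> * \<epsilon>)) + poly_const (2 * (a * b)) * u"
      proof -
        have "poly_const (2 * (a * b)) = poly_const (a * b) + (poly_const (a * b) :: 'n rpoly)"
          by (simp flip: poly_const_simps)
        then show ?thesis by (simp add: poly_const_simps power2_eq_square algebra_simps)
      qed
      also have "a * a + b * b * (\<epsilon> * \<epsilon>) = \<epsilon>" unfolding a(2) bb using \<epsilon> by simp
      also have "poly_const \<epsilon> + poly_const (2 * (a * b)) * u = poly_const \<epsilon> - u"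
        unfolding ab by (simp add: poly_const_simps)
      finally show "poly_const \<epsilon> - p ^ (2 ^ j) \<in> V" using mem by (simp add: u_def)
    qed
  qed
  from this[of r] show ?thesis using \<open>0 < \<epsilon>\<close> by simp
qed

theorem theorem4p1:
  fixes f :: "'n::finite rpoly"
    and h g :: "nat \<Rightarrow> 'n rpoly"
    and m1 m2 :: nat
  assumes "finite (feasible_set m1 h m2 g)"
  shows "finite_convergence (f_pre f m1 h m2 g) (f_min f m1 h m2 g)"
proof -
  let ?K = "feasible_set m1 h m2 g" and ?T = "full_cone m1 h m2 g"
  let ?V = "\<lambda>k. trunc_cone k m1 h m2 g"
  note T = ring_preorderingD[OF ring_preordering_full_cone[of m1 h m2 g]]
  have pre: "f_pre f m1 h m2 g k = (SUP \<gamma>\<in>{\<gamma>. f - poly_const \<gamma> \<in> ?V k}. ereal \<gamma>)" for k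
    unfolding f_pre_def trunc_cone_def by (rule arg_cong[where f = Sup]) blast
  have upper: "f_pre f m1 h m2 g k \<le> f_min f m1 h m2 g" for k
    unfolding pre f_min_def
  proof (intro SUP_least INF_greatest)
    fix \<gamma> x assume "\<gamma> \<in> {\<gamma>. f - poly_const \<gamma> \<in> ?V k}" "x \<in> ?K"
    then have "0 \<le> poly_eval (f - poly_const \<gamma>) x" using trunc_cone_nonneg by blast
    then show "ereal \<gamma> \<le> ereal (poly_eval f x)" by (simp add: poly_eval_simps)
  qed
  have lower: "ereal \<gamma> \<le> f_pre f m1 h m2 g k" if "f - poly_const \<gamma> \<in> ?V k" for \<gamma> k
    unfolding pre using that by (intro SUP_upper) simp
  have "\<exists>k. f_min f m1 h m2 g \<le> f_pre f m1 h m2 g k"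
  proof (cases "?K = {}")
    case True
    then obtain l where "- (1 ^ (2 * l)) \<in> ?T" using positivstellensatz_vanishing[of m1 h m2 g 1] by blast
    then have m1: "- 1 \<in> ?T" by simp
    define e where "e = poly_const (1 / 2) * (f + 1)"
    define e' where "e' = poly_const (1 / 2) * (f - 1)"
    \<comment> \<open>\<open>f = ((f + 1) / 2)\<^sup>2 - ((f - 1) / 2)\<^sup>2\<close>, where the minus sign is the factor \<open>-1\<close> from the cone\<close>
    have "e\<^sup>2 + - 1 * e'\<^sup>2 = (poly_const (1 / 2) * poly_const (1 / 2)) * (f + f + f + f)"
      unfolding e_def e'_def by (simp add: power2_eq_square algebra_simps)
    also have "f + f + f + f = poly_const 4 * f"
    proof -
      have "poly_const 4 = (1 + 1 + 1 + 1 :: 'n rpoly)" by (simp flip: poly_const_simps)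
      then show ?thesis by (simp add: algebra_simps)
    qed
    also have "(poly_const (1 / 2) * poly_const (1 / 2)) * (poly_const 4 * f) = f"
      by (simp add: mult.assoc[symmetric] flip: poly_const_simps) (simp add: poly_const_simps)
    finally have "f = e\<^sup>2 + - 1 * e'\<^sup>2" by simp
    also have "\<dots> \<in> ?T" by (intro T m1)
    finally obtain k1 k2 k3 where k: "f \<in> ?V k1" "- 1 \<in> ?V k2" "1 \<in> ?V k3"
      using full_cone_truncated m1 T(5) by meson
    define k where "k = max k1 (max k2 k3)"
    have le: "k1 \<le> k" "k2 \<le> k" "k3 \<le> k" by (auto simp: k_def)
    note V = subsetD[OF trunc_cone_mono[OF le(1)] k(1)] subsetD[OF trunc_cone_mono[OF le(2)] k(2)]
      subsetD[OF trunc_cone_mono[OF le(3)] k(3)]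
    have "f - poly_const \<gamma> \<in> ?V k" for \<gamma>
    proof (cases "0 \<le> \<gamma>")
      case True
      from trunc_cone_add[OF V(1) trunc_cone_scale[OF V(2) True]] show ?thesis by simp
    next
      case False
      then have "0 \<le> - \<gamma>" by simp
      from trunc_cone_add[OF V(1) trunc_cone_scale[OF V(3) this]] show ?thesis by (simp add: poly_const_simps)
    qed
    then have "ereal \<gamma> \<le> f_pre f m1 h m2 g k" for \<gamma> using lower by blast
    then have "f_pre f m1 h m2 g k = \<infinity>" by (metis ereal_top)
    then show ?thesis by (intro exI[of _ k]) simp
  next
    case False
    define m where "m = Min (poly_eval f ` ?K)"
    have min: "m \<in> poly_eval f ` ?K" "\<And>x. x \<in> ?K \<Longrightarrow> m \<le> poly_eval f x"
      unfolding m_def using assms False by (auto intro!: Min_in)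
    have fmin: "f_min f m1 h m2 g \<le> ereal m"
      using min(1) unfolding f_min_def by (auto intro: INF_lower2)
    obtain q where q: "\<forall>u\<in>?K. poly_eval q u = sqrt (poly_eval f u - m)"
      using interpolation[OF assms, of "\<lambda>u. sqrt (poly_eval f u - m)"] by blast
    define p where "p = q\<^sup>2 - (f - poly_const m)"
    have "poly_eval p u = 0" if "u \<in> ?K" for u
      using q min(2)[OF that] that by (simp add: p_def poly_eval_simps)
    then obtain l where l: "- (p ^ (2 * l)) \<in> ?T" using positivstellensatz_vanishing[of m1 h m2 g p] by blast
    \<comment> \<open>the descent needs an exponent that is a power of two; the missing factor is an even power of \<open>p\<close>\<close>
    define r where "r = Suc l"
    have "2 * l \<le> 2 ^ r" using less_exp[of l] by (simp add: r_def)
    moreover have "even (2 ^ r - 2 * l :: nat)" by (simp add: r_def)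
    ultimately obtain d where d: "(2::nat) ^ r = 2 * l + 2 * d"
      by (metis dvdE le_add_diff_inverse)
    have "- (p ^ (2 ^ r)) = - (p ^ (2 * l)) * p ^ (2 * d)" unfolding d by (simp add: power_add)
    also have "\<dots> \<in> ?T" by (intro T(2,6) l)
    finally obtain k1 where k1: "- (p ^ (2 ^ r)) \<in> ?V k1" using full_cone_truncated by blast
    obtain k2 where k2: "q\<^sup>2 \<in> ?V k2" using full_cone_truncated[OF T(3)] by blast
    define k3 where "k3 = (\<Sum>j\<le>r. poly_deg (p ^ (2 ^ j)) + poly_deg (p ^ (2 ^ j) * p ^ (2 ^ j)))"
    define k where "k = max k1 (max k2 k3)"
    have le: "k1 \<le> k" "k2 \<le> k" by (auto simp: k_def)
    note V = subsetD[OF trunc_cone_mono[OF le(1)] k1] subsetD[OF trunc_cone_mono[OF le(2)] k2]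
    have sq: "(poly_const a + poly_const b * p ^ (2 ^ j))\<^sup>2 \<in> ?V k" if j: "j \<le> r" for a b j
    proof (rule square_in_trunc_cone)
      let ?u = "p ^ (2 ^ j)"
      have "poly_deg ?u + poly_deg (?u * ?u) \<le> k3" unfolding k3_def using j by (intro member_le_sum) auto
      then have deg: "poly_deg ?u \<le> 2 * k" "poly_deg (?u * ?u) \<le> 2 * k" by (auto simp: k_def)
      have "(poly_const a + poly_const b * ?u)\<^sup>2 =
          poly_const (a * a) + (poly_const (a * b) * ?u + (poly_const (a * b) * ?u + poly_const (b * b) * (?u * ?u)))"
        unfolding poly_const_simps(4) power2_eq_square by (simp only: algebra_simps)
      then show "poly_deg ((poly_const a + poly_const b * ?u)\<^sup>2) \<le> 2 * k"
        by (simp only:) (intro poly_deg_add poly_deg_const_mult poly_deg_const deg)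
    qed
    have feas: "f - poly_const (m - \<epsilon>) \<in> ?V k" if "0 < \<epsilon>" for \<epsilon>
    proof -
      have "poly_const \<epsilon> - p \<in> ?V k"
        by (rule epsilon_minus_in_cone[where r = r])
           (use trunc_cone_add trunc_cone_scale sq V(1) that in auto)
      from trunc_cone_add[OF V(2) this] show ?thesis
        by (simp add: p_def poly_const_simps algebra_simps)
    qed
    have "ereal m \<le> f_pre f m1 h m2 g k"
    proof (rule dense_le)
      fix y assume y: "y < ereal m"
      show "y \<le> f_pre f m1 h m2 g k"
      proof (cases y)
        case (real c)
        then show ?thesis using lower[OF feas[of "m - c"]] y by simp
      qed (use y in auto)
    qed
    then show ?thesis using fmin order.trans by blast
  qed
  then obtain k where "f_min f m1 h m2 g \<le> f_pre f m1 h m2 g k" by blast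
  then have "f_pre f m1 h m2 g k = f_min f m1 h m2 g" using upper antisym by blast
  then show ?thesis unfolding finite_convergence_def by blast
qed

end
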